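(* Assume $e=0$ (i.e. $a_0=a_1$). Let $D=\{L_1,\dots,L_a,C_1,\dots,C_b\}$ be an arrangement of $a\ge0$ lines and $b\ge0$ rational curves on $X$, with $L_i\in|\mathcal O_X(f)|$ and $C_j\in|\mathcal O_X(H-a_1f)|$. Then $$\Omega_X^1(\log D)\cong\mathcal O_X((a-2)f)\oplus\mathcal O_X((b-2)H+(c-ba_1)f).$$
   Context: The base field is algebraically closed of characteristic $0$. Let $0<a_0\le a_1$ be integers, $\mathcal E=\mathcal O_{\mathbf P^1}(a_0)\oplus\mathcal O_{\mathbf P^1}(a_1)$, and let $X=S(a_0,a_1)$ be the smooth rational normal scroll surface, i.e. the image of $\mathbf P(\mathcal E)$ under the embedding given by $\mathcal O_{\mathbf P(\mathcal E)}(1)$; let $\pi:X\cong\mathbf P(\mathcal E)\to\mathbf P^1$ be the projection. $H$ is the class of $\mathcal O_{\mathbf P(\mathcal E)}(1)$ (hyperplane class) and $f$ the class of $\pi^*\mathcal O_{\mathbf P^1}(1)$ (fibre class); $\mathrm{Pic}(X)=\mathbf Z\langle H,f\rangle$. Put $c=a_0+a_1$ and $e=a_1-a_0$. An arrangement on $X$ is a finite set $D=\{D_1,\dots,D_m\}$ of smooth irreducible divisors of $X$ with $D_i\ne D_j$ for $i\neq j$. $\Omega_X^1(\log D)$ denotes the logarithmic sheaf of $D$, i.e. the sheaf of differential $1$-forms with logarithmic poles along $\bigcup_i D_i$; when $D$ has simple normal crossings it is locally free and fits into the residue sequence $0\to\Omega_X^1\to\Omega_X^1(\log D)\to\bigoplus_i\mathcal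 O_{D_i}\to0$. *)

theory Defs
  imports
    "HOL-Analysis.Abstract_Topology"
    "HOL-Analysis.Function_Topology"
    "HOL-Computational_Algebra.Polynomial"
    "HOL-Algebra.Module"
begin

section \<open>Projective space and its locally closed subvarieties\<close>

text \<open>
  Vectors of \<open>k^(N+1)\<close> are functions \<open>nat \<Rightarrow> 'k\<close> vanishing beyond \<open>N\<close>.  A point of projective
  \<open>N\<close>-space is the set of all its vectors of homogeneous coordinates, so \<open>v \<in> p\<close> reads
  ``\<open>v\<close> represents \<open>p\<close>''.
\<close>

type_synonym 'k ppoint = "(nat \<Rightarrow> 'k) set"

definition kvec :: "nat \<Rightarrow> (nat \<Rightarrow> 'k::field) set"
  where "kvec N = {v. \<forall>i>N. v i = 0}"

definition hclass :: "(nat \<Rightarrow> 'k::field) \<Rightarrow> 'k ppoint"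
  where "hclass v = {(\<lambda>i. c * v i) | c. c \<noteq> 0}"

definition proj :: "nat \<Rightarrow> 'k::field ppoint set"
  where "proj N = hclass ` (kvec N - {\<lambda>_. 0})"

text \<open>
  Forms of degree \<open>d\<close>, and of bidegree \<open>(d, e)\<close>, as polynomial functions; all ground fields
  below are infinite, so nothing is lost by not using formal polynomials.
\<close>

definition hpoly :: "nat \<Rightarrow> nat \<Rightarrow> ((nat \<Rightarrow> 'k::field) \<Rightarrow> 'k) set"
  where "hpoly N d = {P. \<exists>A c. finite A \<and> (\<forall>\<alpha>\<in>A. (\<Sum>i\<le>N. \<alpha> i) = d) \<and>
           P = (\<lambda>v. \<Sum>\<alpha>\<in>A. c \<alpha> * (\<Prod>i\<le>N. v i ^ \<alpha> i))}"

definition bihpoly :: "nat \<Rightarrow> nat \<Rightarrow> nat \<Rightarrow> nat \<Rightarrow> ((nat \<Rightarrow> 'k::field) \<Rightarrow> (nat \<Rightarrow> 'k) \<Rightarrow> 'k) set"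
  where "bihpoly N M d e =
           {P. \<exists>A c. finite A \<and> (\<forall>(\<alpha>, \<beta>)\<in>A. (\<Sum>i\<le>N. \<alpha> i) = d \<and> (\<Sum>j\<le>M. \<beta> j) = e) \<and>
             P = (\<lambda>v w. \<Sum>(\<alpha>, \<beta>)\<in>A. c (\<alpha>, \<beta>) * (\<Prod>i\<le>N. v i ^ \<alpha> i) * (\<Prod>j\<le>M. w j ^ \<beta> j))}"

definition zariski :: "nat \<Rightarrow> 'k::field ppoint topology"
  where "zariski N =
           topology_generated_by {{p \<in> proj N. \<forall>v\<in>p. F v \<noteq> 0} | d F. F \<in> hpoly N d}"

text \<open>
  A space with a sheaf of \<open>'k\<close>-valued functions.  A section over \<open>U\<close> is a total function that
  is \<open>0\<close> outside \<open>U\<close>; the same normalisation is used for all sheaves below, so that sections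
  over \<open>U\<close> are equal iff they agree on \<open>U\<close>.
\<close>

record ('p, 'k) kspace =
  ktop :: "'p topology"
  kreg :: "'p set \<Rightarrow> ('p \<Rightarrow> 'k) set"

definition pvariety :: "nat \<Rightarrow> 'k::field ppoint set \<Rightarrow> ('k ppoint, 'k) kspace"
  where "pvariety N Y =
    \<lparr> ktop = subtopology (zariski N) Y,
      kreg = (\<lambda>U. {f. (\<forall>p. p \<notin> U \<longrightarrow> f p = 0) \<and>
        (\<forall>p\<in>U. \<exists>V. openin (subtopology (zariski N) Y) V \<and> p \<in> V \<and> V \<subseteq> U \<and>
          (\<exists>d. \<exists>P\<in>hpoly N d. \<exists>Q\<in>hpoly N d.
            \<forall>q\<in>V. \<forall>v\<in>q. Q v \<noteq> 0 \<and> f q = P v / Q v))}) \<rparr>"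

definition kspace_isomorphic ::
    "('p, 'k::field) kspace \<Rightarrow> 'p set \<Rightarrow> ('q, 'k) kspace \<Rightarrow> 'q set \<Rightarrow> bool"
  where "kspace_isomorphic X V Z W \<longleftrightarrow>
    (\<exists>\<phi>. bij_betw \<phi> V W \<and>
      (\<forall>U\<subseteq>V. openin (ktop X) U \<longleftrightarrow> openin (ktop Z) (\<phi> ` U)) \<and>
      (\<forall>U\<subseteq>V. openin (ktop X) U \<longrightarrow> (\<forall>r. (\<forall>z. z \<notin> \<phi> ` U \<longrightarrow> r z = 0) \<longrightarrow>
        (r \<in> kreg Z (\<phi> ` U) \<longleftrightarrow> (\<lambda>x. if x \<in> U then r (\<phi> x) else 0) \<in> kreg X U))))"

definition irreducible_set :: "'p topology \<Rightarrow> 'p set \<Rightarrow> bool"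
  where "irreducible_set T Y \<longleftrightarrow> Y \<subseteq> topspace T \<and> Y \<noteq> {} \<and>
    (\<forall>A B. closedin T A \<and> closedin T B \<and> Y \<subseteq> A \<union> B \<longrightarrow> Y \<subseteq> A \<or> Y \<subseteq> B)"

text \<open>For irreducible varieties: isomorphic nonempty open subsets.\<close>

definition birational :: "('p, 'k::field) kspace \<Rightarrow> ('q, 'k) kspace \<Rightarrow> bool"
  where "birational X Z \<longleftrightarrow>
    (\<exists>V W. openin (ktop X) V \<and> V \<noteq> {} \<and> openin (ktop Z) W \<and> W \<noteq> {} \<and>
      kspace_isomorphic X V Z W)"

definition line_in :: "nat \<Rightarrow> 'k::field ppoint set \<Rightarrow> bool"
  where "line_in N L \<longleftrightarrow>
    (\<exists>u\<in>kvec N. \<exists>v\<in>kvec N.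
      (\<forall>\<alpha> \<beta>. (\<lambda>i. \<alpha> * u i + \<beta> * v i) = (\<lambda>_. 0) \<longrightarrow> \<alpha> = 0 \<and> \<beta> = 0) \<and>
      L = {hclass (\<lambda>i. \<alpha> * u i + \<beta> * v i) | \<alpha> \<beta>. \<not> (\<alpha> = 0 \<and> \<beta> = 0)})"

definition rational_curve :: "nat \<Rightarrow> 'k::field ppoint set \<Rightarrow> bool"
  where "rational_curve N Y \<longleftrightarrow>
    closedin (zariski N) Y \<and> irreducible_set (zariski N) Y \<and>
    birational (pvariety N Y) (pvariety 1 (proj 1))"

section \<open>Sheaves of modules\<close>

definition kring :: "('p, 'k::field) kspace \<Rightarrow> 'p set \<Rightarrow> ('p \<Rightarrow> 'k) ring"
  where "kring X U =
    \<lparr> carrier = kreg X U,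
      monoid.mult = (\<lambda>f g p. f p * g p),
      one = (\<lambda>p. if p \<in> U then 1 else 0),
      zero = (\<lambda>p. 0),
      add = (\<lambda>f g p. f p + g p) \<rparr>"

text \<open>
  Sections over an open set \<open>U\<close> (a module over \<^term>\<open>kring X U\<close>), and the restriction
  \<open>ores F U V\<close> from \<open>U\<close> to \<open>V \<subseteq> U\<close>.  The fields \<open>mult\<close> and \<open>one\<close> that module records inherit
  from ring records are never used.
\<close>

record ('p, 'k, 's) omodule =
  osec :: "'p set \<Rightarrow> ('p \<Rightarrow> 'k, 's) module"
  ores :: "'p set \<Rightarrow> 'p set \<Rightarrow> 's \<Rightarrow> 's"

definition omodule_isomorphic ::
    "('p, 'k::field) kspace \<Rightarrow> ('p, 'k, 's) omodule \<Rightarrow> ('p, 'k, 't) omodule \<Rightarrow> bool"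
  where "omodule_isomorphic X F G \<longleftrightarrow>
    (\<exists>\<phi>.
      (\<forall>U. openin (ktop X) U \<longrightarrow>
        bij_betw (\<phi> U) (carrier (osec F U)) (carrier (osec G U)) \<and>
        (\<forall>s\<in>carrier (osec F U). \<forall>t\<in>carrier (osec F U).
          \<phi> U (s \<oplus>\<^bsub>osec F U\<^esub> t) = \<phi> U s \<oplus>\<^bsub>osec G U\<^esub> \<phi> U t) \<and>
        (\<forall>r\<in>carrier (kring X U). \<forall>s\<in>carrier (osec F U).
          \<phi> U (r \<odot>\<^bsub>osec F U\<^esub> s) = r \<odot>\<^bsub>osec G U\<^esub> \<phi> U s)) \<and>
      (\<forall>U V. openin (ktop X) U \<and> openin (ktop X) V \<and> V \<subseteq> U \<longrightarrow>
        (\<forall>s\<in>carrier (osec F U). \<phi> V (ores F U V s) = ores G U V (\<phi> U s))))"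

definition omodule_sum ::
    "('p, 'k, 's) omodule \<Rightarrow> ('p, 'k, 't) omodule \<Rightarrow> ('p, 'k, 's \<times> 't) omodule"
  where "omodule_sum F G =
    \<lparr> osec = (\<lambda>U.
        \<lparr> carrier = carrier (osec F U) \<times> carrier (osec G U),
          monoid.mult = undefined,
          one = undefined,
          zero = (\<zero>\<^bsub>osec F U\<^esub>, \<zero>\<^bsub>osec G U\<^esub>),
          add = (\<lambda>(s, t) (s', t'). (s \<oplus>\<^bsub>osec F U\<^esub> s', t \<oplus>\<^bsub>osec G U\<^esub> t')),
          module.smult = (\<lambda>r (s, t). (r \<odot>\<^bsub>osec F U\<^esub> s, r \<odot>\<^bsub>osec G U\<^esub> t)) \<rparr>),
      ores = (\<lambda>U V (s, t). (ores F U V s, ores G U V t)) \<rparr>"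

text \<open>
  For \<open>Y \<subseteq> P^N\<close> and a morphism \<open>\<pi> : Y \<rightarrow> P^M\<close>, the invertible sheaf
  \<open>O_Y(n) \<otimes> \<pi>^* O(m)\<close>, that is, the restriction of \<open>O(n, m)\<close> along \<open>(id, \<pi>) : Y \<rightarrow> P^N \<times> P^M\<close>:
  a section is a function of homogeneous coordinates \<open>v\<close> of a point \<open>p \<in> Y\<close> and \<open>w\<close> of \<open>\<pi> p\<close>
  that is locally a quotient of forms whose bidegrees differ by \<open>(n, m)\<close>.
\<close>

definition twist ::
    "nat \<Rightarrow> 'k::field ppoint set \<Rightarrow> nat \<Rightarrow> ('k ppoint \<Rightarrow> 'k ppoint) \<Rightarrow> int \<Rightarrow> int \<Rightarrow>
      ('k ppoint, 'k, (nat \<Rightarrow> 'k) \<Rightarrow> (nat \<Rightarrow> 'k) \<Rightarrow> 'k) omodule"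
  where "twist N Y M \<pi> n m =
    \<lparr> osec = (\<lambda>U.
        \<lparr> carrier = {F.
            (\<forall>v w. \<not> (hclass v \<in> U \<and> w \<in> \<pi> (hclass v)) \<longrightarrow> F v w = 0) \<and>
            (\<forall>p\<in>U. \<exists>V. openin (subtopology (zariski N) Y) V \<and> p \<in> V \<and> V \<subseteq> U \<and>
              (\<exists>d e d' e'. int d - int d' = n \<and> int e - int e' = m \<and>
                (\<exists>P\<in>bihpoly N M d e. \<exists>Q\<in>bihpoly N M d' e'.
                  \<forall>q\<in>V. \<forall>v\<in>q. \<forall>w\<in>\<pi> q. Q v w \<noteq> 0 \<and> F v w = P v w / Q v w)))},
          monoid.mult = undefined,
          one = undefined,
          zero = (\<lambda>v w. 0),
          add = (\<lambda>F G v w. F v w + G v w),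
          module.smult = (\<lambda>r F v w. r (hclass v) * F v w) \<rparr>),
      ores = (\<lambda>U V F v w. if hclass v \<in> V then F v w else 0) \<rparr>"

section \<open>Divisors\<close>

text \<open>\<open>h\<close> generates the ideal sheaf of the closed set \<open>S\<close> (with its reduced structure) over \<open>V\<close>.\<close>

definition local_equation ::
    "('p, 'k::field) kspace \<Rightarrow> 'p set \<Rightarrow> 'p set \<Rightarrow> ('p \<Rightarrow> 'k) \<Rightarrow> bool"
  where "local_equation X S V h \<longleftrightarrow>
    openin (ktop X) V \<and> h \<in> kreg X V \<and> (\<forall>p\<in>V \<inter> S. h p = 0) \<and>
    (\<forall>W g. openin (ktop X) W \<and> W \<subseteq> V \<and> g \<in> kreg X W \<and> (\<forall>p\<in>W \<inter> S. g p = 0) \<longrightarrow>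
      (\<forall>p\<in>W. \<exists>W' r. openin (ktop X) W' \<and> p \<in> W' \<and> W' \<subseteq> W \<and> r \<in> kreg X W' \<and>
        (\<forall>q\<in>W'. g q = r q * h q)))"

text \<open>
  \<open>Y \<in> |F|\<close> for an invertible sheaf \<open>F\<close> and a reduced effective divisor \<open>Y\<close>: some global section
  of \<open>F\<close> has divisor \<open>Y\<close>, i.e. in local trivialisations \<open>e\<close> of \<open>F\<close> it is \<open>h e\<close> with \<open>h\<close> a
  local equation of \<open>Y\<close> (so that it vanishes along \<open>Y\<close> with multiplicity one and nowhere else).
\<close>

definition in_linear_system ::
    "('p, 'k::field) kspace \<Rightarrow> ('p, 'k, 's) omodule \<Rightarrow> 'p set \<Rightarrow> bool"
  where "in_linear_system X F Y \<longleftrightarrow>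
    closedin (ktop X) Y \<and>
    (\<exists>s\<in>carrier (osec F (topspace (ktop X))). \<forall>p\<in>topspace (ktop X). \<exists>V h e.
      p \<in> V \<and> local_equation X Y V h \<and> e \<in> carrier (osec F V) \<and>
      (\<forall>W. openin (ktop X) W \<and> W \<subseteq> V \<longrightarrow>
        (\<forall>t\<in>carrier (osec F W). \<exists>!r. r \<in> kreg X W \<and> t = r \<odot>\<^bsub>osec F W\<^esub> ores F V W e)) \<and>
      ores F (topspace (ktop X)) V s = h \<odot>\<^bsub>osec F V\<^esub> e)"

section \<open>Differential forms\<close>

text \<open>Functions, on the whole space, that are regular near \<open>p\<close> (representatives of germs).\<close>

definition regular_near :: "('p, 'k::field) kspace \<Rightarrow> 'p \<Rightarrow> ('p \<Rightarrow> 'k) set"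
  where "regular_near X p =
    {g. \<exists>V. openin (ktop X) V \<and> p \<in> V \<and> (\<lambda>q. if q \<in> V then g q else 0) \<in> kreg X V}"

text \<open>
  Tangent vectors at \<open>p\<close> are the \<open>k\<close>-derivations at \<open>p\<close>.  Such a derivation depends only on germs:
  if \<open>f\<close> and \<open>g\<close> agree on an open neighbourhood \<open>V\<close> of \<open>p\<close>, apply the product rule to
  the product of \<open>f - g\<close> and the indicator function of \<open>V\<close>, which is \<open>0\<close>.
\<close>

definition tangent :: "('p, 'k::field) kspace \<Rightarrow> 'p \<Rightarrow> (('p \<Rightarrow> 'k) \<Rightarrow> 'k) set"
  where "tangent X p =
    {\<delta>. (\<forall>g. g \<notin> regular_near X p \<longrightarrow> \<delta> g = 0) \<and>
        (\<forall>c. \<forall>g\<in>regular_near X p. \<delta> (\<lambda>q. c * g q) = c * \<delta> g) \<and>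
        (\<forall>g\<in>regular_near X p. \<forall>h\<in>regular_near X p.
          \<delta> (\<lambda>q. g q + h q) = \<delta> g + \<delta> h \<and>
          \<delta> (\<lambda>q. g q * h q) = g p * \<delta> h + h p * \<delta> g)}"

text \<open>
  Regular differential forms on a nonsingular variety: an \<open>r\<close>-form assigns to each point an
  alternating \<open>r\<close>-linear form on the tangent space, and is regular if it is locally a finite sum
  \<open>\<Sum> f dg\<close> (for \<open>r = 1\<close>) or \<open>\<Sum> f dg \<and> dh\<close> (for \<open>r = 2\<close>) with \<open>f\<close>, \<open>g\<close>, \<open>h\<close> regular;
  here \<open>dg\<close> is \<open>\<delta> \<mapsto> \<delta> g\<close>.
\<close>

type_synonym ('p, 'k) form1 = "'p \<Rightarrow> (('p \<Rightarrow> 'k) \<Rightarrow> 'k) \<Rightarrow> 'k"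
type_synonym ('p, 'k) form2 = "'p \<Rightarrow> (('p \<Rightarrow> 'k) \<Rightarrow> 'k) \<Rightarrow> (('p \<Rightarrow> 'k) \<Rightarrow> 'k) \<Rightarrow> 'k"

definition regular_form1 :: "('p, 'k::field) kspace \<Rightarrow> 'p set \<Rightarrow> ('p, 'k) form1 set"
  where "regular_form1 X U =
    {\<omega>. (\<forall>p \<delta>. \<not> (p \<in> U \<and> \<delta> \<in> tangent X p) \<longrightarrow> \<omega> p \<delta> = 0) \<and>
        (\<forall>p\<in>U. \<exists>V (n::nat) f g. openin (ktop X) V \<and> p \<in> V \<and> V \<subseteq> U \<and>
          (\<forall>i<n. f i \<in> kreg X V \<and> g i \<in> kreg X V) \<and>
          (\<forall>q\<in>V. \<forall>\<delta>\<in>tangent X q. \<omega> q \<delta> = (\<Sum>i<n. f i q * \<delta> (g i))))}"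

definition regular_form2 :: "('p, 'k::field) kspace \<Rightarrow> 'p set \<Rightarrow> ('p, 'k) form2 set"
  where "regular_form2 X U =
    {\<eta>. (\<forall>p \<delta> \<epsilon>. \<not> (p \<in> U \<and> \<delta> \<in> tangent X p \<and> \<epsilon> \<in> tangent X p) \<longrightarrow> \<eta> p \<delta> \<epsilon> = 0) \<and>
        (\<forall>p\<in>U. \<exists>V (n::nat) f g h. openin (ktop X) V \<and> p \<in> V \<and> V \<subseteq> U \<and>
          (\<forall>i<n. f i \<in> kreg X V \<and> g i \<in> kreg X V \<and> h i \<in> kreg X V) \<and>
          (\<forall>q\<in>V. \<forall>\<delta>\<in>tangent X q. \<forall>\<epsilon>\<in>tangent X q.
            \<eta> q \<delta> \<epsilon> = (\<Sum>i<n. f i q * (\<delta> (g i) * \<epsilon> (h i) - \<epsilon> (g i) * \<delta> (h i)))))}"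

text \<open>\<open>\<eta> = d\<omega>\<close> on \<open>U\<close>, where \<open>d (\<Sum> f dg) = \<Sum> df \<and> dg\<close>.\<close>

definition is_exterior_derivative ::
    "('p, 'k::field) kspace \<Rightarrow> 'p set \<Rightarrow> ('p, 'k) form1 \<Rightarrow> ('p, 'k) form2 \<Rightarrow> bool"
  where "is_exterior_derivative X U \<omega> \<eta> \<longleftrightarrow>
    \<eta> \<in> regular_form2 X U \<and>
    (\<forall>p\<in>U. \<exists>V (n::nat) f g. openin (ktop X) V \<and> p \<in> V \<and> V \<subseteq> U \<and>
      (\<forall>i<n. f i \<in> kreg X V \<and> g i \<in> kreg X V) \<and>
      (\<forall>q\<in>V. \<forall>\<delta>\<in>tangent X q. \<omega> q \<delta> = (\<Sum>i<n. f i q * \<delta> (g i))) \<and>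
      (\<forall>q\<in>V. \<forall>\<delta>\<in>tangent X q. \<forall>\<epsilon>\<in>tangent X q.
        \<eta> q \<delta> \<epsilon> = (\<Sum>i<n. \<delta> (f i) * \<epsilon> (g i) - \<epsilon> (f i) * \<delta> (g i))))"

text \<open>
  Logarithmic forms (Deligne, Saito): \<open>\<omega>\<close> is regular off the reduced divisor \<open>S\<close>, and both \<open>\<omega>\<close>
  and \<open>d\<omega>\<close> have at most simple poles along \<open>S\<close>, i.e. \<open>h \<omega>\<close> and \<open>h d\<omega>\<close> extend to regular forms
  for a local equation \<open>h\<close> of \<open>S\<close> near any point.
\<close>

definition log_form1 ::
    "('p, 'k::field) kspace \<Rightarrow> 'p set \<Rightarrow> 'p set \<Rightarrow> ('p, 'k) form1 set"
  where "log_form1 X S U =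
    {\<omega> \<in> regular_form1 X (U - S).
      \<forall>p\<in>U. \<exists>V h. p \<in> V \<and> V \<subseteq> U \<and> local_equation X S V h \<and>
        (\<exists>\<theta>\<in>regular_form1 X V. \<forall>q\<in>V - S. \<forall>\<delta>\<in>tangent X q. \<theta> q \<delta> = h q * \<omega> q \<delta>) \<and>
        (\<exists>\<eta>. is_exterior_derivative X (V - S) \<omega> \<eta> \<and>
          (\<exists>\<theta>\<in>regular_form2 X V. \<forall>q\<in>V - S. \<forall>\<delta>\<in>tangent X q. \<forall>\<epsilon>\<in>tangent X q.
            \<theta> q \<delta> \<epsilon> = h q * \<eta> q \<delta> \<epsilon>))}"

definition log_sheaf ::
    "('p, 'k::field) kspace \<Rightarrow> 'p set set \<Rightarrow> ('p, 'k, ('p, 'k) form1) omodule"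
  where "log_sheaf X D =
    \<lparr> osec = (\<lambda>U.
        \<lparr> carrier = log_form1 X (\<Union>D) U,
          monoid.mult = undefined,
          one = undefined,
          zero = (\<lambda>p \<delta>. 0),
          add = (\<lambda>\<omega> \<omega>' p \<delta>. \<omega> p \<delta> + \<omega>' p \<delta>),
          module.smult = (\<lambda>r \<omega> p \<delta>. r p * \<omega> p \<delta>) \<rparr>),
      ores = (\<lambda>U V \<omega> p \<delta>. if p \<in> V then \<omega> p \<delta> else 0) \<rparr>"

text \<open>
  On a nonsingular variety the prime divisors are the irreducible closed proper subsets whose
  ideal is locally principal; smoothness is the Jacobian criterion \<open>dh \<noteq> 0\<close> at the points of \<open>Y\<close>.
\<close>

definition smooth_irreducible_divisor :: "('p, 'k::field) kspace \<Rightarrow> 'p set \<Rightarrow> bool"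
  where "smooth_irreducible_divisor X Y \<longleftrightarrow>
    closedin (ktop X) Y \<and> irreducible_set (ktop X) Y \<and> Y \<noteq> topspace (ktop X) \<and>
    (\<forall>p\<in>Y. \<exists>V h. p \<in> V \<and> local_equation X Y V h \<and> (\<exists>\<delta>\<in>tangent X p. \<delta> h \<noteq> 0))"

definition arrangement :: "('p, 'k::field) kspace \<Rightarrow> 'p set set \<Rightarrow> bool"
  where "arrangement X D \<longleftrightarrow> finite D \<and> (\<forall>Y\<in>D. smooth_irreducible_divisor X Y)"

section \<open>Rational normal scroll surfaces\<close>

text \<open>
  A point of \<open>P(O(a0) \<oplus> O(a1))\<close> is given by coordinates \<open>w = (w 0, w 1)\<close> of its image in \<open>P^1\<close>
  and fibre coordinates \<open>y = (y 0, y 1)\<close>, \<open>y i\<close> being a section of \<open>O(1) \<otimes> \<pi>^* O(-ai)\<close>.  The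
  global sections of \<open>O(1)\<close> are spanned by \<open>y 0\<close> times the monomials of degree \<open>a0\<close> in \<open>w\<close> and
  \<open>y 1\<close> times those of degree \<open>a1\<close>; they define the embedding into \<open>P^(a0+a1+1)\<close>.
\<close>

definition scroll_map :: "nat \<Rightarrow> nat \<Rightarrow> (nat \<Rightarrow> 'k::field) \<Rightarrow> (nat \<Rightarrow> 'k) \<Rightarrow> nat \<Rightarrow> 'k"
  where "scroll_map a0 a1 w y i =
    (if i \<le> a0 then w 0 ^ (a0 - i) * w 1 ^ i * y 0
     else if i \<le> a0 + a1 + 1 then w 0 ^ (a0 + a1 + 1 - i) * w 1 ^ (i - a0 - 1) * y 1
     else 0)"

definition scroll_points :: "nat \<Rightarrow> nat \<Rightarrow> 'k::field ppoint set"
  where "scroll_points a0 a1 =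
    {hclass (scroll_map a0 a1 w y) | w y. w \<in> kvec 1 - {\<lambda>_. 0} \<and> y \<in> kvec 1 - {\<lambda>_. 0}}"

definition scroll :: "nat \<Rightarrow> nat \<Rightarrow> ('k::field ppoint, 'k) kspace"
  where "scroll a0 a1 = pvariety (a0 + a1 + 1) (scroll_points a0 a1)"

definition scroll_proj :: "nat \<Rightarrow> nat \<Rightarrow> 'k::field ppoint \<Rightarrow> 'k ppoint"
  where "scroll_proj a0 a1 p =
    (THE q. \<exists>w y. w \<in> kvec 1 - {\<lambda>_. 0} \<and> y \<in> kvec 1 - {\<lambda>_. 0} \<and>
       p = hclass (scroll_map a0 a1 w y) \<and> q = hclass w)"

lemma monomials_proportional:
  fixes s t s' t' y y' c :: "'k::field"
  assumes "0 < a" "y \<noteq> 0" "s \<noteq> 0 \<or> t \<noteq> 0"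
    and eq: "\<And>i. i \<le> a \<Longrightarrow> s ^ (a - i) * t ^ i * y = c * (s' ^ (a - i) * t' ^ i * y')"
  shows "s * t' = t * s'"
proof -
  obtain b where b: "a = Suc b" using assms(1) gr0_implies_Suc by blast
  show ?thesis
  proof (cases "s = 0")
    case True
    have "t ^ a * y = c * (t' ^ a * y')" "0 = c * (s' ^ a * y')"
      using eq[of a] eq[of 0] True \<open>0 < a\<close> by (simp_all add: zero_power)
    moreover have "t ^ a * y \<noteq> 0" using True assms by simp
    ultimately have "s' = 0" by auto
    with True show ?thesis by simp
  next
    case False
    have e0: "s * s ^ b * y = c * (s' * s' ^ b * y')" using eq[of 0] b by simp
    have e1: "s ^ b * t * y = c * (s' ^ b * t' * y')" using eq[of 1] b by simp
    have "(s * t' - t * s') * (s ^ b * y * (c * s' ^ b * y')) =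
        (s * s ^ b * y) * (c * (s' ^ b * t' * y')) - (s ^ b * t * y) * (c * (s' * s' ^ b * y'))"
      by (simp add: algebra_simps)
    also have "\<dots> = 0" unfolding e0 e1 by simp
    finally have *: "(s * t' - t * s') * (s ^ b * y * (c * s' ^ b * y')) = 0" .
    have "s * s ^ b * y \<noteq> 0" using False assms by simp
    then have "c * (s' * s' ^ b * y') \<noteq> 0" by (simp add: e0)
    then have "s ^ b * y * (c * s' ^ b * y') \<noteq> 0" using False assms by simp
    with * show ?thesis by (metis mult_eq_0_iff right_minus_eq)
  qed
qed

lemma hclass_kvec_1_eqI:
  fixes w w' :: "nat \<Rightarrow> 'k::field"
  assumes "w \<in> kvec 1 - {\<lambda>_. 0}" "w' \<in> kvec 1 - {\<lambda>_. 0}" "w 0 * w' 1 = w 1 * w' 0"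
  shows "hclass w = hclass w'"
proof -
  have nz: "u 0 \<noteq> 0 \<or> u 1 \<noteq> 0" if "u \<in> kvec 1 - {\<lambda>_. 0}" for u :: "nat \<Rightarrow> 'k"
  proof (rule ccontr)
    assume "\<not> ?thesis"
    then have "u i = 0" for i using that by (cases "i \<le> 1") (auto simp: kvec_def le_Suc_eq)
    with that show False by auto
  qed
  define c where "c = (if w' 0 \<noteq> 0 then w 0 / w' 0 else w 1 / w' 1)"
  have c0: "c \<noteq> 0"
    using nz[OF assms(1)] nz[OF assms(2)] assms(3) by (auto simp: c_def)
  have wi: "w i = c * w' i" for i
  proof -
    consider "i = 0" | "i = 1" | "i > 1" by linarith
    then show ?thesis
      using nz[OF assms(1)] nz[OF assms(2)] assms by cases (auto simp: c_def kvec_def field_simps)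
  qed
  have "w' i = inverse c * w i" for i using wi[of i] c0 by simp
  show ?thesis
  proof (intro equalityI subsetI)
    fix x assume "x \<in> hclass w"
    then obtain d where "d \<noteq> 0" "x = (\<lambda>i. d * w i)" by (auto simp: hclass_def)
    then show "x \<in> hclass w'" using c0 unfolding hclass_def
      by (auto simp: wi intro!: exI[of _ "d * c"])
  next
    fix x assume "x \<in> hclass w'"
    then obtain d where "d \<noteq> 0" "x = (\<lambda>i. d * w' i)" by (auto simp: hclass_def)
    then show "x \<in> hclass w" using c0 unfolding hclass_def
      by (auto simp: wi intro!: exI[of _ "d / c"])
  qed
qed

text \<open>The definite description is justified: the projection is well defined.\<close>

lemma scroll_proj_scroll_map:
  fixes w y :: "nat \<Rightarrow> 'k::field"
  assumes a: "0 < a0" "a0 \<le> a1"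
    and w: "w \<in> kvec 1 - {\<lambda>_. 0}" and y: "y \<in> kvec 1 - {\<lambda>_. 0}"
  shows "scroll_proj a0 a1 (hclass (scroll_map a0 a1 w y)) = hclass w"
proof -
  have nz: "u 0 \<noteq> 0 \<or> u 1 \<noteq> 0" if "u \<in> kvec 1 - {\<lambda>_. 0}" for u :: "nat \<Rightarrow> 'k"
  proof (rule ccontr)
    assume "\<not> ?thesis"
    then have "u i = 0" for i using that by (cases "i \<le> 1") (auto simp: kvec_def le_Suc_eq)
    with that show False by auto
  qed
  have "hclass w' = hclass w"
    if w': "w' \<in> kvec 1 - {\<lambda>_. 0}" and y': "y' \<in> kvec 1 - {\<lambda>_. 0}"
      and eq: "hclass (scroll_map a0 a1 w y) = hclass (scroll_map a0 a1 w' y')"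
    for w' y' :: "nat \<Rightarrow> 'k"
  proof -
    have "scroll_map a0 a1 w y \<in> hclass (scroll_map a0 a1 w y)"
      unfolding hclass_def by (auto intro!: exI[of _ 1])
    then obtain c where "scroll_map a0 a1 w y = (\<lambda>i. c * scroll_map a0 a1 w' y' i)"
      unfolding eq by (auto simp: hclass_def)
    then have c: "scroll_map a0 a1 w y i = c * scroll_map a0 a1 w' y' i" for i
      by metis
    have "w 0 * w' 1 = w 1 * w' 0"
    proof (cases "y 0 = 0")
      case False
      have "w 0 ^ (a0 - i) * w 1 ^ i * y 0 = c * (w' 0 ^ (a0 - i) * w' 1 ^ i * y' 0)"
        if "i \<le> a0" for i
        using c[of i] that by (simp add: scroll_map_def)
      then show ?thesis
        by (rule monomials_proportional[OF a(1) False nz[OF w]])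
    next
      case True
      then have "y 1 \<noteq> 0" using nz[OF y] by simp
      moreover have "w 0 ^ (a1 - i) * w 1 ^ i * y 1 = c * (w' 0 ^ (a1 - i) * w' 1 ^ i * y' 1)"
        if "i \<le> a1" for i
        using c[of "a0 + 1 + i"] that by (simp add: scroll_map_def)
      ultimately show ?thesis
        using monomials_proportional[OF _ _ nz[OF w]] a by (meson less_le_trans)
    qed
    then show ?thesis using hclass_kvec_1_eqI[OF w w'] by simp
  qed
  then show ?thesis
    unfolding scroll_proj_def using w y by (intro the_equality) blast+
qed

text \<open>\<open>O_X(n H + m f)\<close> with \<open>H\<close> the hyperplane class and \<open>f\<close> the class of \<open>\<pi>^* O(1)\<close>.\<close>

definition scroll_sheaf ::
    "nat \<Rightarrow> nat \<Rightarrow> int \<Rightarrow> int \<Rightarrow>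
      ('k::field ppoint, 'k, (nat \<Rightarrow> 'k) \<Rightarrow> (nat \<Rightarrow> 'k) \<Rightarrow> 'k) omodule"
  where "scroll_sheaf a0 a1 n m =
    twist (a0 + a1 + 1) (scroll_points a0 a1) 1 (scroll_proj a0 a1) n m"

end

theory Submission
  imports Defs
begin

text \<open>
  For \<open>e = 0\<close> the scroll is \<open>P\<^sup>1 \<times> P\<^sup>1\<close>, with coordinates \<open>w\<close> and \<open>y\<close> on the factors.  A global section
  of \<open>O(f)\<close> is constant in \<open>y\<close>, hence a linear form in \<open>w\<close>, and a section of \<open>O(H - a\<^sub>1 f)\<close> is a linear
  form in \<open>y\<close>; so the arrangement consists of fibres of the two projections.  With \<open>P(w)\<close> and \<open>Q(y)\<close>
  the products of the linear forms, the isomorphism sends sections \<open>F\<close> of \<open>O((a - 2) f)\<close> and \<open>G\<close> of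
  \<open>O((b - 2) (H - a\<^sub>1 f))\<close> to the form
  \<open>F (w\<^sub>0 dw\<^sub>1 - w\<^sub>1 dw\<^sub>0) / P + G (y\<^sub>0 dy\<^sub>1 - y\<^sub>1 dy\<^sub>0) / Q\<close>.  Sections of all sheaves are rational functions
  on four affine charts, and that every logarithmic form is of this shape is a divisibility statement
  in \<open>k[s, t]\<close>, which uses that \<open>P\<close> and \<open>Q\<close> have simple roots.
\<close>

section \<open>Bivariate polynomials and rational functions on the affine plane\<close>

text \<open>The twists are forced by the change of chart s s' = 1: there ds = - s^2 ds', while P, a
  product of a linear forms, is multiplied by s^a, so F ds / P is well defined when F is multiplied
  by s^(a - 2). The embedding has bidegree (n, 1) in (w, y); hence H - n f is multiplied by t alone,
  and the second summand is a power of it.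

  A simple pole of \<omega> would still allow terms such as ds / Q; the condition on d\<omega> is
  what excludes them.

  The obstacle is that the definitions speak of total functions that are locally quotients, with no
  local rings at hand. Germs are therefore replaced by one fraction of polynomials, valid wherever
  its denominator is nonzero, and identities found off the divisor are carried across it by density.
  Characteristic 0 makes the field infinite, so that values determine polynomials; algebraic
  closedness enters where global sections are shown to be polynomials.\<close>

lemma poly_vanishing_off_eq_0:
  fixes p h :: "'k::field_char_0 poly"
  assumes "h \<noteq> 0" "\<And>x. poly h x \<noteq> 0 \<Longrightarrow> poly p x = 0"
  shows "p = 0"
proof -
  have "poly (p * h) x = poly 0 x" for x using assms(2)[of x] by (cases "poly h x = 0") auto
  then have "p * h = 0" using poly_eq_poly_eq_iff by blast
  then show ?thesis using assms(1) by simp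
qed

text \<open>The outer variable is t and the coefficients are polynomials in s. Fixing t is thus an
  evaluation of the outer polynomial, while fixing s goes through the coefficients
  (\<open>ev_fixed_fst\<close>). A polynomial in s alone is \<open>[:p:]\<close>, one in t alone is
  \<open>tpoly p\<close>.\<close>

definition ev :: "'k::field poly poly \<Rightarrow> 'k \<Rightarrow> 'k \<Rightarrow> 'k" where
  "ev B s t = poly (poly B [:t:]) s"

lemma ev_simps [simp]:
  "ev 0 s t = 0" "ev 1 s t = 1"
  "ev (A + B) s t = ev A s t + ev B s t"
  "ev (A - B) s t = ev A s t - ev B s t"
  "ev (- A) s t = - ev A s t"
  "ev (A * B) s t = ev A s t * ev B s t"
  "ev (A ^ n) s t = ev A s t ^ n"
  "ev [:p:] s t = poly p s"
  "ev (pCons p A) s t = poly p s + t * ev A s t"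
  "ev (Polynomial.smult p A) s t = poly p s * ev A s t"
  by (simp_all add: ev_def)

definition tpoly :: "'k::field poly \<Rightarrow> 'k poly poly" where
  "tpoly p = map_poly (\<lambda>c. [:c:]) p"

lemma ev_tpoly [simp]: "ev (tpoly p) s t = poly p t"
  unfolding tpoly_def by (induction p) (simp_all add: map_poly_pCons)

lemma ev_fun:
  "ev [:p:] = (\<lambda>s t. poly p s)" "ev (tpoly p) = (\<lambda>s t. poly p t)"
  by (intro ext, simp)+

lemma ev_fixed_fst: "poly (map_poly (\<lambda>p. poly p s) A) t = ev A s t"
  by (induction A) (simp_all add: map_poly_pCons)

text \<open>For each t the inner polynomial vanishes identically, so every constant
  \<open>[:t:]\<close> is a root of \<open>A\<close> over k[s]; a nonzero \<open>A\<close> has only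
  finitely many roots.\<close>

lemma ev_eq_0_imp:
  fixes A :: "'k::field_char_0 poly poly"
  assumes "\<And>s t. ev A s t = 0"
  shows "A = 0"
proof (rule ccontr)
  assume "A \<noteq> 0"
  have "poly (poly A [:t:]) s = poly 0 s" for s t using assms by (simp add: ev_def)
  then have "poly A [:t:] = 0" for t using poly_eq_poly_eq_iff by blast
  then have "(\<lambda>t. [:t:]) ` UNIV \<subseteq> {x. poly A x = 0}" by auto
  moreover have "finite {x. poly A x = 0}" using \<open>A \<noteq> 0\<close> by (rule poly_roots_finite)
  ultimately have "finite (range (\<lambda>t::'k. [:t:]))" by (rule finite_subset)
  then have "finite (UNIV :: 'k set)" by (rule finite_imageD) (auto simp: inj_on_def)
  then show False using infinite_UNIV_char_0 by blast
qed

text \<open>The complement of a curve is dense in the plane: \<open>A * H\<close> vanishes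
  everywhere, and k[s, t] is a domain.\<close>

lemma ev_vanishing_off_eq_0:
  fixes A H :: "'k::field_char_0 poly poly"
  assumes "H \<noteq> 0" "\<And>s t. ev H s t \<noteq> 0 \<Longrightarrow> ev A s t = 0"
  shows "A = 0"
proof -
  have "ev (A * H) s t = 0" for s t using assms(2)[of s t] by (cases "ev H s t = 0") auto
  then show ?thesis using ev_eq_0_imp[of "A * H"] assms(1) by simp
qed

text \<open>The restriction to the line s = c is the polynomial in t with coefficients
  \<open>poly (coeff A n) c\<close>; if it vanishes, s - c divides every coefficient of
  \<open>A\<close>.\<close>

lemma ev_dvd_fst:
  fixes A :: "'k::field_char_0 poly poly"
  assumes "\<And>t. ev A c t = 0"
  shows "[:[:- c, 1:]:] dvd A"
proof -
  have "poly (map_poly (\<lambda>p. poly p c) A) t = poly 0 t" for t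
    using assms by (simp add: ev_fixed_fst)
  then have "map_poly (\<lambda>p. poly p c) A = 0" using poly_eq_poly_eq_iff by blast
  then have "coeff (map_poly (\<lambda>p. poly p c) A) n = 0" for n by simp
  then have "poly (coeff A n) c = 0" for n by (simp add: coeff_map_poly)
  then show ?thesis by (simp add: const_poly_dvd_iff poly_eq_0_iff_dvd)
qed

lemma ev_dvd_snd:
  fixes A :: "'k::field_char_0 poly poly"
  assumes "\<And>s. ev A s d = 0"
  shows "[:- [:d:], 1:] dvd A"
proof -
  have "poly (poly A [:d:]) s = poly 0 s" for s using assms by (simp add: ev_def)
  then have "poly A [:d:] = 0" using poly_eq_poly_eq_iff by blast
  then show ?thesis by (simp add: poly_eq_0_iff_dvd)
qed

section \<open>Partial derivatives of polynomials in two variables\<close>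

definition dS :: "'k::field poly poly \<Rightarrow> 'k poly poly" where "dS = map_poly pderiv"
definition dT :: "'k::field poly poly \<Rightarrow> 'k poly poly" where "dT = pderiv"

text \<open>A common interface for \<open>dS\<close> and \<open>dT\<close>, so that the calculus of
  \<open>pd\<close> below is proved once for both variables.\<close>

definition derivation :: "('k::field poly poly \<Rightarrow> 'k poly poly) \<Rightarrow> bool" where
  "derivation D \<longleftrightarrow> (\<forall>A B. D (A + B) = D A + D B) \<and> (\<forall>A B. D (A * B) = A * D B + B * D A) \<and>
     (\<forall>c. D [:[:c:]:] = 0)"

lemma dS_pCons [simp]: "dS (pCons p A) = pCons (pderiv p) (dS A)"
  by (simp add: dS_def map_poly_pCons)

lemma dS_0 [simp]: "dS 0 = 0" and dT_0 [simp]: "dT 0 = 0"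
  by (simp_all add: dS_def dT_def)

lemma poly_dS: "poly (dS A) [:t:] = pderiv (poly A [:t:])"
  by (induction A) (simp_all add: pderiv_add pderiv_smult)

lemma ev_extensional:
  fixes A B :: "'k::field_char_0 poly poly"
  assumes "\<And>s t. ev A s t = ev B s t"
  shows "A = B"
  using ev_eq_0_imp[of "A - B"] assms by simp

text \<open>The Leibniz rule is hidden by \<open>map_poly\<close>. It appears once t is fixed, where
  \<open>poly_dS\<close> turns \<open>dS\<close> into the ordinary derivative in s; equality of all
  values then gives equality of polynomials.\<close>

lemma derivation_dS: "derivation (dS :: 'k::field_char_0 poly poly \<Rightarrow> _)"
  unfolding derivation_def
  by (auto intro!: ev_extensional simp: ev_def poly_dS pderiv_add pderiv_mult algebra_simps)

lemma derivation_dT: "derivation (dT :: 'k::field poly poly \<Rightarrow> _)"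
  unfolding derivation_def dT_def by (simp add: pderiv_add pderiv_mult pderiv_pCons)

lemma dT_pCons: "dT (pCons p A) = A + pCons 0 (dT A)"
  by (simp add: dT_def pderiv_pCons)

lemma dS_dT_commute: "dS (dT A) = dT (dS (A :: 'k::field_char_0 poly poly))"
proof (induction A)
  case (pCons p A)
  have "dS (A + pCons 0 (dT A)) = dS A + dS (pCons 0 (dT A))"
    using derivation_dS unfolding derivation_def by blast
  then show ?case using pCons by (simp add: dT_pCons)
qed simp

lemma dS_tpoly [simp]: "dS (tpoly p) = 0"
  by (induction p) (simp_all add: tpoly_def map_poly_pCons)

lemma tpoly_pCons [simp]: "tpoly (pCons a p) = pCons [:a:] (tpoly p)" and tpoly_0 [simp]: "tpoly 0 = 0"
  by (simp_all add: tpoly_def map_poly_pCons)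

lemma dT_tpoly: "dT (tpoly p) = tpoly (pderiv p :: 'k::field_char_0 poly)"
proof (rule ev_extensional)
  fix s t
  show "ev (dT (tpoly p)) s t = ev (tpoly (pderiv p)) s t"
    by (induction p) (simp_all add: dT_pCons pderiv_pCons)
qed

subsection \<open>Germs of rational functions\<close>

text \<open>The point occurs only in the requirement that the denominator be nonzero there. Hence
  the same pair represents the function at every point where \<open>B\<close> is nonzero, which
  makes regularity an open condition (\<open>rep_near\<close>).\<close>

definition rep :: "('k::field \<Rightarrow> 'k \<Rightarrow> 'k) \<Rightarrow> 'k \<Rightarrow> 'k \<Rightarrow> 'k poly poly \<Rightarrow> 'k poly poly \<Rightarrow> bool" where
  "rep \<phi> s t A B \<longleftrightarrow> ev B s t \<noteq> 0 \<and> (\<forall>s' t'. ev B s' t' \<noteq> 0 \<longrightarrow> \<phi> s' t' = ev A s' t' / ev B s' t')"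

definition reg2 :: "('k::field \<Rightarrow> 'k \<Rightarrow> 'k) \<Rightarrow> 'k \<Rightarrow> 'k \<Rightarrow> bool" where
  "reg2 \<phi> s t \<longleftrightarrow> (\<exists>A B. rep \<phi> s t A B)"

text \<open>The neighbourhood filter of a point in the Zariski topology of the affine plane; the
  principal open sets form a basis.\<close>

definition near :: "'k::field \<Rightarrow> 'k \<Rightarrow> ('k \<Rightarrow> 'k \<Rightarrow> bool) \<Rightarrow> bool" where
  "near s t P \<longleftrightarrow> (\<exists>B. ev B s t \<noteq> 0 \<and> (\<forall>s' t'. ev B s' t' \<noteq> 0 \<longrightarrow> P s' t'))"

lemma near_mono: "near s t P \<Longrightarrow> (\<And>s' t'. P s' t' \<Longrightarrow> Q s' t') \<Longrightarrow> near s t Q"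
  unfolding near_def by blast

lemma near_here: "near s t P \<Longrightarrow> P s t"
  unfolding near_def by blast

lemma near_True: "(\<And>s' t'. P s' t') \<Longrightarrow> near s t P"
  unfolding near_def by (intro exI[of _ 1]) auto

lemma near_conj: "near s t P \<Longrightarrow> near s t Q \<Longrightarrow> near s t (\<lambda>s t. P s t \<and> Q s t)"
  unfolding near_def
proof (elim exE conjE)
  fix B B' assume "ev B s t \<noteq> 0" "ev B' s t \<noteq> 0"
    "\<forall>s' t'. ev B s' t' \<noteq> 0 \<longrightarrow> P s' t'" "\<forall>s' t'. ev B' s' t' \<noteq> 0 \<longrightarrow> Q s' t'"
  then show "\<exists>B. ev B s t \<noteq> 0 \<and> (\<forall>s' t'. ev B s' t' \<noteq> 0 \<longrightarrow> P s' t' \<and> Q s' t')"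
    by (intro exI[of _ "B * B'"]) auto
qed

lemma near_nonzero: "ev B s t \<noteq> 0 \<Longrightarrow> near s t (\<lambda>s t. ev B s t \<noteq> 0)"
  unfolding near_def by blast

lemma rep_near: "rep \<phi> s t A B \<Longrightarrow> near s t (\<lambda>s t. rep \<phi> s t A B)"
  unfolding near_def rep_def by blast

lemma reg2_near: "reg2 \<phi> s t \<Longrightarrow> near s t (\<lambda>s t. reg2 \<phi> s t)"
  unfolding reg2_def by (elim exE, drule rep_near, erule near_mono) blast

lemma rep_shrink:
  assumes "rep \<phi> s t A B" "ev C s t \<noteq> 0"
  shows "rep \<phi> s t (A * C) (B * C)"
  using assms unfolding rep_def by auto

lemma rep_cong:
  assumes "rep \<phi> s t A B" "near s t (\<lambda>s t. \<phi> s t = \<psi> s t)"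
  shows "\<exists>C. ev C s t \<noteq> 0 \<and> rep \<psi> s t (A * C) (B * C)"
proof -
  obtain C where C: "ev C s t \<noteq> 0" "\<forall>s' t'. ev C s' t' \<noteq> 0 \<longrightarrow> \<phi> s' t' = \<psi> s' t'"
    using assms(2) unfolding near_def by blast
  then have "rep \<psi> s t (A * C) (B * C)"
    using rep_shrink[OF assms(1) C(1)] unfolding rep_def by auto
  with C show ?thesis by blast
qed

lemma reg2_cong: "reg2 \<phi> s t \<Longrightarrow> near s t (\<lambda>s t. \<phi> s t = \<psi> s t) \<Longrightarrow> reg2 \<psi> s t"
  unfolding reg2_def using rep_cong by blast

lemma rep_ev: "rep (ev A) s t A 1"
  by (simp add: rep_def)

lemma reg2_ev: "reg2 (ev A) s t"
  unfolding reg2_def using rep_ev by blast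

lemma reg2_const: "reg2 (\<lambda>s t. c) s t"
  using reg2_ev[of "[:[:c:]:]"] by (simp add: ev_fun)

lemma reg2_fst: "reg2 (\<lambda>s t. poly p s) s t"
  using reg2_ev[of "[:p:]"] by (simp add: ev_fun)

lemma reg2_snd: "reg2 (\<lambda>s t. poly p t) s t"
  using reg2_ev[of "tpoly p"] by (simp add: ev_fun)

lemma reg2_id_fst: "reg2 (\<lambda>s t. s) s t"
  using reg2_fst[of "[:0, 1:]"] by simp

lemma reg2_id_snd: "reg2 (\<lambda>s t. t) s t"
  using reg2_snd[of "[:0, 1:]"] by simp

lemma rep_add:
  assumes "rep \<phi> s t A B" "rep \<psi> s t A' B'"
  shows "rep (\<lambda>s t. \<phi> s t + \<psi> s t) s t (A * B' + A' * B) (B * B')"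
  using assms unfolding rep_def by (auto simp: field_simps)

lemma rep_mult:
  assumes "rep \<phi> s t A B" "rep \<psi> s t A' B'"
  shows "rep (\<lambda>s t. \<phi> s t * \<psi> s t) s t (A * A') (B * B')"
  using assms unfolding rep_def by (auto simp: field_simps)

text \<open>The factor \<open>B'\<close>, repeated in numerator and denominator, keeps out the zeros
  of \<open>B'\<close>, where the fraction \<open>A' / B'\<close> carries no information on
  \<psi>.\<close>

lemma rep_divide:
  assumes "rep \<phi> s t A B" "rep \<psi> s t A' B'" "\<psi> s t \<noteq> 0"
  shows "rep (\<lambda>s t. \<phi> s t / \<psi> s t) s t (A * B' * B') (B * A' * B')"
proof -
  have "ev A' s t \<noteq> 0" using assms by (auto simp: rep_def)
  moreover have "\<phi> s' t' / \<psi> s' t' = ev (A * B' * B') s' t' / ev (B * A' * B') s' t'"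
    if "ev (B * A' * B') s' t' \<noteq> 0" for s' t'
  proof -
    have "\<phi> s' t' = ev A s' t' / ev B s' t'" "\<psi> s' t' = ev A' s' t' / ev B' s' t'"
      using that assms by (auto simp: rep_def)
    then show ?thesis using that by simp
  qed
  ultimately show ?thesis using assms unfolding rep_def by simp
qed

lemma reg2_add: "reg2 \<phi> s t \<Longrightarrow> reg2 \<psi> s t \<Longrightarrow> reg2 (\<lambda>s t. \<phi> s t + \<psi> s t) s t"
  unfolding reg2_def using rep_add by blast

lemma reg2_mult: "reg2 \<phi> s t \<Longrightarrow> reg2 \<psi> s t \<Longrightarrow> reg2 (\<lambda>s t. \<phi> s t * \<psi> s t) s t"
  unfolding reg2_def using rep_mult by blast

lemma reg2_minus: "reg2 \<phi> s t \<Longrightarrow> reg2 (\<lambda>s t. - \<phi> s t) s t"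
  using reg2_mult[OF reg2_const[of "-1"], of \<phi>] by simp

lemma reg2_diff: "reg2 \<phi> s t \<Longrightarrow> reg2 \<psi> s t \<Longrightarrow> reg2 (\<lambda>s t. \<phi> s t - \<psi> s t) s t"
  using reg2_add[OF _ reg2_minus, of \<phi> s t \<psi>] by simp

lemma reg2_divide:
  "reg2 \<phi> s t \<Longrightarrow> reg2 \<psi> s t \<Longrightarrow> \<psi> s t \<noteq> 0 \<Longrightarrow> reg2 (\<lambda>s t. \<phi> s t / \<psi> s t) s t"
  unfolding reg2_def using rep_divide by blast

lemma reg2_sum:
  "(\<And>i. i \<in> I \<Longrightarrow> reg2 (\<phi> i) s t) \<Longrightarrow> reg2 (\<lambda>s t. \<Sum>i\<in>I. \<phi> i s t) s t"
  by (induction I rule: infinite_finite_induct) (auto intro: reg2_const reg2_add)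

text \<open>Carries identities known off a curve to the points on it: off the curve and the zeros of
  the denominators the numerator vanishes, so it is the zero polynomial.\<close>

lemma reg2_density:
  fixes \<phi> :: "'k::field_char_0 \<Rightarrow> 'k \<Rightarrow> 'k"
  assumes "reg2 \<phi> s t" "H \<noteq> 0" "near s t (\<lambda>s t. ev H s t \<noteq> 0 \<longrightarrow> \<phi> s t = 0)"
  shows "near s t (\<lambda>s t. \<phi> s t = 0)"
proof -
  obtain A B where AB: "rep \<phi> s t A B" using assms(1) by (auto simp: reg2_def)
  obtain C where C: "ev C s t \<noteq> 0" "\<And>s t. ev C s t \<noteq> 0 \<Longrightarrow> ev H s t \<noteq> 0 \<Longrightarrow> \<phi> s t = 0"
    using assms(3) unfolding near_def by blast
  have "B \<noteq> 0" "C \<noteq> 0" using AB C by (auto simp: rep_def)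
  have "A = 0"
  proof (rule ev_vanishing_off_eq_0[of "H * B * C"])
    show "H * B * C \<noteq> 0" using \<open>B \<noteq> 0\<close> \<open>C \<noteq> 0\<close> assms(2) by simp
    fix s' t' assume "ev (H * B * C) s' t' \<noteq> 0"
    then have "\<phi> s' t' = 0" "\<phi> s' t' = ev A s' t' / ev B s' t'" "ev B s' t' \<noteq> 0"
      using AB C(2)[of s' t'] by (auto simp: rep_def)
    then show "ev A s' t' = 0" by simp
  qed
  then show ?thesis using AB unfolding rep_def near_def by auto
qed

lemma reg2_density_eq:
  fixes \<phi> \<psi> :: "'k::field_char_0 \<Rightarrow> 'k \<Rightarrow> 'k"
  assumes "reg2 \<phi> s t" "reg2 \<psi> s t" "H \<noteq> 0" "near s t (\<lambda>s t. ev H s t \<noteq> 0 \<longrightarrow> \<phi> s t = \<psi> s t)"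
  shows "near s t (\<lambda>s t. \<phi> s t = \<psi> s t)"
  using reg2_density[OF reg2_diff[OF assms(1,2)] assms(3)] assms(4) by (simp add: )

section \<open>Division by a polynomial with simple roots in one of the variables\<close>

definition simple_roots :: "'k::field poly \<Rightarrow> bool" where
  "simple_roots p \<longleftrightarrow> (\<forall>x. poly p x = 0 \<longrightarrow> poly (pderiv p) x \<noteq> 0)"

lemma simple_roots_nonzero: "simple_roots p \<Longrightarrow> p \<noteq> 0"
  unfolding simple_roots_def by auto

lemma simple_root_factor:
  assumes "simple_roots p" "poly p c = 0"
  obtains u where "p = [:- c, 1:] * u" "poly u c \<noteq> 0"
proof -
  obtain u where u: "p = [:- c, 1:] * u" using assms(2) by (auto simp: poly_eq_0_iff_dvd)
  have "poly (pderiv p) c = poly u c" unfolding u pderiv_mult by (simp add: pderiv_pCons)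
  then have "poly u c \<noteq> 0" using assms unfolding simple_roots_def by metis
  with u show thesis by (rule that)
qed

text \<open>At a root s the polynomial is x - s times a factor that is nonzero at s, so near the
  point only one line has to be divided out, and vanishing along this line is enough.
  \<open>H\<close> exempts finitely many points of the line; in the applications these are its
  crossings with the other family of rulings.\<close>

lemma reg2_divide_fst:
  fixes \<phi> :: "'k::field_char_0 \<Rightarrow> 'k \<Rightarrow> 'k"
  assumes p: "simple_roots p" and \<phi>: "reg2 \<phi> s t"
    and H: "H \<noteq> 0"
    and zero: "poly p s = 0 \<Longrightarrow> near s t (\<lambda>s' t'. s' = s \<longrightarrow> poly H t' \<noteq> 0 \<longrightarrow> \<phi> s' t' = 0)"
  shows "\<exists>\<psi>. reg2 \<psi> s t \<and> near s t (\<lambda>s t. \<phi> s t = poly p s * \<psi> s t)"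
proof (cases "poly p s = 0")
  case False
  have "near s t (\<lambda>s t. \<phi> s t = poly p s * (\<phi> s t / poly p s))"
    unfolding near_def using False by (intro exI[of _ "[:p:]"]) auto
  then show ?thesis using reg2_divide[OF \<phi> reg2_fst False] by blast
next
  case True
  obtain u where u: "p = [:- s, 1:] * u" "poly u s \<noteq> 0" by (rule simple_root_factor[OF p True])
  obtain A B where AB: "rep \<phi> s t A B" using \<phi> by (auto simp: reg2_def)
  obtain C where C: "ev C s t \<noteq> 0" "\<And>t'. ev C s t' \<noteq> 0 \<Longrightarrow> poly H t' \<noteq> 0 \<Longrightarrow> \<phi> s t' = 0"
    using zero[OF True] unfolding near_def by blast
  let ?r = "map_poly (\<lambda>p. poly p s)"
  have nz: "?r B \<noteq> 0" "?r C \<noteq> 0"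
    using AB C(1) ev_fixed_fst[of s B t] ev_fixed_fst[of s C t] by (auto simp: rep_def)
  have "?r A = 0"
  proof (rule poly_vanishing_off_eq_0[of "H * ?r B * ?r C"])
    show "H * ?r B * ?r C \<noteq> 0" using nz H by simp
    show "poly (?r A) x = 0" if "poly (H * ?r B * ?r C) x \<noteq> 0" for x
      using that AB C(2)[of x] by (auto simp: ev_fixed_fst rep_def)
  qed
  then have "ev A s t' = 0" for t' using ev_fixed_fst[of s A t'] by simp
  then obtain A1 where A1: "A = [:[:- s, 1:]:] * A1" using ev_dvd_fst by (meson dvdE)
  have ps: "poly p s' = (s' - s) * poly u s'" for s' unfolding u(1) by (simp add: algebra_simps)
  have "ev ([:u:] * B) s t \<noteq> 0" using AB u(2) by (simp add: rep_def)
  then have "reg2 (\<lambda>s t. ev A1 s t / ev ([:u:] * B) s t) s t" by (intro reg2_divide reg2_ev)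
  moreover have "near s t (\<lambda>s t. \<phi> s t = poly p s * (ev A1 s t / ev ([:u:] * B) s t))"
    unfolding near_def using AB u(2) A1 ps
    by (intro exI[of _ "[:u:] * B"]) (auto simp: rep_def)
  ultimately show ?thesis by blast
qed

lemma reg2_divide_snd:
  fixes \<phi> :: "'k::field_char_0 \<Rightarrow> 'k \<Rightarrow> 'k"
  assumes p: "simple_roots p" and \<phi>: "reg2 \<phi> s t"
    and H: "H \<noteq> 0"
    and zero: "poly p t = 0 \<Longrightarrow> near s t (\<lambda>s' t'. t' = t \<longrightarrow> poly H s' \<noteq> 0 \<longrightarrow> \<phi> s' t' = 0)"
  shows "\<exists>\<psi>. reg2 \<psi> s t \<and> near s t (\<lambda>s t. \<phi> s t = poly p t * \<psi> s t)"
proof (cases "poly p t = 0")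
  case False
  have "near s t (\<lambda>s t. \<phi> s t = poly p t * (\<phi> s t / poly p t))"
    unfolding near_def using False by (intro exI[of _ "tpoly p"]) auto
  then show ?thesis using reg2_divide[OF \<phi> reg2_snd False] by blast
next
  case True
  obtain u where u: "p = [:- t, 1:] * u" "poly u t \<noteq> 0" by (rule simple_root_factor[OF p True])
  obtain A B where AB: "rep \<phi> s t A B" using \<phi> by (auto simp: reg2_def)
  obtain C where C: "ev C s t \<noteq> 0" "\<And>s'. ev C s' t \<noteq> 0 \<Longrightarrow> poly H s' \<noteq> 0 \<Longrightarrow> \<phi> s' t = 0"
    using zero[OF True] unfolding near_def by blast
  let ?r = "\<lambda>A. poly A [:t:]"
  have nz: "?r B \<noteq> 0" "?r C \<noteq> 0"
    using AB C(1) by (auto simp: rep_def ev_def)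
  have "?r A = 0"
  proof (rule poly_vanishing_off_eq_0[of "H * ?r B * ?r C"])
    show "H * ?r B * ?r C \<noteq> 0" using nz H by simp
    show "poly (?r A) x = 0" if "poly (H * ?r B * ?r C) x \<noteq> 0" for x
      using that AB C(2)[of x] by (auto simp: rep_def ev_def)
  qed
  then have "ev A s' t = 0" for s' by (simp add: ev_def)
  then obtain A1 where A1: "A = [:- [:t:], 1:] * A1" using ev_dvd_snd by (meson dvdE)
  have ps: "poly p t' = (t' - t) * poly u t'" for t' unfolding u(1) by (simp add: algebra_simps)
  have A1': "ev A s' t' = (t' - t) * ev A1 s' t'" for s' t'
    unfolding A1 by (simp add: algebra_simps)
  have "ev (tpoly u * B) s t \<noteq> 0" using AB u(2) by (simp add: rep_def)
  then have "reg2 (\<lambda>s t. ev A1 s t / ev (tpoly u * B) s t) s t" by (intro reg2_divide reg2_ev)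
  moreover have "near s t (\<lambda>s t. \<phi> s t = poly p t * (ev A1 s t / ev (tpoly u * B) s t))"
    unfolding near_def using AB u(2) A1' ps
    by (intro exI[of _ "tpoly u * B"]) (auto simp: rep_def)
  ultimately show ?thesis by blast
qed

subsection \<open>Partial derivatives of rational functions\<close>

text \<open>The quotient rule, made into an operation on functions by a definite description;
  \<open>pd_eq\<close> shows that all representing fractions give the same value.\<close>

definition pd ::
    "('k::field poly poly \<Rightarrow> 'k poly poly) \<Rightarrow> ('k \<Rightarrow> 'k \<Rightarrow> 'k) \<Rightarrow> 'k \<Rightarrow> 'k \<Rightarrow> 'k" where
  "pd D \<phi> s t = (THE d. \<exists>A B. rep \<phi> s t A B \<and>
     d = (ev (D A) s t * ev B s t - ev A s t * ev (D B) s t) / (ev B s t)\<^sup>2)"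

lemma rep_unique:
  fixes \<phi> :: "'k::field_char_0 \<Rightarrow> 'k \<Rightarrow> 'k"
  assumes "rep \<phi> s t A B" "rep \<phi> s t A' B'"
  shows "A * B' = A' * B"
proof -
  have "A * B' - A' * B = 0"
  proof (rule ev_vanishing_off_eq_0[of "B * B'"])
    show "B * B' \<noteq> 0" using assms by (auto simp: rep_def)
    fix s' t' assume "ev (B * B') s' t' \<noteq> 0"
    then have nz: "ev B s' t' \<noteq> 0" "ev B' s' t' \<noteq> 0" by auto
    then have "ev A s' t' / ev B s' t' = ev A' s' t' / ev B' s' t'"
      using assms unfolding rep_def by metis
    then show "ev (A * B' - A' * B) s' t' = 0" using nz by (simp add: field_simps)
  qed
  then show ?thesis by simp
qed

lemma derivation_ev:
  assumes "derivation D"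
  shows "ev (D (A * B)) s t = ev A s t * ev (D B) s t + ev B s t * ev (D A) s t"
    "ev (D (A + B)) s t = ev (D A) s t + ev (D B) s t"
    "D [:[:c:]:] = 0" "D (- A) = - D A" "D (A - B) = D A - D B" "D 1 = 0" "D 0 = 0"
proof -
  note d = assms[unfolded derivation_def]
  show "ev (D (A * B)) s t = ev A s t * ev (D B) s t + ev B s t * ev (D A) s t"
    "ev (D (A + B)) s t = ev (D A) s t + ev (D B) s t"
    "D [:[:c:]:] = 0" using d by simp_all
  have "D [:[:1:]:] = 0" "D [:[:0:]:] = 0" using d by blast+
  then show 10: "D 1 = 0" "D 0 = 0" by (simp_all add: one_pCons)
  have neg: "D (- A) = - D A" for A using d 10 by (metis add.right_inverse minus_unique)
  then show "D (- A) = - D A" .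
  show "D (A - B) = D A - D B" using d neg by (metis diff_conv_add_uminus)
qed

lemma pd_eq:
  fixes \<phi> :: "'k::field_char_0 \<Rightarrow> 'k \<Rightarrow> 'k"
  assumes D: "derivation D" and r: "rep \<phi> s t A B"
  shows "pd D \<phi> s t = (ev (D A) s t * ev B s t - ev A s t * ev (D B) s t) / (ev B s t)\<^sup>2"
  unfolding pd_def
proof (rule the_equality)
  fix d assume "\<exists>A B. rep \<phi> s t A B \<and>
     d = (ev (D A) s t * ev B s t - ev A s t * ev (D B) s t) / (ev B s t)\<^sup>2"
  then obtain A' B' where r': "rep \<phi> s t A' B'" and
    d: "d = (ev (D A') s t * ev B' s t - ev A' s t * ev (D B') s t) / (ev B' s t)\<^sup>2" by blast
  note nz = r[unfolded rep_def, THEN conjunct1] r'[unfolded rep_def, THEN conjunct1]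
  \<comment> \<open>Differentiating the polynomial identity \<open>A * B' = A' * B\<close> expresses
    the derivative of \<open>A'\<close> by those of the other three.\<close>
  have "ev (D (A * B')) s t = ev (D (A' * B)) s t" using rep_unique[OF r r'] by simp
  then have 1: "ev A s t * ev (D B') s t + ev B' s t * ev (D A) s t =
      ev A' s t * ev (D B) s t + ev B s t * ev (D A') s t"
    by (simp add: derivation_ev[OF D])
  have "ev (A * B') s t = ev (A' * B) s t" using rep_unique[OF r r'] by simp
  then have 2: "ev A' s t = ev A s t * ev B' s t / ev B s t" using nz by (simp add: field_simps)
  have 3: "ev (D A') s t = (ev A s t * ev (D B') s t + ev B' s t * ev (D A) s t
      - ev A s t * ev B' s t / ev B s t * ev (D B) s t) / ev B s t"
    using 1 nz unfolding 2 by (simp add: field_simps)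
  show "d = (ev (D A) s t * ev B s t - ev A s t * ev (D B) s t) / (ev B s t)\<^sup>2"
    unfolding d 3 2 using nz by (simp add: field_simps power2_eq_square)
qed (use r in blast)

text \<open>The fraction represents the function on a whole open set, so one quotient rule serves
  all its points and the derivative is again a rational function there.\<close>

lemma rep_pd:
  fixes \<phi> :: "'k::field_char_0 \<Rightarrow> 'k \<Rightarrow> 'k"
  assumes D: "derivation D" and r: "rep \<phi> s t A B"
  shows "rep (pd D \<phi>) s t (D A * B - A * D B) (B ^ 2)"
  unfolding rep_def
proof (intro conjI allI impI)
  show "ev (B\<^sup>2) s t \<noteq> 0" using r by (simp add: rep_def)
  fix s' t' assume "ev (B ^ 2) s' t' \<noteq> 0"
  then have "rep \<phi> s' t' A B" using r by (simp add: rep_def)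
  from pd_eq[OF D this] show "pd D \<phi> s' t' = ev (D A * B - A * D B) s' t' / ev (B\<^sup>2) s' t'" by simp
qed

lemma reg2_pd:
  fixes \<phi> :: "'k::field_char_0 \<Rightarrow> 'k \<Rightarrow> 'k"
  shows "derivation D \<Longrightarrow> reg2 \<phi> s t \<Longrightarrow> reg2 (pd D \<phi>) s t"
  unfolding reg2_def using rep_pd by blast

lemma pd_ev:
  fixes A :: "'k::field_char_0 poly poly"
  assumes D: "derivation D"
  shows "pd D (ev A) s t = ev (D A) s t"
  using pd_eq[OF D rep_ev] by (simp add: derivation_ev[OF D])

lemma pd_cong:
  fixes \<phi> \<psi> :: "'k::field_char_0 \<Rightarrow> 'k \<Rightarrow> 'k"
  assumes D: "derivation D" and "reg2 \<phi> s t" "near s t (\<lambda>s t. \<phi> s t = \<psi> s t)"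
  shows "pd D \<phi> s t = pd D \<psi> s t"
proof -
  obtain A B where r: "rep \<phi> s t A B" using assms(2) by (auto simp: reg2_def)
  obtain C where C: "ev C s t \<noteq> 0" "rep \<psi> s t (A * C) (B * C)"
    using rep_cong[OF r assms(3)] by blast
  show ?thesis unfolding pd_eq[OF D C(2)] pd_eq[OF D rep_shrink[OF r C(1)]] ..
qed

lemma pd_add:
  fixes \<phi> \<psi> :: "'k::field_char_0 \<Rightarrow> 'k \<Rightarrow> 'k"
  assumes D: "derivation D" and "reg2 \<phi> s t" "reg2 \<psi> s t"
  shows "pd D (\<lambda>s t. \<phi> s t + \<psi> s t) s t = pd D \<phi> s t + pd D \<psi> s t"
proof -
  obtain A B A' B' where r: "rep \<phi> s t A B" "rep \<psi> s t A' B'" using assms by (auto simp: reg2_def)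
  then have "ev B s t \<noteq> 0" "ev B' s t \<noteq> 0" by (auto simp: rep_def)
  then show ?thesis
    unfolding pd_eq[OF D rep_add[OF r]] pd_eq[OF D r(1)] pd_eq[OF D r(2)]
    by (simp add: derivation_ev[OF D] field_simps power2_eq_square)
qed

lemma pd_mult:
  fixes \<phi> \<psi> :: "'k::field_char_0 \<Rightarrow> 'k \<Rightarrow> 'k"
  assumes D: "derivation D" and "reg2 \<phi> s t" "reg2 \<psi> s t"
  shows "pd D (\<lambda>s t. \<phi> s t * \<psi> s t) s t = \<phi> s t * pd D \<psi> s t + \<psi> s t * pd D \<phi> s t"
proof -
  obtain A B A' B' where r: "rep \<phi> s t A B" "rep \<psi> s t A' B'" using assms by (auto simp: reg2_def)
  then have nz: "ev B s t \<noteq> 0" "ev B' s t \<noteq> 0" and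
    v: "\<phi> s t = ev A s t / ev B s t" "\<psi> s t = ev A' s t / ev B' s t" by (auto simp: rep_def)
  show ?thesis
    unfolding pd_eq[OF D rep_mult[OF r]] pd_eq[OF D r(1)] pd_eq[OF D r(2)] v
    using nz by (simp add: derivation_ev[OF D] field_simps power2_eq_square)
qed

lemma pd_const:
  "derivation D \<Longrightarrow> pd D (\<lambda>s t. c :: 'k::field_char_0) s t = 0"
  using pd_ev[of D "[:[:c:]:]"] by (simp add: derivation_ev ev_fun)

lemma pd_cmult:
  fixes \<phi> :: "'k::field_char_0 \<Rightarrow> 'k \<Rightarrow> 'k"
  assumes D: "derivation D" and "reg2 \<phi> s t"
  shows "pd D (\<lambda>s t. c * \<phi> s t) s t = c * pd D \<phi> s t"
  using pd_mult[OF D reg2_const assms(2)] pd_const[OF D] by simp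

lemma pd_sum:
  fixes \<phi> :: "'i \<Rightarrow> 'k::field_char_0 \<Rightarrow> 'k \<Rightarrow> 'k"
  assumes D: "derivation D"
  shows "(\<And>i. i \<in> I \<Longrightarrow> reg2 (\<phi> i) s t) \<Longrightarrow>
    pd D (\<lambda>s t. \<Sum>i\<in>I. \<phi> i s t) s t = (\<Sum>i\<in>I. pd D (\<phi> i) s t)"
  by (induction I rule: infinite_finite_induct)
    (simp_all add: pd_const[OF D] pd_add[OF D] reg2_sum)

text \<open>Symmetry of mixed derivatives, which cancels the second derivatives when the exterior
  derivative is computed in coordinates.\<close>

lemma pd_commute:
  fixes \<phi> :: "'k::field_char_0 \<Rightarrow> 'k \<Rightarrow> 'k"
  assumes D: "derivation D" and D': "derivation D'" and c: "\<And>A. D (D' A) = D' (D A)"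
    and "reg2 \<phi> s t"
  shows "pd D (pd D' \<phi>) s t = pd D' (pd D \<phi>) s t"
proof -
  obtain A B where r: "rep \<phi> s t A B" using assms by (auto simp: reg2_def)
  then have "ev B s t \<noteq> 0" by (simp add: rep_def)
  then show ?thesis
    unfolding pd_eq[OF D rep_pd[OF D' r]] pd_eq[OF D' rep_pd[OF D r]]
    by (simp add: derivation_ev[OF D] derivation_ev[OF D'] c power2_eq_square field_simps)
qed

lemma pd_basic [simp]:
  fixes p :: "'k::field_char_0 poly"
  shows "pd dS (\<lambda>s t. poly p s) s t = poly (pderiv p) s" "pd dT (\<lambda>s t. poly p s) s t = 0"
    "pd dS (\<lambda>s t. poly p t) s t = 0" "pd dT (\<lambda>s t. poly p t) s t = poly (pderiv p) t"
    "pd dS (\<lambda>s t. s :: 'k) s t = 1" "pd dT (\<lambda>s t. s :: 'k) s t = 0"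
    "pd dS (\<lambda>s t. t :: 'k) s t = 0" "pd dT (\<lambda>s t. t :: 'k) s t = 1"
proof -
  have S: "pd dS (\<lambda>s t. poly p s) s t = poly (pderiv p) s" and
    T: "pd dT (\<lambda>s t. poly p s) s t = 0" for p :: "'k poly" and s t
    using pd_ev[OF derivation_dS, of "[:p:]"] pd_ev[OF derivation_dT, of "[:p:]"]
    by (simp_all add: dT_pCons ev_fun)
  have S': "pd dS (\<lambda>s t. poly p t) s t = 0" and
    T': "pd dT (\<lambda>s t. poly p t) s t = poly (pderiv p) t" for p :: "'k poly" and s t
    using pd_ev[OF derivation_dS, of "tpoly p"] pd_ev[OF derivation_dT, of "tpoly p"]
    by (simp_all add: dT_tpoly ev_fun)
  show "pd dS (\<lambda>s t. poly p s) s t = poly (pderiv p) s" "pd dT (\<lambda>s t. poly p s) s t = 0"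
    "pd dS (\<lambda>s t. poly p t) s t = 0" "pd dT (\<lambda>s t. poly p t) s t = poly (pderiv p) t"
    by (rule S T S' T')+
  show "pd dS (\<lambda>s t. s :: 'k) s t = 1" "pd dT (\<lambda>s t. s :: 'k) s t = 0"
    "pd dS (\<lambda>s t. t :: 'k) s t = 0" "pd dT (\<lambda>s t. t :: 'k) s t = 1"
    using S[of "[:0, 1:]" s t] T[of "[:0, 1:]" s t] S'[of "[:0, 1:]" s t] T'[of "[:0, 1:]" s t]
    by (simp_all add: pderiv_pCons)
qed

section \<open>Forms\<close>

text \<open>Forms come as functions rather than formal polynomials, so only the existence of a
  polynomial in s and t with these values is recorded.\<close>

definition evf :: "('k::field \<Rightarrow> 'k \<Rightarrow> 'k) \<Rightarrow> bool" where
  "evf \<phi> \<longleftrightarrow> (\<exists>B. \<forall>s t. \<phi> s t = ev B s t)"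

lemma evf_const: "evf (\<lambda>s t. c)"
  unfolding evf_def by (intro exI[of _ "[:[:c:]:]"]) simp

lemma evf_fst: "evf (\<lambda>s t. s)"
  unfolding evf_def by (intro exI[of _ "[:[:0, 1:]:]"]) simp

lemma evf_snd: "evf (\<lambda>s t. t)"
  unfolding evf_def by (intro exI[of _ "[:0, 1:]"]) simp

lemma evf_add: "evf \<phi> \<Longrightarrow> evf \<psi> \<Longrightarrow> evf (\<lambda>s t. \<phi> s t + \<psi> s t)"
  unfolding evf_def by (metis ev_simps(3))

lemma evf_mult: "evf \<phi> \<Longrightarrow> evf \<psi> \<Longrightarrow> evf (\<lambda>s t. \<phi> s t * \<psi> s t)"
  unfolding evf_def by (metis ev_simps(6))

lemma evf_power: "evf \<phi> \<Longrightarrow> evf (\<lambda>s t. \<phi> s t ^ m)"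
  unfolding evf_def by (metis ev_simps(7))

lemma evf_sum: "(\<And>i. i \<in> I \<Longrightarrow> evf (\<phi> i)) \<Longrightarrow> evf (\<lambda>s t. \<Sum>i\<in>I. \<phi> i s t)"
  by (induction I rule: infinite_finite_induct) (auto intro: evf_const evf_add)

lemma evf_prod: "(\<And>i. i \<in> I \<Longrightarrow> evf (\<phi> i)) \<Longrightarrow> evf (\<lambda>s t. \<Prod>i\<in>I. \<phi> i s t)"
  by (induction I rule: infinite_finite_induct) (auto intro: evf_const evf_mult)

lemma evf_reg2: "evf \<phi> \<Longrightarrow> reg2 \<phi> s t"
  unfolding evf_def by (elim exE, rule reg2_cong[OF reg2_ev near_True]) simp

lemma evf_near_nonzero: "evf \<phi> \<Longrightarrow> \<phi> s t \<noteq> 0 \<Longrightarrow> near s t (\<lambda>s t. \<phi> s t \<noteq> 0)"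
  unfolding evf_def near_def by auto

text \<open>In \<open>hpoly\<close> each exponent vector occurs once, whereas sums and products of
  forms produce repetitions; the coefficients with equal exponents are collected in
  \<open>c'\<close>.\<close>

lemma hpoly_indexedI:
  assumes "finite J" "\<And>j. j \<in> J \<Longrightarrow> (\<Sum>i\<le>N. \<alpha> j i) = d"
  shows "(\<lambda>v. \<Sum>j\<in>J. c j * (\<Prod>i\<le>N. v i ^ \<alpha> j i)) \<in> hpoly N d"
proof -
  define c' where "c' a = (\<Sum>j\<in>{j \<in> J. \<alpha> j = a}. c j)" for a
  have "(\<Sum>j\<in>J. c j * (\<Prod>i\<le>N. v i ^ \<alpha> j i)) = (\<Sum>a\<in>\<alpha> ` J. c' a * (\<Prod>i\<le>N. v i ^ a i))" for v
    unfolding sum.image_gen[OF assms(1), where g = \<alpha>] c'_def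
    by (intro sum.cong refl) (simp add: sum_distrib_right)
  then show ?thesis unfolding hpoly_def using assms by blast
qed

lemma hpoly_const: "(\<lambda>v. c) \<in> hpoly N 0"
  using hpoly_indexedI[of "{()}" "\<lambda>_ _. 0" N 0 "\<lambda>_. c"] by simp

lemma hpoly_var:
  assumes "k \<le> N" shows "(\<lambda>v. v k) \<in> hpoly N 1"
proof -
  have *: "(\<Prod>i\<le>N. v i ^ (if i = k then 1 else 0)) = v k" for v :: "nat \<Rightarrow> 'a"
  proof -
    have "(\<Prod>i\<le>N. v i ^ (if i = k then 1 else 0)) = (\<Prod>i\<le>N. if i = k then v i else 1)"
      by (intro prod.cong) auto
    then show ?thesis using assms by simp
  qed
  have "(\<lambda>v :: nat \<Rightarrow> 'a. \<Sum>j\<in>{()}. 1 * (\<Prod>i\<le>N. v i ^ (if i = k then 1 else 0))) \<in> hpoly N 1"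
    using assms by (intro hpoly_indexedI) auto
  then show ?thesis unfolding * by simp
qed

lemma hpoly_mult:
  assumes "P \<in> hpoly N d" "Q \<in> hpoly N e"
  shows "(\<lambda>v. P v * Q v) \<in> hpoly N (d + e)"
proof -
  obtain A c where A: "finite A" "\<And>\<alpha>. \<alpha> \<in> A \<Longrightarrow> (\<Sum>i\<le>N. \<alpha> i) = d"
    "P = (\<lambda>v. \<Sum>\<alpha>\<in>A. c \<alpha> * (\<Prod>i\<le>N. v i ^ \<alpha> i))" using assms(1) by (auto simp: hpoly_def)
  obtain B c' where B: "finite B" "\<And>\<alpha>. \<alpha> \<in> B \<Longrightarrow> (\<Sum>i\<le>N. \<alpha> i) = e"
    "Q = (\<lambda>v. \<Sum>\<alpha>\<in>B. c' \<alpha> * (\<Prod>i\<le>N. v i ^ \<alpha> i))" using assms(2) by (auto simp: hpoly_def)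
  have "P v * Q v = (\<Sum>x\<in>A \<times> B. c (fst x) * c' (snd x) * (\<Prod>i\<le>N. v i ^ (fst x i + snd x i)))" for v
    unfolding A(3) B(3) sum_product sum.cartesian_product
    by (intro sum.cong) (auto simp: power_add prod.distrib)
  then show ?thesis
    using hpoly_indexedI[of "A \<times> B" "\<lambda>x i. fst x i + snd x i" N "d + e" "\<lambda>x. c (fst x) * c' (snd x)"] A B
    by (auto simp: sum.distrib)
qed

lemma hpoly_add:
  assumes "P \<in> hpoly N d" "Q \<in> hpoly N d"
  shows "(\<lambda>v. P v + Q v) \<in> hpoly N d"
proof -
  obtain A c where A: "finite A" "\<And>\<alpha>. \<alpha> \<in> A \<Longrightarrow> (\<Sum>i\<le>N. \<alpha> i) = d"
    "P = (\<lambda>v. \<Sum>\<alpha>\<in>A. c \<alpha> * (\<Prod>i\<le>N. v i ^ \<alpha> i))" using assms(1) by (auto simp: hpoly_def)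
  obtain B c' where B: "finite B" "\<And>\<alpha>. \<alpha> \<in> B \<Longrightarrow> (\<Sum>i\<le>N. \<alpha> i) = d"
    "Q = (\<lambda>v. \<Sum>\<alpha>\<in>B. c' \<alpha> * (\<Prod>i\<le>N. v i ^ \<alpha> i))" using assms(2) by (auto simp: hpoly_def)
  have "P v + Q v = (\<Sum>x\<in>A <+> B. case_sum c c' x * (\<Prod>i\<le>N. v i ^ case_sum id id x i))" for v
    unfolding A(3) B(3) by (simp add: sum.Plus A B)
  moreover have "(\<Sum>i\<le>N. case_sum id id x i) = d" if "x \<in> A <+> B" for x
    using that A(2) B(2) by (auto elim!: PlusE)
  ultimately show ?thesis
    using hpoly_indexedI[of "A <+> B" "case_sum id id" N d "case_sum c c'"] A(1) B(1) by simp
qed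

lemma hpoly_power: "P \<in> hpoly N d \<Longrightarrow> (\<lambda>v. P v ^ m) \<in> hpoly N (d * m)"
  by (induction m) (use hpoly_mult[of P N d] in \<open>auto simp: hpoly_const\<close>)

lemma hpoly_var_power: "k \<le> N \<Longrightarrow> (\<lambda>v. v k ^ m) \<in> hpoly N m"
  using hpoly_power[OF hpoly_var] by fastforce

lemma hpoly_evf:
  assumes "P \<in> hpoly N d" "\<And>i. evf (\<lambda>s t. x s t i)"
  shows "evf (\<lambda>s t. P (x s t))"
  using assms by (auto simp: hpoly_def intro!: evf_sum evf_mult evf_prod evf_power evf_const)

lemma bihpoly_evf:
  assumes "P \<in> bihpoly N M d e" "\<And>i. evf (\<lambda>s t. x s t i)" "\<And>i. evf (\<lambda>s t. y s t i)"
  shows "evf (\<lambda>s t. P (x s t) (y s t))"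
  using assms
  by (auto simp: bihpoly_def case_prod_unfold intro!: evf_sum evf_mult evf_prod evf_power evf_const)

lemma hpoly_scale: "P \<in> hpoly N d \<Longrightarrow> P (\<lambda>i. c * v i) = c ^ d * P v"
  by (auto simp: hpoly_def power_mult_distrib prod.distrib sum_distrib_left algebra_simps
      simp flip: power_sum intro!: sum.cong)

lemma bihpoly_scale:
  assumes "P \<in> bihpoly N M d e"
  shows "P (\<lambda>i. c * v i) (\<lambda>i. c' * w i) = c ^ d * c' ^ e * P v w"
proof -
  obtain A b where A: "\<forall>(\<alpha>, \<beta>)\<in>A. (\<Sum>i\<le>N. \<alpha> i) = d \<and> (\<Sum>j\<le>M. \<beta> j) = e"
    "P = (\<lambda>v w. \<Sum>(\<alpha>, \<beta>)\<in>A. b (\<alpha>, \<beta>) * (\<Prod>i\<le>N. v i ^ \<alpha> i) * (\<Prod>j\<le>M. w j ^ \<beta> j))"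
    using assms unfolding bihpoly_def mem_Collect_eq by (elim exE conjE) (rule that)
  show ?thesis
    unfolding A(2) sum_distrib_left using A(1)
    by (intro sum.cong refl) (auto simp: power_mult_distrib prod.distrib simp flip: power_sum)
qed

lemma bihpoly_product:
  assumes "P \<in> hpoly N d" "Q \<in> hpoly M e"
  shows "(\<lambda>v w. P v * Q w) \<in> bihpoly N M d e"
proof -
  obtain A c where A: "finite A" "\<And>\<alpha>. \<alpha> \<in> A \<Longrightarrow> (\<Sum>i\<le>N. \<alpha> i) = d"
    "P = (\<lambda>v. \<Sum>\<alpha>\<in>A. c \<alpha> * (\<Prod>i\<le>N. v i ^ \<alpha> i))" using assms(1) by (auto simp: hpoly_def)
  obtain B c' where B: "finite B" "\<And>\<alpha>. \<alpha> \<in> B \<Longrightarrow> (\<Sum>i\<le>M. \<alpha> i) = e"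
    "Q = (\<lambda>v. \<Sum>\<alpha>\<in>B. c' \<alpha> * (\<Prod>i\<le>M. v i ^ \<alpha> i))" using assms(2) by (auto simp: hpoly_def)
  have "(\<lambda>v w. P v * Q w) = (\<lambda>v w. \<Sum>(\<alpha>, \<beta>)\<in>A \<times> B. (case (\<alpha>, \<beta>) of (\<alpha>, \<beta>) \<Rightarrow> c \<alpha> * c' \<beta>) *
      (\<Prod>i\<le>N. v i ^ \<alpha> i) * (\<Prod>j\<le>M. w j ^ \<beta> j))"
    unfolding A(3) B(3) sum_product sum.cartesian_product
    by (intro ext sum.cong) (auto simp: algebra_simps)
  then show ?thesis unfolding bihpoly_def using A(1,2) B(1,2)
    by (intro CollectI exI[of _ "A \<times> B"] exI[of _ "\<lambda>(\<alpha>, \<beta>). c \<alpha> * c' \<beta>"]) auto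
qed

section \<open>Charts of the balanced scroll\<close>

lemma hclass_self: "v \<in> hclass v"
  unfolding hclass_def by (auto intro!: exI[of _ 1])

lemma hclass_scale:
  fixes v :: "nat \<Rightarrow> 'k::field"
  assumes "c \<noteq> 0" shows "hclass (\<lambda>i. c * v i) = hclass v"
proof -
  have "\<exists>d'. (\<lambda>i. d * v i) = (\<lambda>i. d' * (c * v i)) \<and> d' \<noteq> 0" if "d \<noteq> 0" for d
    using assms that by (intro exI[of _ "d / c"]) auto
  moreover have "\<exists>d'. (\<lambda>i. d * (c * v i)) = (\<lambda>i. d' * v i) \<and> d' \<noteq> 0" if "d \<noteq> 0" for d
    using assms that by (intro exI[of _ "d * c"]) (auto simp: mult.assoc)
  ultimately show ?thesis by (auto simp: hclass_def)
qed

lemma in_hclassE: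
  assumes "u \<in> hclass v"
  obtains c where "c \<noteq> 0" "u = (\<lambda>i. c * v i)"
  using assms by (auto simp: hclass_def)

lemma hclass_eqE:
  assumes "hclass u = hclass v"
  obtains c where "c \<noteq> 0" "u = (\<lambda>i. c * v i)"
  using assms hclass_self[of u] in_hclassE by metis

text \<open>Homogeneous coordinates \<open>(1, s)\<close> or \<open>(s, 1)\<close> on the line; the flag tells which coordinate is \<open>1\<close>.\<close>

definition aff :: "bool \<Rightarrow> 'k::field \<Rightarrow> nat \<Rightarrow> 'k" where
  "aff i s k = (if k = of_bool i then 1 else if k = of_bool (\<not> i) then s else 0)"

lemma aff_simps [simp]: "aff i s (of_bool i) = 1" "aff i s (of_bool (\<not> i)) = s"
  "aff (\<not> i) s (of_bool i) = s"
  by (auto simp: aff_def of_bool_def)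

lemma aff_nonzero [simp]: "aff i s \<in> kvec 1 - {\<lambda>_. 0}"
  by (cases i) (auto simp: aff_def kvec_def fun_eq_iff)

lemma aff_flip:
  assumes "s * s' = 1" shows "aff i s = (\<lambda>k. s * aff (\<not> i) s' k)"
  using assms by (cases i) (auto simp: aff_def fun_eq_iff)

lemma nonzero_vector_aff:
  fixes w :: "nat \<Rightarrow> 'k::field"
  assumes "w \<in> kvec 1 - {\<lambda>_. 0}"
  obtains (aff) i c s where "c \<noteq> 0" "w = (\<lambda>k. c * aff i s k)"
proof -
  have "w 0 \<noteq> 0 \<or> w 1 \<noteq> 0"
  proof (rule ccontr)
    assume "\<not> ?thesis"
    then have "w i = 0" for i using assms by (cases "i \<le> 1") (auto simp: kvec_def le_Suc_eq)
    then show False using assms by auto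
  qed
  moreover have "thesis" if "w 0 \<noteq> 0"
  proof (rule aff)
    show "w 0 \<noteq> 0" by fact
    show "w = (\<lambda>k. w 0 * aff False (w 1 / w 0) k)"
      using assms \<open>w 0 \<noteq> 0\<close> by (auto simp: kvec_def aff_def fun_eq_iff)
  qed
  moreover have "thesis" if "w 1 \<noteq> 0"
  proof (rule aff)
    show "w 1 \<noteq> 0" by fact
    show "w = (\<lambda>k. w 1 * aff True (w 0 / w 1) k)"
      using assms \<open>w 1 \<noteq> 0\<close> by (auto simp: kvec_def aff_def fun_eq_iff)
  qed
  ultimately show thesis by blast
qed

lemma evf_aff: "evf (\<lambda>s t. aff i s k)" "evf (\<lambda>s t. aff j t k)"
  by (cases "k = of_bool i"; cases "k = of_bool (\<not> i)"; simp add: aff_def evf_const evf_fst)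
    (cases "k = of_bool j"; cases "k = of_bool (\<not> j)"; simp add: aff_def evf_const evf_snd)

text \<open>\<open>n\<close> is the common value of a0 and a1. Its positivity provides the
  coordinate with index \<open>idx'\<close>, from which s is read off.\<close>

locale balanced_scroll =
  fixes n :: nat
  assumes n_pos: "0 < n"
begin

abbreviation sm :: "(nat \<Rightarrow> 'k::field) \<Rightarrow> (nat \<Rightarrow> 'k) \<Rightarrow> nat \<Rightarrow> 'k" where
  "sm \<equiv> scroll_map n n"

abbreviation X :: "('k::field ppoint, 'k) kspace" where
  "X \<equiv> scroll n n"

definition smc :: "bool \<Rightarrow> bool \<Rightarrow> 'k::field \<Rightarrow> 'k \<Rightarrow> nat \<Rightarrow> 'k" where
  "smc i j s t = sm (aff i s) (aff j t)"

definition chart :: "bool \<Rightarrow> bool \<Rightarrow> 'k::field \<Rightarrow> 'k \<Rightarrow> 'k ppoint" where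
  "chart i j s t = hclass (smc i j s t)"

text \<open>The indices of the coordinates \<open>w i ^ n * y j\<close> and \<open>w i ^ (n - 1) * w (1 - i) * y j\<close>.\<close>

definition idx :: "bool \<Rightarrow> bool \<Rightarrow> nat" where
  "idx i j = (if j then n + 1 else 0) + (if i then n else 0)"

definition idx' :: "bool \<Rightarrow> bool \<Rightarrow> nat" where
  "idx' i j = (if j then n + 1 else 0) + (if i then n - 1 else 1)"

lemma idx_le: "idx i j \<le> n + n + 1" "idx' i j \<le> n + n + 1"
  using n_pos by (auto simp: idx_def idx'_def)

lemma sm_idx: "sm w y (idx i j) = w (of_bool i) ^ n * y (of_bool j)"
  by (auto simp: scroll_map_def idx_def)

lemma sm_idx': "sm w y (idx' i j) = w (of_bool i) ^ (n - 1) * w (of_bool (\<not> i)) * y (of_bool j)"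
  using n_pos by (cases i; cases j) (auto simp: scroll_map_def idx'_def)

lemma smc_idx [simp]: "smc i j s t (idx i j) = 1" "smc i j s t (idx i (\<not> j)) = t"
  "smc i j s t (idx' i j) = s"
  by (simp_all add: smc_def sm_idx sm_idx')

lemma sm_scale: "c * d = e \<Longrightarrow> c = b ^ n \<Longrightarrow>
    sm (\<lambda>k. b * w k) (\<lambda>k. d * y k) = (\<lambda>k. e * sm w y k)"
  by (auto simp: scroll_map_def fun_eq_iff power_mult_distrib simp flip: power_add)

lemma smc_evf: "evf (\<lambda>s t. smc i j s t k)"
  unfolding smc_def scroll_map_def
  by (cases "k \<le> n"; cases "k \<le> n + n + 1"; simp add: evf_const)
    (intro evf_mult evf_power evf_aff)+

lemma chart_in_points: "chart i j s t \<in> scroll_points n n"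
  unfolding chart_def smc_def scroll_points_def using aff_nonzero by blast

lemma chart_in_proj: "chart i j s t \<in> proj (n + n + 1)"
proof -
  have "smc i j s t \<in> kvec (n + n + 1)" by (auto simp: smc_def kvec_def scroll_map_def)
  moreover have "smc i j s t \<noteq> (\<lambda>_. 0)" using smc_idx(1)[of i j s t] by (metis zero_neq_one)
  ultimately show ?thesis by (auto simp: proj_def chart_def)
qed

lemma scroll_points_chart:
  assumes "p \<in> scroll_points n n"
  obtains i j s t where "p = chart i j s t"
proof -
  obtain w y where wy: "p = hclass (sm w y)" "w \<in> kvec 1 - {\<lambda>_. 0}" "y \<in> kvec 1 - {\<lambda>_. 0}"
    using assms by (auto simp: scroll_points_def)
  obtain i b s where b: "b \<noteq> 0" "w = (\<lambda>k. b * aff i s k)" by (rule nonzero_vector_aff[OF wy(2)])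
  obtain j d t where d: "d \<noteq> 0" "y = (\<lambda>k. d * aff j t k)" by (rule nonzero_vector_aff[OF wy(3)])
  have "hclass (sm w y) = hclass (sm (aff i s) (aff j t))"
    using b(1) d(1) unfolding b(2) d(2) sm_scale[OF refl refl] by (intro hclass_scale) auto
  then show thesis using that wy(1) unfolding chart_def smc_def by blast
qed

text \<open>Three projective coordinates are compared, namely those that equal 1, t and s on the
  chart. The first shows that the other representative lies over the same chart, the remaining two
  give the ratios of its coordinates.\<close>

lemma chart_eq_sm:
  assumes "chart i j s t = hclass (sm w y)"
  shows "w (of_bool i) \<noteq> 0" "y (of_bool j) \<noteq> 0"
    "s * w (of_bool i) = w (of_bool (\<not> i))" "t * y (of_bool j) = y (of_bool (\<not> j))"
proof -
  obtain c where c: "c \<noteq> 0" "smc i j s t = (\<lambda>k. c * sm w y k)"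
    using assms unfolding chart_def by (rule hclass_eqE)
  have 1: "1 = c * (w (of_bool i) ^ n * y (of_bool j))"
    and t: "t = c * (w (of_bool i) ^ n * y (of_bool (\<not> j)))"
    and s: "s = c * (w (of_bool i) ^ (n - 1) * w (of_bool (\<not> i)) * y (of_bool j))"
    using c(2)[THEN fun_cong, of "idx i j"] c(2)[THEN fun_cong, of "idx i (\<not> j)"]
      c(2)[THEN fun_cong, of "idx' i j"] by (simp_all only: smc_idx sm_idx sm_idx')
  show "w (of_bool i) \<noteq> 0" "y (of_bool j) \<noteq> 0" using 1 n_pos by (metis mult_zero_left mult_zero_right zero_neq_one power_0_left not_gr_zero)+
  have "s * w (of_bool i) = c * (w (of_bool i) ^ n * y (of_bool j)) * w (of_bool (\<not> i))"
    unfolding s using n_pos by (cases n) (simp_all add: algebra_simps)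
  then show "s * w (of_bool i) = w (of_bool (\<not> i))" using 1 by simp
  have "t * y (of_bool j) = c * (w (of_bool i) ^ n * y (of_bool j)) * y (of_bool (\<not> j))"
    unfolding t by (simp add: algebra_simps)
  then show "t * y (of_bool j) = y (of_bool (\<not> j))" using 1 by simp
qed

lemma chart_inj [simp]:
  "chart i j s t = chart i j s' t' \<longleftrightarrow> s = s' \<and> t = t'"
  using chart_eq_sm(3,4)[of i j s t "aff i s'" "aff j t'"] by (auto simp: chart_def smc_def)

lemma chart_fst_eq: "chart i j s t = chart i j' s' t' \<Longrightarrow> s = s'"
  using chart_eq_sm(3)[of i j s t "aff i s'" "aff j' t'"] by (auto simp: chart_def smc_def)

lemma chart_snd_eq: "chart i j s t = chart i' j s' t' \<Longrightarrow> t = t'"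
  using chart_eq_sm(4)[of i j s t "aff i' s'" "aff j t'"] by (auto simp: chart_def smc_def)

lemma chart_fst_eq_flip: "chart i j s t = chart (\<not> i) j' s' t' \<Longrightarrow> s * s' = 1"
  using chart_eq_sm(3)[of i j s t "aff (\<not> i) s'" "aff j' t'"] by (cases i) (auto simp: chart_def smc_def aff_def)

lemma chart_snd_eq_flip: "chart i j s t = chart i' (\<not> j) s' t' \<Longrightarrow> t * t' = 1"
  using chart_eq_sm(4)[of i j s t "aff i' s'" "aff (\<not> j) t'"] by (cases j) (auto simp: chart_def smc_def aff_def)

lemma smc_flip_fst: "s * s' = 1 \<Longrightarrow> smc i j s t = (\<lambda>k. s ^ n * smc (\<not> i) j s' t k)"
  unfolding smc_def aff_flip[of s s' i] using sm_scale[of "s ^ n" 1 "s ^ n" s] by simp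

lemma smc_flip_snd: "t * t' = 1 \<Longrightarrow> smc i j s t = (\<lambda>k. t * smc i (\<not> j) s t' k)"
  unfolding smc_def aff_flip[of t t' j] using sm_scale[of 1 t t 1] by simp

lemma chart_flip_fst: "s * s' = 1 \<Longrightarrow> chart i j s t = chart (\<not> i) j s' t"
  unfolding chart_def by (subst smc_flip_fst, assumption, intro hclass_scale) auto

lemma chart_flip_snd: "t * t' = 1 \<Longrightarrow> chart i j s t = chart i (\<not> j) s t'"
  unfolding chart_def by (subst smc_flip_snd, assumption, intro hclass_scale) auto

lemma scroll_proj_chart: "scroll_proj n n (chart i j s t) = hclass (aff i s)"
  unfolding chart_def smc_def
  by (rule scroll_proj_scroll_map[OF n_pos order_refl aff_nonzero aff_nonzero])

subsection \<open>Topology\<close>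

definition principal :: "bool \<Rightarrow> bool \<Rightarrow> 'k::field poly poly \<Rightarrow> 'k ppoint set" where
  "principal i j B = {chart i j s t | s t. ev B s t \<noteq> 0}"

lemma ktop_X: "ktop X = subtopology (zariski (n + n + 1)) (scroll_points n n)"
  by (simp add: scroll_def pvariety_def)

text \<open>Continuity of the charts, by induction on the generation of the topology: a form pulled
  back along \<open>smc\<close> is a polynomial in s and t, and by homogeneity its nonvanishing does
  not depend on the representative.\<close>

lemma open_near:
  assumes "openin (ktop X) V" "chart i j s t \<in> V"
  shows "near s t (\<lambda>s t. chart i j s t \<in> V)"
proof -
  obtain T where T: "openin (zariski (n + n + 1)) T" "V = T \<inter> scroll_points n n"
    using assms(1) unfolding ktop_X openin_subtopology by blast
  have "generate_topology_on {{p \<in> proj (n + n + 1). \<forall>v\<in>p. F v \<noteq> 0} | d F. F \<in> hpoly (n + n + 1) d} T"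
    using T(1) unfolding zariski_def openin_topology_generated_by_iff .
  then have "chart i j s t \<in> T \<longrightarrow> near s t (\<lambda>s t. chart i j s t \<in> T)"
  proof (induction rule: generate_topology_on.induct)
    case (Int a b)
    then show ?case using near_conj[of s t "\<lambda>s t. chart i j s t \<in> a" "\<lambda>s t. chart i j s t \<in> b"] by auto
  next
    case (UN K)
    show ?case
    proof
      assume "chart i j s t \<in> \<Union>K"
      then obtain k where k: "k \<in> K" "chart i j s t \<in> k" by blast
      then have "near s t (\<lambda>s t. chart i j s t \<in> k)" using UN by blast
      then show "near s t (\<lambda>s t. chart i j s t \<in> \<Union>K)" by (rule near_mono) (use k in blast)
    qed
  next
    case (Basis b)
    then obtain d F where F: "F \<in> hpoly (n + n + 1) d"
      and b: "b = {p \<in> proj (n + n + 1). \<forall>v\<in>p. F v \<noteq> 0}" by blast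
    have iff: "chart i j s t \<in> b \<longleftrightarrow> F (smc i j s t) \<noteq> 0" for s t
    proof -
      have "(\<forall>v\<in>chart i j s t. F v \<noteq> 0) \<longleftrightarrow> F (smc i j s t) \<noteq> 0"
        unfolding chart_def using hclass_self hpoly_scale[OF F] by (fastforce elim!: in_hclassE)
      then show ?thesis using b chart_in_proj by auto
    qed
    show ?case unfolding iff
      using evf_near_nonzero[OF hpoly_evf[OF F, of "smc i j"], OF smc_evf] by blast
  qed simp
  then show ?thesis using assms(2) unfolding T(2) by (simp add: chart_in_points)
qed

text \<open>On the chart the coordinates with indices \<open>idx i j\<close>,
  \<open>idx' i j\<close> and \<open>idx i (\<not> j)\<close> are 1, s and t, so every polynomial is
  the restriction of a form; the coordinate that is 1 makes up for unequal degrees.\<close>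

lemma homogenize:
  fixes B :: "'k::field poly poly"
  shows "\<exists>d F. F \<in> hpoly (n + n + 1) d \<and>
    (\<forall>c s t. c \<noteq> 0 \<longrightarrow> F (\<lambda>k. c * smc i j s t k) = c ^ d * ev B s t)"
proof -
  let ?h = "\<lambda>B d F. F \<in> hpoly (n + n + 1) d \<and> (\<forall>s t. F (smc i j s t) = ev B s t)"
  have h1: "\<exists>d F. ?h [:p:] d F" for p
  proof (induction p)
    case 0 show ?case using hpoly_const[of 0] by force
  next
    case (pCons a p)
    then obtain d F where F: "?h [:p:] d F" by blast
    have "?h [:pCons a p:] (d + 1) (\<lambda>v. a * v (idx i j) ^ (d + 1) + v (idx' i j) * F v)"
      using F hpoly_add[OF hpoly_mult[OF hpoly_const[of a] hpoly_var_power[OF idx_le(1)[of i j], of "d + 1"]],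
          of "\<lambda>v. v (idx' i j) * F v"] hpoly_mult[OF hpoly_var[OF idx_le(2)[of i j]], of F d] by auto
    then show ?case by blast
  qed
  have "\<exists>d F. ?h B d F"
  proof (induction B)
    case 0 show ?case using hpoly_const[of 0] by force
  next
    case (pCons p B)
    then obtain d F where F: "?h B d F" by blast
    obtain e G where G: "?h [:p:] e G" using h1 by blast
    have 1: "(\<lambda>v. G v * v (idx i j) ^ (d + 1)) \<in> hpoly (n + n + 1) (e + (d + 1))"
      using G by (intro hpoly_mult hpoly_var_power idx_le) auto
    have 2: "(\<lambda>v. v (idx i j) ^ e * (v (idx i (\<not> j)) * F v)) \<in> hpoly (n + n + 1) (e + (1 + d))"
      using F by (intro hpoly_mult hpoly_var_power hpoly_var idx_le) auto
    have "?h (pCons p B) (e + (d + 1))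
        (\<lambda>v. G v * v (idx i j) ^ (d + 1) + v (idx i j) ^ e * (v (idx i (\<not> j)) * F v))"
      using F G hpoly_add[OF 1, unfolded add.commute[of d 1], OF 2] by simp
    then show ?case by blast
  qed
  then obtain d F where F: "?h B d F" by blast
  then show ?thesis using hpoly_scale[of F] by (intro exI[of _ d] exI[of _ F]) auto
qed

lemma open_principal: "openin (ktop X) (principal i j B)"
proof -
  obtain d F where F: "F \<in> hpoly (n + n + 1) d"
    "\<And>c s t. c \<noteq> 0 \<Longrightarrow> F (\<lambda>k. c * smc i j s t k) = c ^ d * ev B s t" using homogenize by blast
  \<comment> \<open>The extra factor vanishes off the chart, so that nonvanishing of
    \<open>G\<close> also confines the point to the chart.\<close>
  define G where "G v = F v * v (idx i j)" for v
  have G: "G \<in> hpoly (n + n + 1) (d + 1)"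
    unfolding G_def using F(1) by (intro hpoly_mult hpoly_var idx_le)
  have Gc: "(\<forall>v\<in>chart i j s t. G v \<noteq> 0) \<longleftrightarrow> ev B s t \<noteq> 0" for s t
  proof -
    have "G (\<lambda>k. c * smc i j s t k) = c ^ d * ev B s t * c" if "c \<noteq> 0" for c
      using F(2)[OF that, of s t] by (simp add: G_def)
    then have "G v \<noteq> 0 \<longleftrightarrow> ev B s t \<noteq> 0" if "v \<in> chart i j s t" for v
      using that unfolding chart_def by (elim in_hclassE) simp
    moreover have "smc i j s t \<in> chart i j s t" by (simp add: chart_def hclass_self)
    ultimately show ?thesis by blast
  qed
  have dom: "\<exists>s t. p = chart i j s t" if "p \<in> scroll_points n n" "\<forall>v\<in>p. G v \<noteq> 0" for p
  proof -
    obtain i' j' s' t' where p: "p = chart i' j' s' t'"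
      using \<open>p \<in> scroll_points n n\<close> by (rule scroll_points_chart)
    have "G (smc i' j' s' t') \<noteq> 0" using that(2) hclass_self unfolding p chart_def by blast
    then have "aff i' s' (of_bool i) ^ n * aff j' t' (of_bool j) \<noteq> 0"
      unfolding G_def by (simp add: smc_def sm_idx)
    then have nz: "aff i' s' (of_bool i) \<noteq> 0" "aff j' t' (of_bool j) \<noteq> 0"
      using n_pos by (auto simp: power_0_left)
    obtain s where s: "chart i' j' s' t' = chart i j' s t'"
      using nz(1) chart_flip_fst[of s' "inverse s'" i' j' t'] by (cases i; cases i') (auto simp: aff_def)
    obtain t where "chart i j' s t' = chart i j s t"
      using nz(2) chart_flip_snd[of t' "inverse t'" i j' s] by (cases j; cases j') (auto simp: aff_def)
    with p s show ?thesis by blast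
  qed
  have "principal i j B = {p \<in> proj (n + n + 1). \<forall>v\<in>p. G v \<noteq> 0} \<inter> scroll_points n n" (is "_ = ?T \<inter> _")
  proof (intro equalityI subsetI)
    fix p assume "p \<in> principal i j B"
    then show "p \<in> ?T \<inter> scroll_points n n"
      using Gc chart_in_proj chart_in_points unfolding principal_def by blast
  next
    fix p assume p: "p \<in> ?T \<inter> scroll_points n n"
    then obtain s t where "p = chart i j s t" using dom by blast
    then show "p \<in> principal i j B" using Gc p unfolding principal_def by blast
  qed
  moreover have "openin (zariski (n + n + 1)) ?T"
    unfolding zariski_def using G by (intro topology_generated_by_Basis) blast
  ultimately show ?thesis unfolding ktop_X openin_subtopology by blast
qed

lemma chart_in_principal [simp]: "chart i j s t \<in> principal i j B \<longleftrightarrow> ev B s t \<noteq> 0"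
  unfolding principal_def by auto

definition dom :: "bool \<Rightarrow> bool \<Rightarrow> 'k::field ppoint set" where
  "dom i j = {chart i j s t | s t. True}"

lemma open_dom: "openin (ktop X) (dom i j)"
  using open_principal[of i j 1] by (simp add: principal_def dom_def)

lemma chart_in_dom [simp]: "chart i j s t \<in> dom i j"
  unfolding dom_def by blast

lemma in_domE: assumes "p \<in> dom i j" obtains s t where "p = chart i j s t"
  using assms unfolding dom_def by blast

lemma topspace_X: "topspace (ktop X) = (scroll_points n n :: 'k::field ppoint set)"
proof
  show "topspace (ktop X) \<subseteq> (scroll_points n n :: 'k ppoint set)" unfolding ktop_X by simp
  show "scroll_points n n \<subseteq> topspace (ktop X :: 'k ppoint topology)"
  proof
    fix p :: "'k ppoint" assume "p \<in> scroll_points n n"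
    then obtain i j s t where "p = chart i j s t" by (rule scroll_points_chart)
    then show "p \<in> topspace (ktop X)"
      using openin_subset[OF open_dom[of i j]] chart_in_dom[of i j s t] by (metis subsetD)
  qed
qed

lemma openE:
  assumes "openin (ktop X) U" "p \<in> U"
  obtains i j s t where "p = chart i j s t"
  using assms openin_subset topspace_X scroll_points_chart by (metis subsetD)

lemma near_principal:
  assumes "near s t (\<lambda>s t. P (chart i j s t))"
  obtains B where "ev B s t \<noteq> 0" "\<And>p. p \<in> principal i j B \<Longrightarrow> P p"
  using assms unfolding near_def principal_def by blast

subsection \<open>Regular functions\<close>

lemma kreg_reg2:
  assumes "f \<in> kreg X U" "chart i j s t \<in> U"
  shows "reg2 (\<lambda>s t. f (chart i j s t)) s t"
proof -
  obtain V P Q d where V: "openin (ktop X) V" "chart i j s t \<in> V"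
    "P \<in> hpoly (n + n + 1) d" "Q \<in> hpoly (n + n + 1) d"
    "\<forall>q\<in>V. \<forall>v\<in>q. Q v \<noteq> 0 \<and> f q = P v / Q v"
  proof -
    have "\<forall>p\<in>U. \<exists>V. openin (ktop X) V \<and> p \<in> V \<and> V \<subseteq> U \<and>
          (\<exists>d. \<exists>P\<in>hpoly (n + n + 1) d. \<exists>Q\<in>hpoly (n + n + 1) d.
            \<forall>q\<in>V. \<forall>v\<in>q. Q v \<noteq> 0 \<and> f q = P v / Q v)"
      using assms(1) unfolding ktop_X by (simp add: scroll_def pvariety_def)
    from bspec[OF this assms(2)] show thesis by (elim exE conjE bexE) (rule that)
  qed
  have v: "Q (smc i j s t) \<noteq> 0 \<and> f (chart i j s t) = P (smc i j s t) / Q (smc i j s t)"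
    if "chart i j s t \<in> V" for s t
    using V(5) that hclass_self unfolding chart_def by blast
  have "reg2 (\<lambda>s t. P (smc i j s t) / Q (smc i j s t)) s t"
    using v V(2) by (intro reg2_divide evf_reg2 hpoly_evf[OF V(3)] hpoly_evf[OF V(4)] smc_evf) auto
  then show ?thesis by (rule reg2_cong) (rule near_mono[OF open_near[OF V(1,2)]], simp add: v)
qed

lemma kregI:
  assumes "openin (ktop X) U" "\<And>p. p \<notin> U \<Longrightarrow> f p = 0"
    and reg: "\<And>p. p \<in> U \<Longrightarrow> \<exists>i j s t. p = chart i j s t \<and> reg2 (\<lambda>s t. f (chart i j s t)) s t"
  shows "f \<in> kreg X U"
proof -
  have "\<exists>V. openin (ktop X) V \<and> p \<in> V \<and> V \<subseteq> U \<and>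
          (\<exists>d. \<exists>P\<in>hpoly (n + n + 1) d. \<exists>Q\<in>hpoly (n + n + 1) d.
            \<forall>q\<in>V. \<forall>v\<in>q. Q v \<noteq> 0 \<and> f q = P v / Q v)" if pU: "p \<in> U" for p
  proof -
    obtain i j s t where p: "p = chart i j s t" and r: "reg2 (\<lambda>s t. f (chart i j s t)) s t"
      using reg[OF pU] by blast
    obtain A B where AB: "rep (\<lambda>s t. f (chart i j s t)) s t A B" using r by (auto simp: reg2_def)
    obtain C where C: "ev C s t \<noteq> 0" "\<And>p. p \<in> principal i j C \<Longrightarrow> p \<in> U"
      using near_principal[of s t "\<lambda>p. p \<in> U", OF open_near[OF assms(1)]] pU p by blast
    obtain d P where P: "P \<in> hpoly (n + n + 1) d"
      "\<And>c s t. c \<noteq> 0 \<Longrightarrow> P (\<lambda>k. c * smc i j s t k) = c ^ d * ev A s t" using homogenize by blast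
    obtain e Q where Q: "Q \<in> hpoly (n + n + 1) e"
      "\<And>c s t. c \<noteq> 0 \<Longrightarrow> Q (\<lambda>k. c * smc i j s t k) = c ^ e * ev B s t" using homogenize by blast
    \<comment> \<open>\<open>P\<close> and \<open>Q\<close> may have different degrees; the powers
      of the coordinate that is 1 on the chart equalise them.\<close>
    let ?P = "\<lambda>v. v (idx i j) ^ e * P v" and ?Q = "\<lambda>v. v (idx i j) ^ d * Q v"
    have "?P \<in> hpoly (n + n + 1) (e + d)" "?Q \<in> hpoly (n + n + 1) (d + e)"
      by (intro hpoly_mult hpoly_var_power idx_le P Q)+
    moreover have "?Q v \<noteq> 0 \<and> f q = ?P v / ?Q v" if q: "q \<in> principal i j (B * C)" "v \<in> q" for q v
    proof -
      obtain s' t' where q': "q = chart i j s' t'" "ev (B * C) s' t' \<noteq> 0"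
        using q(1) by (auto simp: principal_def)
      obtain c where c: "c \<noteq> 0" "v = (\<lambda>k. c * smc i j s' t' k)"
        using q(2) unfolding q' chart_def by (rule in_hclassE)
      have B: "ev B s' t' \<noteq> 0" using q' by auto
      then have "f q = ev A s' t' / ev B s' t'" using AB q' by (simp add: rep_def)
      then show ?thesis using B c(1) unfolding c(2) by (simp add: P Q)
    qed
    moreover have "p \<in> principal i j (B * C)" "principal i j (B * C) \<subseteq> U"
      using C AB p by (auto simp: rep_def principal_def)
    ultimately show ?thesis using open_principal
      by (intro exI[of _ "principal i j (B * C)"] conjI exI[of _ "e + d"] bexI[of _ ?P] bexI[of _ ?Q])
        (simp_all add: add.commute)
  qed
  then show ?thesis using assms(2) unfolding ktop_X by (auto simp: scroll_def pvariety_def)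
qed

lemma kregI_dom:
  assumes "openin (ktop X) U" "\<And>p. p \<notin> U \<Longrightarrow> f p = 0" "U \<subseteq> dom i j"
    and "\<And>s t. chart i j s t \<in> U \<Longrightarrow> reg2 (\<lambda>s t. f (chart i j s t)) s t"
  shows "f \<in> kreg X U"
proof (rule kregI[OF assms(1,2)])
  fix p assume "p \<in> U"
  then show "\<exists>i j s t. p = chart i j s t \<and> reg2 (\<lambda>s t. f (chart i j s t)) s t"
    using assms(3,4) unfolding dom_def by blast
qed

lemma regular_near_iff:
  "g \<in> regular_near X (chart i j s t) \<longleftrightarrow> reg2 (\<lambda>s t. g (chart i j s t)) s t"
proof
  assume "g \<in> regular_near X (chart i j s t)"
  then obtain V where V: "openin (ktop X) V" "chart i j s t \<in> V"
    "(\<lambda>q. if q \<in> V then g q else 0) \<in> kreg X V" by (auto simp: regular_near_def)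
  have "reg2 (\<lambda>s t. if chart i j s t \<in> V then g (chart i j s t) else 0) s t"
    using kreg_reg2[OF V(3,2)] .
  then show "reg2 (\<lambda>s t. g (chart i j s t)) s t"
    by (rule reg2_cong) (rule near_mono[OF open_near[OF V(1,2)]], simp)
next
  assume "reg2 (\<lambda>s t. g (chart i j s t)) s t"
  then obtain A B where AB: "rep (\<lambda>s t. g (chart i j s t)) s t A B" by (auto simp: reg2_def)
  let ?V = "principal i j B"
  have "(\<lambda>q. if q \<in> ?V then g q else 0) \<in> kreg X ?V"
  proof (rule kregI_dom[OF open_principal, where i = i and j = j])
    show "?V \<subseteq> dom i j" unfolding principal_def dom_def by blast
    fix s' t' assume "chart i j s' t' \<in> ?V"
    then have B: "ev B s' t' \<noteq> 0" by simp
    then have "reg2 (\<lambda>s t. g (chart i j s t)) s' t'" using AB unfolding reg2_def rep_def by blast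
    then show "reg2 (\<lambda>s t. if chart i j s t \<in> ?V then g (chart i j s t) else 0) s' t'"
      by (rule reg2_cong) (rule near_mono[OF near_nonzero[OF B]], simp)
  qed auto
  then show "g \<in> regular_near X (chart i j s t)"
    using AB open_principal[of i j B] unfolding regular_near_def rep_def by (intro CollectI exI[of _ ?V]) simp
qed

end

context balanced_scroll
begin

subsection \<open>Affine coordinates and tangent vectors\<close>

text \<open>Extended by 0 to a total function, because tangent vectors act on total functions. Only
  the flag \<open>i\<close> is needed, since the charts with the two values of \<open>j\<close>
  share the coordinate s.\<close>

definition sig :: "bool \<Rightarrow> 'k::field ppoint \<Rightarrow> 'k" where
  "sig i p = (if \<exists>j s t. p = chart i j s t then THE s. \<exists>j t. p = chart i j s t else 0)"

definition tau :: "bool \<Rightarrow> 'k::field ppoint \<Rightarrow> 'k" where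
  "tau j p = (if \<exists>i s t. p = chart i j s t then THE t. \<exists>i s. p = chart i j s t else 0)"

lemma sig_chart [simp]: "sig i (chart i j s t) = s"
proof -
  have "(THE s'. \<exists>j' t'. chart i j s t = chart i j' s' t') = s"
    using chart_fst_eq by (intro the_equality) blast+
  then show ?thesis unfolding sig_def by auto
qed

lemma tau_chart [simp]: "tau j (chart i j s t) = t"
proof -
  have "(THE t'. \<exists>i' s'. chart i j s t = chart i' j s' t') = t"
    using chart_snd_eq by (intro the_equality) blast+
  then show ?thesis unfolding tau_def by auto
qed

definition cut :: "'k ppoint set \<Rightarrow> ('k ppoint \<Rightarrow> 'k::field) \<Rightarrow> 'k ppoint \<Rightarrow> 'k" where
  "cut V g q = (if q \<in> V then g q else 0)"

lemma cut_in [simp]: "q \<in> V \<Longrightarrow> cut V g q = g q" and cut_out: "q \<notin> V \<Longrightarrow> cut V g q = 0"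
  by (simp_all add: cut_def)

lemma near_cut:
  assumes "openin (ktop X) V" "chart i j s t \<in> V"
  shows "near s t (\<lambda>s t. g (chart i j s t) = cut V g (chart i j s t))"
  by (rule near_mono[OF open_near[OF assms]]) simp

lemma kreg_cutI:
  assumes "openin (ktop X) V" "V \<subseteq> dom i j"
    and "\<And>s t. chart i j s t \<in> V \<Longrightarrow> reg2 (\<lambda>s t. g (chart i j s t)) s t"
  shows "cut V g \<in> kreg X V"
proof (rule kregI_dom[OF assms(1) cut_out assms(2)])
  fix s t assume c: "chart i j s t \<in> V"
  show "reg2 (\<lambda>s t. cut V g (chart i j s t)) s t"
    by (rule reg2_cong[OF assms(3)[OF c] near_cut[OF assms(1) c]])
qed

lemma kreg_regular_near: "f \<in> kreg X V \<Longrightarrow> chart i j s t \<in> V \<Longrightarrow> f \<in> regular_near X (chart i j s t)"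
  by (simp add: regular_near_iff kreg_reg2)

lemma tangent_rules:
  assumes "\<delta> \<in> tangent X p"
  shows "g \<in> regular_near X p \<Longrightarrow> \<delta> (\<lambda>q. c * g q) = c * \<delta> g"
    and "g \<in> regular_near X p \<Longrightarrow> h \<in> regular_near X p \<Longrightarrow> \<delta> (\<lambda>q. g q + h q) = \<delta> g + \<delta> h"
    and "g \<in> regular_near X p \<Longrightarrow> h \<in> regular_near X p \<Longrightarrow>
      \<delta> (\<lambda>q. g q * h q) = g p * \<delta> h + h p * \<delta> g"
  using assms by (auto simp: tangent_def)

lemma regular_near_const: "(\<lambda>q. c) \<in> regular_near X (chart i j s t)"
  by (simp add: regular_near_iff reg2_const)

lemma tangent_const:
  fixes \<delta> :: "('k::field ppoint \<Rightarrow> 'k) \<Rightarrow> 'k"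
  assumes "\<delta> \<in> tangent X (chart i j s t)"
  shows "\<delta> (\<lambda>q. c) = 0"
proof -
  have "\<delta> (\<lambda>q. 1 * 1) = 1 * \<delta> (\<lambda>q. 1) + 1 * \<delta> (\<lambda>q. 1)"
    using tangent_rules(3)[OF assms regular_near_const[of 1] regular_near_const[of 1]] .
  then have "\<delta> (\<lambda>q. 1) = 0" by (metis add_0_right add_left_imp_eq mult_1)
  then show ?thesis using tangent_rules(1)[OF assms regular_near_const[of 1], of c] by simp
qed

lemma tangent_cong:
  fixes \<delta> :: "('k::field ppoint \<Rightarrow> 'k) \<Rightarrow> 'k"
  assumes \<delta>: "\<delta> \<in> tangent X (chart i j s t)"
    and g: "g \<in> regular_near X (chart i j s t)"
    and eq: "near s t (\<lambda>s t. g (chart i j s t) = h (chart i j s t))"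
  shows "\<delta> g = \<delta> h"
proof -
  let ?p = "chart i j s t"
  obtain C where C: "ev C s t \<noteq> 0" "\<And>p. p \<in> principal i j C \<Longrightarrow> g p = h p"
    using near_principal[of s t "\<lambda>p. g p = h p" i j] eq by blast
  have h: "h \<in> regular_near X ?p"
    using reg2_cong[OF g[unfolded regular_near_iff] eq] by (simp add: regular_near_iff)
  \<comment> \<open>\<open>?u\<close> is the indicator function of the neighbourhood. The product
    \<open>?d * ?u\<close> is 0 everywhere and \<open>?d\<close> vanishes at the point, so the
    product rule leaves \<open>\<delta> ?d = 0\<close>.\<close>
  let ?u = "cut (principal i j C) (\<lambda>q. 1)" and ?d = "\<lambda>q. g q + (- 1) * h q"
  have u: "?u \<in> regular_near X ?p" unfolding regular_near_iff
    by (rule reg2_cong[OF reg2_const[of 1]]) (use near_cut[OF open_principal, of i j s t i j C "\<lambda>q. 1"] C in simp)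
  have h': "(\<lambda>q. (- 1) * h q) \<in> regular_near X ?p" and d: "?d \<in> regular_near X ?p"
    using g h unfolding regular_near_iff
    by (auto intro!: reg2_diff reg2_minus)
  have "(\<lambda>q. ?d q * ?u q) = (\<lambda>q. 0)"
    using C(2) by (auto simp: cut_def)
  then have "\<delta> (\<lambda>q. ?d q * ?u q) = 0" using tangent_const[OF \<delta>, of 0] by (simp only:)
  moreover have "\<delta> (\<lambda>q. ?d q * ?u q) = ?d ?p * \<delta> ?u + ?u ?p * \<delta> ?d"
    by (rule tangent_rules(3)[OF \<delta> d u])
  moreover have "?d ?p = 0" "?u ?p = 1" using C by auto
  moreover have "\<delta> ?d = \<delta> g + (- 1) * \<delta> h"
    unfolding tangent_rules(2)[OF \<delta> g h'] tangent_rules(1)[OF \<delta> h] ..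
  ultimately show ?thesis by simp
qed

lemma tangent_cut:
  fixes \<delta> :: "('k::field ppoint \<Rightarrow> 'k) \<Rightarrow> 'k"
  assumes "\<delta> \<in> tangent X (chart i j s t)" "g \<in> regular_near X (chart i j s t)"
    "openin (ktop X) V" "chart i j s t \<in> V"
  shows "\<delta> (cut V g) = \<delta> g"
  by (rule tangent_cong[symmetric, OF assms(1,2) near_cut[OF assms(3,4)]])

lemma regular_near_sig: "sig i \<in> regular_near X (chart i j s t)"
  by (simp add: regular_near_iff reg2_id_fst)

lemma regular_near_tau: "tau j \<in> regular_near X (chart i j s t)"
  by (simp add: regular_near_iff reg2_id_snd)

lemma regular_near_ev: "(\<lambda>q. ev A (sig i q) (tau j q)) \<in> regular_near X (chart i j s t)"
  using reg2_ev[of A] by (simp add: regular_near_iff)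

lemma tangent_ev:
  fixes \<delta> :: "('k::field ppoint \<Rightarrow> 'k) \<Rightarrow> 'k"
  assumes \<delta>: "\<delta> \<in> tangent X (chart i j s t)"
  shows "\<delta> (\<lambda>q. ev A (sig i q) (tau j q)) = ev (dS A) s t * \<delta> (sig i) + ev (dT A) s t * \<delta> (tau j)"
proof -
  note sg = regular_near_sig[of i j s t] and tu = regular_near_tau[of j i s t]
  have ps: "(\<lambda>q. poly p (sig i q)) \<in> regular_near X (chart i j s t)" for p :: "'k poly"
    by (simp add: regular_near_iff reg2_fst)
  have 1: "\<delta> (\<lambda>q. poly p (sig i q)) = poly (pderiv p) s * \<delta> (sig i)" for p
  proof (induction p)
    case 0 show ?case using tangent_const[OF \<delta>, of 0] by simp
  next
    case (pCons a p)
    have sp: "(\<lambda>q. sig i q * poly p (sig i q)) \<in> regular_near X (chart i j s t)"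
      by (simp add: regular_near_iff reg2_mult[OF reg2_id_fst reg2_fst])
    have "\<delta> (\<lambda>q. a + sig i q * poly p (sig i q)) =
        \<delta> (\<lambda>q. a) + \<delta> (\<lambda>q. sig i q * poly p (sig i q))"
      by (rule tangent_rules(2)[OF \<delta> regular_near_const sp])
    also have "\<delta> (\<lambda>q. sig i q * poly p (sig i q)) =
        s * \<delta> (\<lambda>q. poly p (sig i q)) + poly p s * \<delta> (sig i)"
      using tangent_rules(3)[OF \<delta> sg ps] by simp
    finally show ?case using pCons tangent_const[OF \<delta>] by (simp add: pderiv_pCons algebra_simps)
  qed
  show ?thesis
  proof (induction A)
    case 0 show ?case using tangent_const[OF \<delta>, of 0] by simp
  next
    case (pCons p A)
    have te: "(\<lambda>q. tau j q * ev A (sig i q) (tau j q)) \<in> regular_near X (chart i j s t)"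
      using reg2_mult[OF reg2_id_snd reg2_ev[of A]] by (simp add: regular_near_iff)
    have "\<delta> (\<lambda>q. poly p (sig i q) + tau j q * ev A (sig i q) (tau j q)) =
        \<delta> (\<lambda>q. poly p (sig i q)) + \<delta> (\<lambda>q. tau j q * ev A (sig i q) (tau j q))"
      by (rule tangent_rules(2)[OF \<delta> ps te])
    also have "\<delta> (\<lambda>q. tau j q * ev A (sig i q) (tau j q)) =
        t * \<delta> (\<lambda>q. ev A (sig i q) (tau j q)) + ev A s t * \<delta> (tau j)"
      using tangent_rules(3)[OF \<delta> tu regular_near_ev] by simp
    finally show ?case using pCons 1 by (simp add: dT_pCons algebra_simps)
  qed
qed

text \<open>Near the point \<open>g\<close> times its denominator equals its numerator. Applying
  \<delta> to this identity reduces the chain rule for rational functions to the one for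
  polynomials, \<open>tangent_ev\<close>.\<close>

lemma tangent_formula:
  fixes \<delta> :: "('k::field_char_0 ppoint \<Rightarrow> 'k) \<Rightarrow> 'k"
  assumes \<delta>: "\<delta> \<in> tangent X (chart i j s t)" and g: "g \<in> regular_near X (chart i j s t)"
  shows "\<delta> g = pd dS (\<lambda>s t. g (chart i j s t)) s t * \<delta> (sig i)
    + pd dT (\<lambda>s t. g (chart i j s t)) s t * \<delta> (tau j)"
proof -
  obtain A B where AB: "rep (\<lambda>s t. g (chart i j s t)) s t A B"
    using g unfolding regular_near_iff reg2_def by blast
  then have nz: "ev B s t \<noteq> 0" and gv: "g (chart i j s t) = ev A s t / ev B s t" by (auto simp: rep_def)
  let ?b = "\<lambda>q. ev B (sig i q) (tau j q)"
  have gb: "(\<lambda>q. g q * ?b q) \<in> regular_near X (chart i j s t)"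
    using g regular_near_ev[of B i j s t] unfolding regular_near_iff by (rule reg2_mult)
  have "\<delta> (\<lambda>q. g q * ?b q) = \<delta> (\<lambda>q. ev A (sig i q) (tau j q))"
    by (rule tangent_cong[OF \<delta> gb], rule near_mono[OF rep_near[OF AB]]) (simp add: rep_def)
  moreover have "\<delta> (\<lambda>q. g q * ?b q) = g (chart i j s t) * \<delta> ?b + ev B s t * \<delta> g"
    using tangent_rules(3)[OF \<delta> g regular_near_ev[of B]] by simp
  ultimately have dg: "\<delta> g = (\<delta> (\<lambda>q. ev A (sig i q) (tau j q)) - ev A s t / ev B s t * \<delta> ?b) / ev B s t"
    using nz gv by (simp add: field_simps)
  show ?thesis
    unfolding dg tangent_ev[OF \<delta>] pd_eq[OF derivation_dS AB] pd_eq[OF derivation_dT AB]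
    using nz by (simp add: field_simps power2_eq_square)
qed

text \<open>Apply \<delta> to the product of the two coordinates, which is 1 where the charts
  overlap. This is ds = - s^2 ds', the source of the - 2 in the twists.\<close>

lemma tangent_flip_fst:
  fixes \<delta> :: "('k::field ppoint \<Rightarrow> 'k) \<Rightarrow> 'k"
  assumes \<delta>: "\<delta> \<in> tangent X (chart i j s t)" and s: "s * s' = 1"
  shows "\<delta> (sig i) = - s\<^sup>2 * \<delta> (sig (\<not> i))"
proof -
  have c: "chart i j s t = chart (\<not> i) j s' t" by (rule chart_flip_fst[OF s])
  have r: "sig (\<not> i) \<in> regular_near X (chart i j s t)" unfolding c by (rule regular_near_sig)
  have v: "sig (\<not> i) (chart i j s t) = s'" unfolding c by simp
  have rr: "(\<lambda>q. sig i q * sig (\<not> i) q) \<in> regular_near X (chart i j s t)"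
    using regular_near_sig[of i j s t] r unfolding regular_near_iff by (rule reg2_mult)
  have "near s t (\<lambda>s t. s \<noteq> 0)" using s by (intro evf_near_nonzero evf_fst) auto
  then have "near s t (\<lambda>s t. sig i (chart i j s t) * sig (\<not> i) (chart i j s t) = 1)"
  proof (rule near_mono)
    fix s t :: 'k assume "s \<noteq> 0"
    then show "sig i (chart i j s t) * sig (\<not> i) (chart i j s t) = 1"
      using chart_flip_fst[of s "inverse s" i j t] by (metis right_inverse sig_chart)
  qed
  then have "\<delta> (\<lambda>q. sig i q * sig (\<not> i) q) = \<delta> (\<lambda>q. 1)" by (rule tangent_cong[OF \<delta> rr])
  then have "s * \<delta> (sig (\<not> i)) + s' * \<delta> (sig i) = 0"
    using tangent_rules(3)[OF \<delta> regular_near_sig r] tangent_const[OF \<delta>] v by simp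
  then have "s * (s * \<delta> (sig (\<not> i)) + s' * \<delta> (sig i)) = 0" by simp
  then have "s * s * \<delta> (sig (\<not> i)) + (s * s') * \<delta> (sig i) = 0" by (simp add: algebra_simps)
  then show ?thesis using s by (simp add: power2_eq_square add_eq_0_iff)
qed

lemma tangent_flip_snd:
  fixes \<delta> :: "('k::field ppoint \<Rightarrow> 'k) \<Rightarrow> 'k"
  assumes \<delta>: "\<delta> \<in> tangent X (chart i j s t)" and t: "t * t' = 1"
  shows "\<delta> (tau j) = - t\<^sup>2 * \<delta> (tau (\<not> j))"
proof -
  have c: "chart i j s t = chart i (\<not> j) s t'" by (rule chart_flip_snd[OF t])
  have r: "tau (\<not> j) \<in> regular_near X (chart i j s t)" unfolding c by (rule regular_near_tau)
  have v: "tau (\<not> j) (chart i j s t) = t'" unfolding c by simp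
  have rr: "(\<lambda>q. tau j q * tau (\<not> j) q) \<in> regular_near X (chart i j s t)"
    using regular_near_tau[of j i s t] r unfolding regular_near_iff by (rule reg2_mult)
  have "near s t (\<lambda>s t. t \<noteq> 0)" using t by (intro evf_near_nonzero evf_snd) auto
  then have "near s t (\<lambda>s t. tau j (chart i j s t) * tau (\<not> j) (chart i j s t) = 1)"
  proof (rule near_mono)
    fix s t :: 'k assume "t \<noteq> 0"
    then show "tau j (chart i j s t) * tau (\<not> j) (chart i j s t) = 1"
      using chart_flip_snd[of t "inverse t" i j s] by (metis right_inverse tau_chart)
  qed
  then have "\<delta> (\<lambda>q. tau j q * tau (\<not> j) q) = \<delta> (\<lambda>q. 1)" by (rule tangent_cong[OF \<delta> rr])
  then have "t * \<delta> (tau (\<not> j)) + t' * \<delta> (tau j) = 0"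
    using tangent_rules(3)[OF \<delta> regular_near_tau r] tangent_const[OF \<delta>] v by simp
  then have "t * (t * \<delta> (tau (\<not> j)) + t' * \<delta> (tau j)) = 0" by simp
  then have "t * t * \<delta> (tau (\<not> j)) + (t * t') * \<delta> (tau j) = 0" by (simp add: algebra_simps)
  then show ?thesis using t by (simp add: power2_eq_square add_eq_0_iff)
qed

text \<open>For \<open>dS\<close> and \<open>dT\<close> these are the coordinate vectors d/ds and
  d/dt. The value 0 on functions that are not regular near the point is the normalisation demanded
  by \<open>tangent\<close>.\<close>

definition vec ::
    "('k::field_char_0 poly poly \<Rightarrow> 'k poly poly) \<Rightarrow> bool \<Rightarrow> bool \<Rightarrow> 'k \<Rightarrow> 'k \<Rightarrow> ('k ppoint \<Rightarrow> 'k) \<Rightarrow> 'k" where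
  "vec D i j s t g =
    (if g \<in> regular_near X (chart i j s t) then pd D (\<lambda>s t. g (chart i j s t)) s t else 0)"

lemma vec_tangent: "derivation D \<Longrightarrow> vec D i j s t \<in> tangent X (chart i j s t)"
  unfolding tangent_def vec_def
  by (auto simp: regular_near_iff pd_add pd_mult pd_cmult pd_const reg2_add reg2_mult reg2_const)

lemma vec_eq: "g \<in> regular_near X (chart i j s t) \<Longrightarrow>
    vec D i j s t g = pd D (\<lambda>s t. g (chart i j s t)) s t"
  by (simp add: vec_def)

lemma vec_coordinates [simp]:
  "vec dS i j s t (sig i) = 1" "vec dS i j s t (tau j) = 0"
  "vec dT i j s t (sig i) = 0" "vec dT i j s t (tau j) = 1"
  by (simp_all add: vec_eq regular_near_sig regular_near_tau)

subsection \<open>Differential forms in a chart\<close>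

abbreviation coeff1 where
  "coeff1 D i j \<omega> s t \<equiv> \<omega> (chart i j s t) (vec D i j s t)"

lemma form1_local:
  fixes \<omega> :: "('k::field_char_0 ppoint, 'k) form1"
  assumes V: "openin (ktop X) V" "chart i j s t \<in> V"
    and fg: "\<forall>k<(m::nat). f k \<in> kreg X V \<and> g k \<in> kreg X V"
    and \<omega>: "\<forall>q\<in>V. \<forall>\<delta>\<in>tangent X q. \<omega> q \<delta> = (\<Sum>k<m. f k q * \<delta> (g k))"
    and D: "derivation D"
  shows "near s t (\<lambda>s t. coeff1 D i j \<omega> s t =
      (\<Sum>k<m. f k (chart i j s t) * pd D (\<lambda>s t. g k (chart i j s t)) s t))"
proof (rule near_mono[OF open_near[OF V]])
  fix s t assume c: "chart i j s t \<in> V"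
  show "coeff1 D i j \<omega> s t = (\<Sum>k<m. f k (chart i j s t) * pd D (\<lambda>s t. g k (chart i j s t)) s t)"
    unfolding bspec[OF bspec[OF \<omega> c] vec_tangent[OF D]]
  proof (intro sum.cong refl)
    fix k assume "k \<in> {..<m}"
    then have "g k \<in> regular_near X (chart i j s t)" using fg c kreg_regular_near by blast
    then show "f k (chart i j s t) * vec D i j s t (g k) =
        f k (chart i j s t) * pd D (\<lambda>s t. g k (chart i j s t)) s t" by (simp add: vec_eq)
  qed
qed

lemma form1_coeff_reg2:
  fixes \<omega> :: "('k::field_char_0 ppoint, 'k) form1"
  assumes \<omega>: "\<omega> \<in> regular_form1 X U" and c: "chart i j s t \<in> U" and D: "derivation D"
  shows "reg2 (coeff1 D i j \<omega>) s t"
proof -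
  obtain V m f g where V: "openin (ktop X) V" "chart i j s t \<in> V"
    and fg: "\<forall>k<(m::nat). f k \<in> kreg X V \<and> g k \<in> kreg X V"
    and eq: "\<forall>q\<in>V. \<forall>\<delta>\<in>tangent X q. \<omega> q \<delta> = (\<Sum>k<m. f k q * \<delta> (g k))"
    using \<omega> c unfolding regular_form1_def by blast
  have "reg2 (\<lambda>s t. \<Sum>k<m. f k (chart i j s t) * pd D (\<lambda>s t. g k (chart i j s t)) s t) s t"
    using fg V(2) by (intro reg2_sum reg2_mult reg2_pd D kreg_reg2) auto
  then show ?thesis
    by (rule reg2_cong, intro near_mono[OF form1_local[OF V fg eq D]]) simp
qed

lemma form1_coeffs:
  fixes \<omega> :: "('k::field_char_0 ppoint, 'k) form1"
  assumes \<omega>: "\<omega> \<in> regular_form1 X U" and c: "chart i j s t \<in> U"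
    and \<delta>: "\<delta> \<in> tangent X (chart i j s t)"
  shows "\<omega> (chart i j s t) \<delta> = coeff1 dS i j \<omega> s t * \<delta> (sig i) + coeff1 dT i j \<omega> s t * \<delta> (tau j)"
proof -
  obtain V m f g where V: "openin (ktop X) V" "chart i j s t \<in> V"
    and fg: "\<forall>k<(m::nat). f k \<in> kreg X V \<and> g k \<in> kreg X V"
    and eq: "\<forall>q\<in>V. \<forall>\<delta>\<in>tangent X q. \<omega> q \<delta> = (\<Sum>k<m. f k q * \<delta> (g k))"
    using \<omega> c unfolding regular_form1_def by blast
  have *: "\<delta> (g k) = pd dS (\<lambda>s t. g k (chart i j s t)) s t * \<delta> (sig i)
      + pd dT (\<lambda>s t. g k (chart i j s t)) s t * \<delta> (tau j)" if "k < m" for k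
    using tangent_formula[OF \<delta>] fg that V kreg_regular_near by blast
  show ?thesis
    unfolding near_here[OF form1_local[OF V fg eq derivation_dS]]
      near_here[OF form1_local[OF V fg eq derivation_dT]] bspec[OF bspec[OF eq V(2)] \<delta>]
    by (simp add: * sum_distrib_left sum_distrib_right sum.distrib algebra_simps)
qed

lemma regular_form1I:
  fixes \<omega> :: "('k::field_char_0 ppoint, 'k) form1"
  assumes zero: "\<And>p \<delta>. \<not> (p \<in> U \<and> \<delta> \<in> tangent X p) \<Longrightarrow> \<omega> p \<delta> = 0"
    and loc: "\<And>p. p \<in> U \<Longrightarrow> \<exists>V i j f g. openin (ktop X) V \<and> p \<in> V \<and> V \<subseteq> U \<and> V \<subseteq> dom i j \<and>
      f \<in> kreg X V \<and> g \<in> kreg X V \<and>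
      (\<forall>q\<in>V. \<forall>\<delta>\<in>tangent X q. \<omega> q \<delta> = f q * \<delta> (sig i) + g q * \<delta> (tau j))"
  shows "\<omega> \<in> regular_form1 X U"
proof -
  have "\<exists>V (m::nat) f g. openin (ktop X) V \<and> p \<in> V \<and> V \<subseteq> U \<and>
          (\<forall>k<m. f k \<in> kreg X V \<and> g k \<in> kreg X V) \<and>
          (\<forall>q\<in>V. \<forall>\<delta>\<in>tangent X q. \<omega> q \<delta> = (\<Sum>k<m. f k q * \<delta> (g k)))" if p: "p \<in> U" for p
  proof -
    obtain V i j f g where V: "openin (ktop X) V" "p \<in> V" "V \<subseteq> U" "V \<subseteq> dom i j"
      and fg: "f \<in> kreg X V" "g \<in> kreg X V"
      and \<omega>: "\<forall>q\<in>V. \<forall>\<delta>\<in>tangent X q. \<omega> q \<delta> = f q * \<delta> (sig i) + g q * \<delta> (tau j)"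
      using loc[OF p] by blast
    \<comment> \<open>The coordinates have to be cut to \<open>V\<close> to be sections over it; by
      \<open>tangent_cut\<close> this does not change their derivatives.\<close>
    have k: "cut V (sig i) \<in> kreg X V" "cut V (tau j) \<in> kreg X V"
      by (rule kreg_cutI[OF V(1,4)], simp add: reg2_id_fst reg2_id_snd)+
    let ?f = "\<lambda>k::nat. if k = 0 then f else g"
    let ?g = "\<lambda>k::nat. if k = 0 then cut V (sig i) else cut V (tau j)"
    have "\<omega> q \<delta> = (\<Sum>k<2. ?f k q * \<delta> (?g k))" if q: "q \<in> V" "\<delta> \<in> tangent X q" for q \<delta>
    proof -
      obtain s t where qc: "q = chart i j s t" using q V(4) by (blast elim: in_domE)
      note q' = q[unfolded qc]
      have "\<delta> (cut V (sig i)) = \<delta> (sig i)" "\<delta> (cut V (tau j)) = \<delta> (tau j)"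
        by (rule tangent_cut[OF q'(2) _ V(1) q'(1)], rule regular_near_sig regular_near_tau)+
      then show ?thesis using \<omega> q by (simp add: numeral_2_eq_2)
    qed
    then show ?thesis using V fg k
      by (intro exI[of _ V] exI[of _ 2] exI[of _ ?f] exI[of _ ?g]) auto
  qed
  then show ?thesis using zero unfolding regular_form1_def by blast
qed

lemma form2_coeff_reg2:
  fixes \<eta> :: "('k::field_char_0 ppoint, 'k) form2"
  assumes \<eta>: "\<eta> \<in> regular_form2 X U" and c: "chart i j s t \<in> U"
  shows "reg2 (\<lambda>s t. \<eta> (chart i j s t) (vec dS i j s t) (vec dT i j s t)) s t"
proof -
  obtain V m f g h where V: "openin (ktop X) V" "chart i j s t \<in> V"
    and fg: "\<forall>k<(m::nat). f k \<in> kreg X V \<and> g k \<in> kreg X V \<and> h k \<in> kreg X V"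
    and eq: "\<forall>q\<in>V. \<forall>\<delta>\<in>tangent X q. \<forall>\<epsilon>\<in>tangent X q.
            \<eta> q \<delta> \<epsilon> = (\<Sum>k<m. f k q * (\<delta> (g k) * \<epsilon> (h k) - \<epsilon> (g k) * \<delta> (h k)))"
    using \<eta> c unfolding regular_form2_def by blast
  let ?r = "\<lambda>s t. \<Sum>k<m. f k (chart i j s t) *
    (pd dS (\<lambda>s t. g k (chart i j s t)) s t * pd dT (\<lambda>s t. h k (chart i j s t)) s t
      - pd dT (\<lambda>s t. g k (chart i j s t)) s t * pd dS (\<lambda>s t. h k (chart i j s t)) s t)"
  have "reg2 ?r s t"
    using fg V(2)
    by (intro reg2_sum reg2_mult reg2_diff reg2_pd derivation_dS derivation_dT kreg_reg2) auto
  moreover have "near s t (\<lambda>s t. ?r s t = \<eta> (chart i j s t) (vec dS i j s t) (vec dT i j s t))"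
  proof (rule near_mono[OF open_near[OF V]])
    fix s t assume c: "chart i j s t \<in> V"
    show "?r s t = \<eta> (chart i j s t) (vec dS i j s t) (vec dT i j s t)"
      unfolding bspec[OF bspec[OF bspec[OF eq c] vec_tangent[OF derivation_dS]] vec_tangent[OF derivation_dT]]
    proof (intro sum.cong refl)
      fix k assume "k \<in> {..<m}"
      then have "g k \<in> regular_near X (chart i j s t)" "h k \<in> regular_near X (chart i j s t)"
        using fg c kreg_regular_near by blast+
      then show "f k (chart i j s t) *
          (pd dS (\<lambda>s t. g k (chart i j s t)) s t * pd dT (\<lambda>s t. h k (chart i j s t)) s t
          - pd dT (\<lambda>s t. g k (chart i j s t)) s t * pd dS (\<lambda>s t. h k (chart i j s t)) s t) =
          f k (chart i j s t) * (vec dS i j s t (g k) * vec dT i j s t (h k)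
          - vec dT i j s t (g k) * vec dS i j s t (h k))" by (simp add: vec_eq)
    qed
  qed
  ultimately show ?thesis by (rule reg2_cong)
qed

text \<open>The definition lets the presentation of \<omega> as a sum of f dg be chosen anew at
  every point. In coordinates the terms with second derivatives of g cancel, and the result depends
  on the coefficients of \<omega> only.\<close>

lemma exterior_derivative_coeff:
  fixes \<omega> :: "('k::field_char_0 ppoint, 'k) form1"
  assumes \<eta>: "is_exterior_derivative X U \<omega> \<eta>" and c: "chart i j s t \<in> U"
  shows "\<eta> (chart i j s t) (vec dS i j s t) (vec dT i j s t) =
    pd dS (coeff1 dT i j \<omega>) s t - pd dT (coeff1 dS i j \<omega>) s t"
proof -
  obtain V m f g where V: "openin (ktop X) V" "chart i j s t \<in> V"
    and fg: "\<forall>k<(m::nat). f k \<in> kreg X V \<and> g k \<in> kreg X V"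
    and eq: "\<forall>q\<in>V. \<forall>\<delta>\<in>tangent X q. \<omega> q \<delta> = (\<Sum>k<m. f k q * \<delta> (g k))"
    and eq2: "\<forall>q\<in>V. \<forall>\<delta>\<in>tangent X q. \<forall>\<epsilon>\<in>tangent X q.
        \<eta> q \<delta> \<epsilon> = (\<Sum>k<m. \<delta> (f k) * \<epsilon> (g k) - \<epsilon> (f k) * \<delta> (g k))"
    using \<eta> c unfolding is_exterior_derivative_def by blast
  let ?f = "\<lambda>k s t. f k (chart i j s t)" and ?g = "\<lambda>k s t. g k (chart i j s t)"
  have rf: "reg2 (?f k) s t" and rg: "reg2 (?g k) s t" if "k < m" for k
    using fg V that kreg_reg2 by blast+
  have c: "pd D (coeff1 D' i j \<omega>) s t =
      (\<Sum>k<m. ?f k s t * pd D (pd D' (?g k)) s t + pd D' (?g k) s t * pd D (?f k) s t)"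
    if D: "derivation D" and D': "derivation D'" for D D'
  proof -
    have r: "reg2 (\<lambda>s t. \<Sum>k<m. ?f k s t * pd D' (?g k) s t) s t"
      using rf rg by (intro reg2_sum reg2_mult reg2_pd D') auto
    have "pd D (\<lambda>s t. \<Sum>k<m. ?f k s t * pd D' (?g k) s t) s t = pd D (coeff1 D' i j \<omega>) s t"
      by (rule pd_cong[OF D r], rule near_mono[OF form1_local[OF V fg eq D']]) simp
    then have "pd D (coeff1 D' i j \<omega>) s t = pd D (\<lambda>s t. \<Sum>k<m. ?f k s t * pd D' (?g k) s t) s t" ..
    also have "\<dots> = (\<Sum>k<m. pd D (\<lambda>s t. ?f k s t * pd D' (?g k) s t) s t)"
      using rf rg by (intro pd_sum[OF D] reg2_mult reg2_pd[OF D']) auto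
    also have "\<dots> = (\<Sum>k<m. ?f k s t * pd D (pd D' (?g k)) s t + pd D' (?g k) s t * pd D (?f k) s t)"
      using rf rg by (intro sum.cong refl pd_mult[OF D] reg2_pd[OF D']) auto
    finally show ?thesis .
  qed
  have "\<eta> (chart i j s t) (vec dS i j s t) (vec dT i j s t) =
      (\<Sum>k<m. pd dS (?f k) s t * pd dT (?g k) s t - pd dT (?f k) s t * pd dS (?g k) s t)"
    unfolding bspec[OF bspec[OF bspec[OF eq2 V(2)] vec_tangent[OF derivation_dS]] vec_tangent[OF derivation_dT]]
  proof (intro sum.cong refl)
    fix k assume "k \<in> {..<m}"
    then have "f k \<in> regular_near X (chart i j s t)" "g k \<in> regular_near X (chart i j s t)"
      using fg V(2) kreg_regular_near by blast+
    then show "vec dS i j s t (f k) * vec dT i j s t (g k) - vec dT i j s t (f k) * vec dS i j s t (g k) =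
        pd dS (?f k) s t * pd dT (?g k) s t - pd dT (?f k) s t * pd dS (?g k) s t"
      by (simp add: vec_eq)
  qed
  moreover have "pd dS (pd dT (?g k)) s t = pd dT (pd dS (?g k)) s t" if "k < m" for k
    by (rule pd_commute[OF derivation_dS derivation_dT dS_dT_commute rg[OF that]])
  then have "(\<Sum>k<m. pd dS (?f k) s t * pd dT (?g k) s t - pd dT (?f k) s t * pd dS (?g k) s t) =
      (\<Sum>k<m. (?f k s t * pd dS (pd dT (?g k)) s t + pd dT (?g k) s t * pd dS (?f k) s t) -
        (?f k s t * pd dT (pd dS (?g k)) s t + pd dS (?g k) s t * pd dT (?f k) s t))"
    by (intro sum.cong refl) (simp add: algebra_simps)
  ultimately show ?thesis
    unfolding c[OF derivation_dS derivation_dT] c[OF derivation_dT derivation_dS]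
    unfolding sum_subtractf[symmetric] by (simp add: algebra_simps)
qed

end

section \<open>Logarithmic forms along a union of rulings\<close>

lemma local_equation_divides:
  assumes h: "local_equation X S V h" and W: "openin (ktop X) W" "W \<subseteq> V" "g \<in> kreg X W"
    and g: "\<And>p. p \<in> W \<Longrightarrow> p \<in> S \<Longrightarrow> g p = 0" and p: "p \<in> W"
  obtains W' r where "openin (ktop X) W'" "p \<in> W'" "W' \<subseteq> W" "r \<in> kreg X W'"
    "\<And>q. q \<in> W' \<Longrightarrow> g q = r q * h q"
proof -
  have *: "\<forall>W g. openin (ktop X) W \<and> W \<subseteq> V \<and> g \<in> kreg X W \<and> (\<forall>p\<in>W \<inter> S. g p = 0) \<longrightarrow>
      (\<forall>p\<in>W. \<exists>W' r. openin (ktop X) W' \<and> p \<in> W' \<and> W' \<subseteq> W \<and> r \<in> kreg X W' \<and>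
        (\<forall>q\<in>W'. g q = r q * h q))"
    using h unfolding local_equation_def by (elim conjE)
  have **: "openin (ktop X) W \<and> W \<subseteq> V \<and> g \<in> kreg X W \<and> (\<forall>p\<in>W \<inter> S. g p = 0)"
    using W g by blast
  have "\<exists>W' r. openin (ktop X) W' \<and> p \<in> W' \<and> W' \<subseteq> W \<and> r \<in> kreg X W' \<and>
      (\<forall>q\<in>W'. g q = r q * h q)" by (rule *[rule_format, OF ** p])
  then show thesis by (elim exE conjE) (rule that, auto)
qed

context balanced_scroll
begin

text \<open>The passage from a germ in the plane to a section over an open set of the scroll;
  \<open>P\<close> collects whatever else should hold on that set.\<close>

lemma reg2_section:
  assumes "reg2 \<psi> s t" "near s t P"
  obtains W where "openin (ktop X) W" "chart i j s t \<in> W" "W \<subseteq> dom i j"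
    "cut W (\<lambda>q. \<psi> (sig i q) (tau j q)) \<in> kreg X W" "\<And>s t. chart i j s t \<in> W \<Longrightarrow> P s t"
proof -
  obtain B where B: "ev B s t \<noteq> 0" "\<And>s t. ev B s t \<noteq> 0 \<Longrightarrow> reg2 \<psi> s t \<and> P s t"
    using near_conj[OF reg2_near[OF assms(1)] assms(2)] unfolding near_def by blast
  have d: "principal i j B \<subseteq> dom i j" unfolding principal_def dom_def by blast
  have "cut (principal i j B) (\<lambda>q. \<psi> (sig i q) (tau j q)) \<in> kreg X (principal i j B)"
    using B(2) by (intro kreg_cutI[OF open_principal d]) simp
  then show thesis using that[OF open_principal _ d] B by simp
qed

end

text \<open>\<open>pp\<close> and \<open>qq\<close> are the affine equations of the two families of
  rulings. The transition laws say that they come from binary forms of degrees \<open>a\<close> and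
  \<open>b\<close>, and simple roots say that the divisors within a family are distinct.\<close>

locale log_scroll = balanced_scroll n for n +
  fixes pp qq :: "bool \<Rightarrow> 'k::field_char_0 poly" and a b :: nat
  assumes simple_pp: "simple_roots (pp i)" and simple_qq: "simple_roots (qq i)"
    and flip_pp: "s * s' = 1 \<Longrightarrow> poly (pp i) s = s ^ a * poly (pp (\<not> i)) s'"
    and flip_qq: "s * s' = 1 \<Longrightarrow> poly (qq i) s = s ^ b * poly (qq (\<not> i)) s'"
begin

definition S :: "'k ppoint set" where
  "S = {chart i j s t | i j s t. poly (pp i) s = 0 \<or> poly (qq j) t = 0}"

lemma chart_in_S [simp]: "chart i j s t \<in> S \<longleftrightarrow> poly (pp i) s = 0 \<or> poly (qq j) t = 0"
proof
  assume "chart i j s t \<in> S"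
  then obtain i' j' s' t' where c: "chart i j s t = chart i' j' s' t'"
    and z: "poly (pp i') s' = 0 \<or> poly (qq j') t' = 0" unfolding S_def by blast
  have "poly (pp i) s = 0" if "poly (pp i') s' = 0"
  proof (cases "i' = i")
    case True then show ?thesis using that c chart_fst_eq by blast
  next
    case False
    then have "i' = (\<not> i)" by blast
    then show ?thesis using flip_pp[OF chart_fst_eq_flip] c that by simp
  qed
  moreover have "poly (qq j) t = 0" if "poly (qq j') t' = 0"
  proof (cases "j' = j")
    case True then show ?thesis using that c chart_snd_eq by blast
  next
    case False
    then have "j' = (\<not> j)" by blast
    then show ?thesis using flip_qq[OF chart_snd_eq_flip] c that by simp
  qed
  ultimately show "poly (pp i) s = 0 \<or> poly (qq j) t = 0" using z by blast
qed (auto simp: S_def)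

definition H :: "bool \<Rightarrow> bool \<Rightarrow> 'k poly poly" where
  "H i j = [:pp i:] * tpoly (qq j)"

lemma ev_H [simp]: "ev (H i j) s t = poly (pp i) s * poly (qq j) t"
  by (simp add: H_def)

lemma pp_nonzero: "pp i \<noteq> 0" and qq_nonzero: "qq i \<noteq> 0"
  using simple_roots_nonzero simple_pp simple_qq by blast+

lemma H_nonzero: "H i j \<noteq> 0"
proof
  assume "H i j = 0"
  then have *: "poly (pp i) s * poly (qq j) t = 0" for s t using ev_H[of i j s t] by simp
  obtain s where "poly (pp i) s \<noteq> 0" using poly_vanishing_off_eq_0[of 1 "pp i"] pp_nonzero by auto
  moreover obtain t where "poly (qq j) t \<noteq> 0" using poly_vanishing_off_eq_0[of 1 "qq j"] qq_nonzero by auto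
  ultimately show False using *[of s t] by simp
qed

lemma open_minus_S:
  assumes "openin (ktop X) V" shows "openin (ktop X) (V - S)"
proof -
  have "V - S = V \<inter> (\<Union>i. \<Union>j. principal i j (H i j))"
  proof (intro equalityI subsetI)
    fix p assume p: "p \<in> V - S"
    obtain i j s t where c: "p = chart i j s t" using openE[OF assms] p by blast
    then have "p \<in> principal i j (H i j)" using p by simp
    then show "p \<in> V \<inter> (\<Union>i. \<Union>j. principal i j (H i j))" using p by blast
  next
    fix p assume p: "p \<in> V \<inter> (\<Union>i. \<Union>j. principal i j (H i j))"
    then obtain i j s t where "p = chart i j s t" "ev (H i j) s t \<noteq> 0"
      unfolding principal_def by blast
    then show "p \<in> V - S" using p by simp
  qed
  moreover have "openin (ktop X) (\<Union>i. \<Union>j. principal i j (H i j))"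
    by (intro openin_Union) (auto intro: open_principal)
  ultimately show ?thesis using assms by (simp add: openin_Int)
qed

definition hS :: "bool \<Rightarrow> bool \<Rightarrow> 'k ppoint \<Rightarrow> 'k" where
  "hS i j q = poly (pp i) (sig i q) * poly (qq j) (tau j q)"

lemma hS_chart [simp]: "hS i j (chart i j s t) = poly (pp i) s * poly (qq j) t"
  by (simp add: hS_def)

lemma reg2_hS: "reg2 (\<lambda>s t. hS i j (chart i j s t)) s t"
  by (simp add: reg2_mult[OF reg2_fst reg2_snd])

text \<open>A function vanishing on \<open>S\<close> is divided first by the polynomial in s, then
  by the one in t. The first quotient is known to vanish on the second family only away from the
  crossings, which the exceptional set in \<open>reg2_divide_snd\<close> permits.\<close>

lemma local_equation_S:
  assumes V: "openin (ktop X) V" "V \<subseteq> dom i j"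
  shows "local_equation X S V (cut V (hS i j))"
  unfolding local_equation_def
proof (intro conjI allI impI ballI)
  show "cut V (hS i j) \<in> kreg X V" by (intro kreg_cutI[OF V] reg2_hS)
  show "cut V (hS i j) p = 0" if p: "p \<in> V \<inter> S" for p
  proof -
    obtain s t where "p = chart i j s t" using p V(2) by (blast elim: in_domE)
    then show ?thesis using p by auto
  qed
  fix W g p assume Wg: "openin (ktop X) W \<and> W \<subseteq> V \<and> g \<in> kreg X W \<and> (\<forall>p\<in>W \<inter> S. g p = 0)"
    and p: "p \<in> W"
  obtain s t where pc: "p = chart i j s t" using p Wg V(2) by (blast elim: in_domE)
  let ?\<phi> = "\<lambda>s t. g (chart i j s t)"
  have nW: "near s t (\<lambda>s t. chart i j s t \<in> W)" using Wg p pc by (intro open_near) auto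
  have zero: "?\<phi> s t = 0" if "chart i j s t \<in> W" "poly (pp i) s = 0 \<or> poly (qq j) t = 0" for s t
    using that Wg by simp
  have "\<exists>\<psi>. reg2 \<psi> s t \<and> near s t (\<lambda>s t. ?\<phi> s t = poly (pp i) s * \<psi> s t)"
  proof (rule reg2_divide_fst[OF simple_pp _ one_neq_zero[symmetric, THEN not_sym]])
    show "reg2 ?\<phi> s t" using Wg p pc kreg_reg2 by blast
    show "near s t (\<lambda>s' t'. s' = s \<longrightarrow> poly 1 t' \<noteq> 0 \<longrightarrow> ?\<phi> s' t' = 0)" if "poly (pp i) s = 0"
      by (rule near_mono[OF nW]) (use that zero in blast)
  qed
  then obtain \<psi>1 where \<psi>1: "reg2 \<psi>1 s t" "near s t (\<lambda>s t. ?\<phi> s t = poly (pp i) s * \<psi>1 s t)" by blast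
  have "\<exists>\<psi>. reg2 \<psi> s t \<and> near s t (\<lambda>s t. \<psi>1 s t = poly (qq j) t * \<psi> s t)"
  proof (rule reg2_divide_snd[OF simple_qq \<psi>1(1) pp_nonzero[of i]])
    show "near s t (\<lambda>s' t'. t' = t \<longrightarrow> poly (pp i) s' \<noteq> 0 \<longrightarrow> \<psi>1 s' t' = 0)" if "poly (qq j) t = 0"
      by (rule near_mono[OF near_conj[OF nW \<psi>1(2)]]) (use that zero in fastforce)
  qed
  then obtain \<psi>2 where \<psi>2: "reg2 \<psi>2 s t" "near s t (\<lambda>s t. \<psi>1 s t = poly (qq j) t * \<psi>2 s t)" by blast
  have "near s t (\<lambda>s t. chart i j s t \<in> W \<and> ?\<phi> s t = \<psi>2 s t * (poly (pp i) s * poly (qq j) t))"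
    by (rule near_mono[OF near_conj[OF nW near_conj[OF \<psi>1(2) \<psi>2(2)]]]) auto
  then obtain W' where W': "openin (ktop X) W'" "chart i j s t \<in> W'" "W' \<subseteq> dom i j"
    "cut W' (\<lambda>q. \<psi>2 (sig i q) (tau j q)) \<in> kreg X W'"
    "\<And>s t. chart i j s t \<in> W' \<Longrightarrow>
      chart i j s t \<in> W \<and> ?\<phi> s t = \<psi>2 s t * (poly (pp i) s * poly (qq j) t)"
    using reg2_section[OF \<psi>2(1)] by blast
  have "W' \<subseteq> W" using W'(3,5) by (blast elim: in_domE)
  moreover have "g q = cut W' (\<lambda>q. \<psi>2 (sig i q) (tau j q)) q * cut V (hS i j) q" if q: "q \<in> W'" for q
  proof -
    obtain s' t' where qc: "q = chart i j s' t'" using q W'(3) by (blast elim: in_domE)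
    have "q \<in> V" using q \<open>W' \<subseteq> W\<close> Wg by blast
    then show ?thesis using W'(5)[of s' t'] q qc by simp
  qed
  ultimately show "\<exists>W' r. openin (ktop X) W' \<and> p \<in> W' \<and> W' \<subseteq> W \<and> r \<in> kreg X W' \<and>
      (\<forall>q\<in>W'. g q = r q * cut V (hS i j) q)"
    using W' pc by blast
qed (rule V(1))

text \<open>
  Clearing denominators, \<open>f = PQ \<cdot> \<omega>(d/ds)\<close>, \<open>g = PQ \<cdot> \<omega>(d/dt)\<close> and \<open>k = PQ \<cdot> d\<omega>(d/ds, d/dt)\<close> are
  regular and satisfy \<open>PQ k = Q (P g_s - P' g) - P (Q f_t - Q' f)\<close>.  Where \<open>Q\<close> vanishes this reads
  \<open>P Q' f = 0\<close>, so \<open>Q\<close>, having simple roots, divides \<open>f\<close>; likewise \<open>P\<close> divides \<open>g\<close>.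
\<close>

lemma log_form_coeffs:
  assumes \<omega>: "\<omega> \<in> log_form1 X S U" and c: "chart i j s0 t0 \<in> U"
  shows "\<exists>\<psi>1 \<psi>2. reg2 \<psi>1 s0 t0 \<and> reg2 \<psi>2 s0 t0 \<and> near s0 t0 (\<lambda>s t.
    poly (pp i) s \<noteq> 0 \<longrightarrow> poly (qq j) t \<noteq> 0 \<longrightarrow>
      \<psi>1 s t = poly (pp i) s * coeff1 dS i j \<omega> s t \<and> \<psi>2 s t = poly (qq j) t * coeff1 dT i j \<omega> s t)"
proof -
  let ?P = "\<lambda>s. poly (pp i) s" and ?Q = "\<lambda>t. poly (qq j) t"
  let ?P' = "\<lambda>s. poly (pderiv (pp i)) s" and ?Q' = "\<lambda>t. poly (pderiv (qq j)) t"
  have \<omega>reg: "\<omega> \<in> regular_form1 X (U - S)" using \<omega> by (simp add: log_form1_def)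
  obtain V h \<theta> \<eta> \<theta>2 where V: "chart i j s0 t0 \<in> V" "V \<subseteq> U" "local_equation X S V h"
    and \<theta>: "\<theta> \<in> regular_form1 X V" "\<forall>q\<in>V - S. \<forall>\<delta>\<in>tangent X q. \<theta> q \<delta> = h q * \<omega> q \<delta>"
    and \<eta>: "is_exterior_derivative X (V - S) \<omega> \<eta>" and \<theta>2: "\<theta>2 \<in> regular_form2 X V"
      "\<forall>q\<in>V - S. \<forall>\<delta>\<in>tangent X q. \<forall>\<epsilon>\<in>tangent X q. \<theta>2 q \<delta> \<epsilon> = h q * \<eta> q \<delta> \<epsilon>"
    using \<omega> c unfolding log_form1_def by blast
  have oV: "openin (ktop X) V" using V(3) by (simp add: local_equation_def)
  define W0 where "W0 = V \<inter> dom i j"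
  have W0: "openin (ktop X) W0" "W0 \<subseteq> dom i j" "W0 \<subseteq> V" "chart i j s0 t0 \<in> W0"
    using oV open_dom V(1) by (auto simp: W0_def)
  \<comment> \<open>The equation \<open>h\<close> supplied with the logarithmic form need not be P
    Q. As \<open>h\<close> generates the ideal of \<open>S\<close>, P Q is a multiple
    \<open>r * h\<close>, and multiplication by \<open>r\<close> turns the pole conditions for
    \<open>h\<close> into those for P Q.\<close>
  obtain W r where W: "openin (ktop X) W" "chart i j s0 t0 \<in> W" "W \<subseteq> W0" "r \<in> kreg X W"
    "\<And>q. q \<in> W \<Longrightarrow> cut W0 (hS i j) q = r q * h q"
  proof -
    have z: "\<And>p. p \<in> W0 \<Longrightarrow> p \<in> S \<Longrightarrow> cut W0 (hS i j) p = 0"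
      using local_equation_S[OF W0(1,2)] by (simp add: local_equation_def)
    show thesis
      by (rule local_equation_divides[OF V(3) W0(1,3) _ z W0(4)])
        (use local_equation_S[OF W0(1,2)] that in \<open>auto simp: local_equation_def\<close>)
  qed
  have rh: "r (chart i j s t) * h (chart i j s t) = ?P s * ?Q t" if "chart i j s t \<in> W" for s t
  proof -
    have "chart i j s t \<in> W0" using that W(3) by blast
    then show ?thesis using W(5)[OF that] by simp
  qed
  let ?cS = "coeff1 dS i j \<omega>" and ?cT = "coeff1 dT i j \<omega>"
  define f where "f s t = r (chart i j s t) * coeff1 dS i j \<theta> s t" for s t
  define g where "g s t = r (chart i j s t) * coeff1 dT i j \<theta> s t" for s t
  define k where "k s t = r (chart i j s t) * \<theta>2 (chart i j s t) (vec dS i j s t) (vec dT i j s t)" for s t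
  have WV: "chart i j s t \<in> V" if "chart i j s t \<in> W" for s t using that W W0 by blast
  have reg: "reg2 f s t" "reg2 g s t" "reg2 k s t" if "chart i j s t \<in> W" for s t
    unfolding f_def g_def k_def
    by (intro reg2_mult kreg_reg2[OF W(4) that] form1_coeff_reg2[OF \<theta>(1) WV[OF that]]
        form2_coeff_reg2[OF \<theta>2(1) WV[OF that]] derivation_dS derivation_dT)+
  have nS: "chart i j s t \<in> W - S \<Longrightarrow> near s t (\<lambda>s t. chart i j s t \<in> W - S)" for s t
    by (rule open_near[OF open_minus_S[OF W(1)]])
  have fg: "f s t = ?P s * (?Q t * ?cS s t)" "g s t = ?P s * (?Q t * ?cT s t)"
    if "chart i j s t \<in> W - S" for s t
  proof -
    have q: "chart i j s t \<in> V - S" "chart i j s t \<in> W" using that WV by blast+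
    show "f s t = ?P s * (?Q t * ?cS s t)" "g s t = ?P s * (?Q t * ?cT s t)"
      using bspec[OF bspec[OF \<theta>(2) q(1)] vec_tangent[OF derivation_dS]]
        bspec[OF bspec[OF \<theta>(2) q(1)] vec_tangent[OF derivation_dT]] rh[OF q(2)]
      unfolding f_def g_def by (simp_all flip: mult.assoc)
  qed
  have k: "k s t = ?P s * ?Q t * (pd dS ?cT s t - pd dT ?cS s t)" if "chart i j s t \<in> W - S" for s t
  proof -
    have q: "chart i j s t \<in> V - S" "chart i j s t \<in> W" using that WV by blast+
    show ?thesis
      using bspec[OF bspec[OF bspec[OF \<theta>2(2) q(1)] vec_tangent[OF derivation_dS]] vec_tangent[OF derivation_dT]]
        rh[OF q(2)] exterior_derivative_coeff[OF \<eta> q(1)]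
      unfolding k_def by (simp flip: mult.assoc)
  qed
  let ?R = "\<lambda>s t. ?Q t * (?P s * pd dS g s t - ?P' s * g s t) - ?P s * (?Q t * pd dT f s t - ?Q' t * f s t)"
  have id: "?P s * ?Q t * k s t = ?R s t" if w: "chart i j s t \<in> W - S" for s t
  proof -
    have U: "chart i j s t \<in> U - S" using w WV V(2) by blast
    note rS = form1_coeff_reg2[OF \<omega>reg U derivation_dS]
    note rT = form1_coeff_reg2[OF \<omega>reg U derivation_dT]
    have w': "chart i j s t \<in> W" using w by blast
    \<comment> \<open>\<open>f\<close> agrees with P Q times the coefficient only off
      \<open>S\<close>; a neighbourhood disjoint from \<open>S\<close> is enough to compare
      derivatives.\<close>
    have "pd dT f s t = pd dT (\<lambda>s t. ?P s * (?Q t * ?cS s t)) s t"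
      by (rule pd_cong[OF derivation_dT reg(1)[OF w']], rule near_mono[OF nS[OF w]]) (rule fg(1))
    also have "\<dots> = ?P s * (?Q t * pd dT ?cS s t + ?Q' t * ?cS s t)"
      using rS by (simp add: pd_mult derivation_dT reg2_mult reg2_fst reg2_snd algebra_simps)
    finally have 1: "pd dT f s t = ?P s * (?Q t * pd dT ?cS s t + ?Q' t * ?cS s t)" .
    have "pd dS g s t = pd dS (\<lambda>s t. ?P s * (?Q t * ?cT s t)) s t"
      by (rule pd_cong[OF derivation_dS reg(2)[OF w']], rule near_mono[OF nS[OF w]]) (rule fg(2))
    also have "\<dots> = ?P s * (?Q t * pd dS ?cT s t) + ?P' s * (?Q t * ?cT s t)"
      using rT by (simp add: pd_mult derivation_dS reg2_mult reg2_fst reg2_snd algebra_simps)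
    finally have 2: "pd dS g s t = ?P s * (?Q t * pd dS ?cT s t) + ?P' s * (?Q t * ?cT s t)" .
    show ?thesis unfolding 1 2 fg[OF w] k[OF w] by (simp add: algebra_simps)
  qed
  have regR: "reg2 ?R s t" "reg2 (\<lambda>s t. ?P s * ?Q t * k s t) s t" if "chart i j s t \<in> W" for s t
    by (intro reg2_diff reg2_mult reg2_fst reg2_snd reg2_pd derivation_dS derivation_dT reg[OF that])+
  have nW: "near s0 t0 (\<lambda>s t. chart i j s t \<in> W)" by (rule open_near[OF W(1,2)])
  \<comment> \<open>Both sides are regular across \<open>S\<close>, so the identity extends by
    density to the roots of P and Q, which is where it is needed.\<close>
  have idn: "near s0 t0 (\<lambda>s t. ?P s * ?Q t * k s t = ?R s t)"
    by (rule reg2_density_eq[OF regR(2)[OF W(2)] regR(1)[OF W(2)] H_nonzero[of i j]],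
        rule near_mono[OF nW]) (use id in simp)
  have "\<exists>\<psi>. reg2 \<psi> s0 t0 \<and> near s0 t0 (\<lambda>s t. f s t = ?Q t * \<psi> s t)"
  proof (rule reg2_divide_snd[OF simple_qq reg(1)[OF W(2)] pp_nonzero[of i]])
    assume Q0: "?Q t0 = 0"
    then have "?Q' t0 \<noteq> 0" using simple_qq unfolding simple_roots_def by blast
    then show "near s0 t0 (\<lambda>s' t'. t' = t0 \<longrightarrow> ?P s' \<noteq> 0 \<longrightarrow> f s' t' = 0)"
      by (intro near_mono[OF idn]) (use Q0 in auto)
  qed
  then obtain \<psi>1 where \<psi>1: "reg2 \<psi>1 s0 t0" "near s0 t0 (\<lambda>s t. f s t = ?Q t * \<psi>1 s t)" by blast
  have "\<exists>\<psi>. reg2 \<psi> s0 t0 \<and> near s0 t0 (\<lambda>s t. g s t = ?P s * \<psi> s t)"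
  proof (rule reg2_divide_fst[OF simple_pp reg(2)[OF W(2)] qq_nonzero[of j]])
    assume P0: "?P s0 = 0"
    then have "?P' s0 \<noteq> 0" using simple_pp unfolding simple_roots_def by blast
    then show "near s0 t0 (\<lambda>s' t'. s' = s0 \<longrightarrow> ?Q t' \<noteq> 0 \<longrightarrow> g s' t' = 0)"
      by (intro near_mono[OF idn]) (use P0 in auto)
  qed
  then obtain \<psi>2 where \<psi>2: "reg2 \<psi>2 s0 t0" "near s0 t0 (\<lambda>s t. g s t = ?P s * \<psi>2 s t)" by blast
  have "near s0 t0 (\<lambda>s t. ?P s \<noteq> 0 \<longrightarrow> ?Q t \<noteq> 0 \<longrightarrow>
      \<psi>1 s t = ?P s * ?cS s t \<and> \<psi>2 s t = ?Q t * ?cT s t)"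
    by (rule near_mono[OF near_conj[OF nW near_conj[OF \<psi>1(2) \<psi>2(2)]]]) (use fg in auto)
  with \<psi>1(1) \<psi>2(1) show ?thesis by blast
qed

text \<open>Here \<open>f0\<close> stands for f / u, and du is a multiple of dx. In u d(f / u)
  \<and> dx the term with du \<and> dx vanishes, which leaves df \<and> dx: no double pole
  arises.\<close>

lemma quotient_wedge:
  fixes \<delta> \<epsilon> :: "('k ppoint \<Rightarrow> 'k) \<Rightarrow> 'k"
  assumes \<delta>: "\<delta> \<in> tangent X (chart i j s t)" and \<epsilon>: "\<epsilon> \<in> tangent X (chart i j s t)"
    and reg: "f0 \<in> regular_near X (chart i j s t)" "u \<in> regular_near X (chart i j s t)"
    and eq: "near s t (\<lambda>s t. f0 (chart i j s t) * u (chart i j s t) = f (chart i j s t))"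
    and u: "\<delta> u = u' * \<delta> x" "\<epsilon> u = u' * \<epsilon> x"
  shows "u (chart i j s t) * (\<delta> f0 * \<epsilon> x - \<epsilon> f0 * \<delta> x) = \<delta> f * \<epsilon> x - \<epsilon> f * \<delta> x"
proof -
  have r: "(\<lambda>q. f0 q * u q) \<in> regular_near X (chart i j s t)"
    using reg unfolding regular_near_iff by (rule reg2_mult)
  have *: "\<delta> f = f0 (chart i j s t) * (u' * \<delta> x) + u (chart i j s t) * \<delta> f0"
    using tangent_cong[OF \<delta> r eq] tangent_rules(3)[OF \<delta> reg] u by simp
  have **: "\<epsilon> f = f0 (chart i j s t) * (u' * \<epsilon> x) + u (chart i j s t) * \<epsilon> f0"
    using tangent_cong[OF \<epsilon> r eq] tangent_rules(3)[OF \<epsilon> reg] u by simp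
  show ?thesis unfolding * ** by (simp add: algebra_simps)
qed

text \<open>The converse of \<open>log_form_coeffs\<close>. Since P depends on s alone, the
  differential of (f / P) ds is (df \<and> ds) / P, again with a simple pole; likewise for Q and
  t.\<close>

lemma log_form1I:
  fixes \<omega> :: "('k ppoint, 'k) form1"
  assumes zero: "\<And>p \<delta>. \<not> (p \<in> U - S \<and> \<delta> \<in> tangent X p) \<Longrightarrow> \<omega> p \<delta> = 0"
    and loc: "\<And>p. p \<in> U \<Longrightarrow> \<exists>V i j f g. openin (ktop X) V \<and> p \<in> V \<and> V \<subseteq> U \<and> V \<subseteq> dom i j \<and>
      f \<in> kreg X V \<and> g \<in> kreg X V \<and> (\<forall>q\<in>V - S. \<forall>\<delta>\<in>tangent X q.
        \<omega> q \<delta> = f q / poly (pp i) (sig i q) * \<delta> (sig i) + g q / poly (qq j) (tau j q) * \<delta> (tau j))"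
  shows "\<omega> \<in> log_form1 X S U"
proof -
  have quot: "cut (V - S) (\<lambda>q. f q / poly (pp i) (sig i q)) \<in> kreg X (V - S)"
    "cut (V - S) (\<lambda>q. f q / poly (qq j) (tau j q)) \<in> kreg X (V - S)"
    if V: "openin (ktop X) V" "V \<subseteq> dom i j" and f: "f \<in> kreg X V" for V i j f
  proof -
    have d: "V - S \<subseteq> dom i j" using V by blast
    show "cut (V - S) (\<lambda>q. f q / poly (pp i) (sig i q)) \<in> kreg X (V - S)"
      by (intro kreg_cutI[OF open_minus_S[OF V(1)] d])
        (auto intro!: reg2_divide reg2_fst kreg_reg2[OF f])
    show "cut (V - S) (\<lambda>q. f q / poly (qq j) (tau j q)) \<in> kreg X (V - S)"
      by (intro kreg_cutI[OF open_minus_S[OF V(1)] d])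
        (auto intro!: reg2_divide reg2_snd kreg_reg2[OF f])
  qed
  have "\<omega> \<in> regular_form1 X (U - S)"
  proof (rule regular_form1I[OF zero])
    fix p assume p: "p \<in> U - S"
    then have pU: "p \<in> U" by blast
    obtain V i j f g where V: "openin (ktop X) V" "p \<in> V" "V \<subseteq> U" "V \<subseteq> dom i j"
      and fg: "f \<in> kreg X V" "g \<in> kreg X V" and \<omega>: "\<forall>q\<in>V - S. \<forall>\<delta>\<in>tangent X q.
        \<omega> q \<delta> = f q / poly (pp i) (sig i q) * \<delta> (sig i) + g q / poly (qq j) (tau j q) * \<delta> (tau j)"
      using loc[OF pU] by (elim exE conjE) (rule that)
    show "\<exists>V i j f g. openin (ktop X) V \<and> p \<in> V \<and> V \<subseteq> U - S \<and> V \<subseteq> dom i j \<and>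
      f \<in> kreg X V \<and> g \<in> kreg X V \<and>
      (\<forall>q\<in>V. \<forall>\<delta>\<in>tangent X q. \<omega> q \<delta> = f q * \<delta> (sig i) + g q * \<delta> (tau j))"
      using V p \<omega> open_minus_S[OF V(1)] quot(1)[OF V(1,4) fg(1)] quot(2)[OF V(1,4) fg(2)]
      by (intro exI[of _ "V - S"] exI[of _ i] exI[of _ j]
          exI[of _ "cut (V - S) (\<lambda>q. f q / poly (pp i) (sig i q))"]
          exI[of _ "cut (V - S) (\<lambda>q. g q / poly (qq j) (tau j q))"]) auto
  qed
  moreover have "\<exists>V h. p \<in> V \<and> V \<subseteq> U \<and> local_equation X S V h \<and>
        (\<exists>\<theta>\<in>regular_form1 X V. \<forall>q\<in>V - S. \<forall>\<delta>\<in>tangent X q. \<theta> q \<delta> = h q * \<omega> q \<delta>) \<and>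
        (\<exists>\<eta>. is_exterior_derivative X (V - S) \<omega> \<eta> \<and>
          (\<exists>\<theta>\<in>regular_form2 X V. \<forall>q\<in>V - S. \<forall>\<delta>\<in>tangent X q. \<forall>\<epsilon>\<in>tangent X q.
            \<theta> q \<delta> \<epsilon> = h q * \<eta> q \<delta> \<epsilon>))" if pU: "p \<in> U" for p
  proof -
    obtain V i j f g where V: "openin (ktop X) V" "p \<in> V" "V \<subseteq> U" "V \<subseteq> dom i j"
      and fg: "f \<in> kreg X V" "g \<in> kreg X V" and \<omega>: "\<forall>q\<in>V - S. \<forall>\<delta>\<in>tangent X q.
        \<omega> q \<delta> = f q / poly (pp i) (sig i q) * \<delta> (sig i) + g q / poly (qq j) (tau j q) * \<delta> (tau j)"
      using loc[OF pU] by (elim exE conjE) (rule that)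
    let ?V = "V - S"
    have oV: "openin (ktop X) ?V" by (rule open_minus_S[OF V(1)])
    have dV: "?V \<subseteq> dom i j" using V(4) by blast
    define u where "u q = poly (pp i) (sig i q)" for q :: "'k ppoint"
    define v where "v q = poly (qq j) (tau j q)" for q :: "'k ppoint"
    have u: "u (chart i j s t) = poly (pp i) s" and v: "v (chart i j s t) = poly (qq j) t" for s t
      by (simp_all add: u_def v_def)
    have ku: "cut V u \<in> kreg X V" and kv: "cut V v \<in> kreg X V"
      by (rule kreg_cutI[OF V(1,4)], simp add: u v reg2_fst reg2_snd)+
    \<comment> \<open>P Q times \<omega> with the denominators already cancelled, hence defined on
      all of \<open>V\<close>.\<close>
    define \<theta> :: "('k ppoint, 'k) form1" where "\<theta> q \<delta> = (if q \<in> V \<and> \<delta> \<in> tangent X q then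
        f q * v q * \<delta> (sig i) + g q * u q * \<delta> (tau j) else 0)" for q \<delta>
    have \<theta>: "\<theta> \<in> regular_form1 X V"
    proof (rule regular_form1I)
      have "cut V (\<lambda>q. f q * v q) \<in> kreg X V" "cut V (\<lambda>q. g q * u q) \<in> kreg X V"
        by (rule kreg_cutI[OF V(1,4)], simp add: u v,
            intro reg2_mult reg2_fst reg2_snd kreg_reg2[OF fg(1)] kreg_reg2[OF fg(2)], assumption)+
      then show "\<exists>V' i j f g. openin (ktop X) V' \<and> p \<in> V' \<and> V' \<subseteq> V \<and> V' \<subseteq> dom i j \<and>
          f \<in> kreg X V' \<and> g \<in> kreg X V' \<and>
          (\<forall>q\<in>V'. \<forall>\<delta>\<in>tangent X q. \<theta> q \<delta> = f q * \<delta> (sig i) + g q * \<delta> (tau j))" if "p \<in> V" for p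
        using V that
        by (intro exI[of _ V] exI[of _ i] exI[of _ j] exI[of _ "cut V (\<lambda>q. f q * v q)"]
            exI[of _ "cut V (\<lambda>q. g q * u q)"]) (auto simp: \<theta>_def)
    qed (auto simp: \<theta>_def)
    have \<theta>h: "\<theta> q \<delta> = cut V (hS i j) q * \<omega> q \<delta>" if q: "q \<in> ?V" "\<delta> \<in> tangent X q" for q \<delta>
    proof -
      obtain s t where qc: "q = chart i j s t" using q V(4) by (blast elim: in_domE)
      have "u q \<noteq> 0" "v q \<noteq> 0" using q qc by (auto simp: u v)
      then show ?thesis using q \<omega> unfolding \<theta>_def by (simp add: hS_def u_def v_def field_simps)
    qed
    \<comment> \<open>Together with \<open>G\<close> this presents \<omega> off \<open>S\<close> as
      a sum of two terms f dg, from which the exterior derivative is formed.\<close>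
    define F where "F k = (if k = (0::nat) then cut ?V (\<lambda>q. f q / u q) else cut ?V (\<lambda>q. g q / v q))" for k
    define G where "G k = (if k = (0::nat) then cut ?V (sig i) else cut ?V (tau j))" for k
    have FG: "F k \<in> kreg X ?V" "G k \<in> kreg X ?V" for k
      unfolding F_def G_def u_def v_def
      using quot(1)[OF V(1,4) fg(1)] quot(2)[OF V(1,4) fg(2)]
        kreg_cutI[OF oV dV, of "sig i"] kreg_cutI[OF oV dV, of "tau j"]
      by (auto simp: reg2_id_fst reg2_id_snd)
    have cutc: "\<delta> (cut ?V (sig i)) = \<delta> (sig i)" "\<delta> (cut ?V (tau j)) = \<delta> (tau j)"
      if "q \<in> ?V" "\<delta> \<in> tangent X q" for q \<delta>
    proof -
      obtain s t where qc: "q = chart i j s t" using \<open>q \<in> ?V\<close> V(4) by (blast elim: in_domE)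
      show "\<delta> (cut ?V (sig i)) = \<delta> (sig i)" "\<delta> (cut ?V (tau j)) = \<delta> (tau j)"
        by (rule tangent_cut[OF that(2)[unfolded qc] _ oV that(1)[unfolded qc]],
            rule regular_near_sig regular_near_tau)+
    qed
    define \<eta> :: "('k ppoint, 'k) form2" where
      "\<eta> q \<delta> \<epsilon> = (if q \<in> ?V \<and> \<delta> \<in> tangent X q \<and> \<epsilon> \<in> tangent X q then
        (\<Sum>k<(2::nat). \<delta> (F k) * \<epsilon> (G k) - \<epsilon> (F k) * \<delta> (G k)) else 0)" for q \<delta> \<epsilon>
    have "cut ?V (\<lambda>q. 1) \<in> kreg X ?V" by (rule kreg_cutI[OF oV dV reg2_const])
    then have "\<exists>W (n::nat) f g h. openin (ktop X) W \<and> p \<in> W \<and> W \<subseteq> ?V \<and>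
          (\<forall>i<n. f i \<in> kreg X W \<and> g i \<in> kreg X W \<and> h i \<in> kreg X W) \<and>
          (\<forall>q\<in>W. \<forall>\<delta>\<in>tangent X q. \<forall>\<epsilon>\<in>tangent X q.
            \<eta> q \<delta> \<epsilon> = (\<Sum>i<n. f i q * (\<delta> (g i) * \<epsilon> (h i) - \<epsilon> (g i) * \<delta> (h i))))"
      if "p \<in> ?V" for p
      using oV FG that
      by (intro exI[of _ ?V] exI[of _ 2] exI[of _ "\<lambda>_. cut ?V (\<lambda>q. 1)"] exI[of _ F] exI[of _ G])
        (simp add: \<eta>_def)
    then have "\<eta> \<in> regular_form2 X ?V"
      unfolding regular_form2_def by (auto simp: \<eta>_def)
    moreover have "\<omega> q \<delta> = (\<Sum>k<(2::nat). F k q * \<delta> (G k))" if q: "q \<in> ?V" "\<delta> \<in> tangent X q" for q \<delta>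
      using \<omega> q cutc[OF q] by (simp add: numeral_2_eq_2 F_def G_def u_def v_def)
    ultimately have E: "openin (ktop X) ?V \<and> p \<in> ?V \<and> ?V \<subseteq> ?V \<and>
          (\<forall>i<2. F i \<in> kreg X ?V \<and> G i \<in> kreg X ?V) \<and>
          (\<forall>q\<in>?V. \<forall>\<delta>\<in>tangent X q. \<omega> q \<delta> = (\<Sum>i<2. F i q * \<delta> (G i))) \<and>
          (\<forall>q\<in>?V. \<forall>\<delta>\<in>tangent X q. \<forall>\<epsilon>\<in>tangent X q.
            \<eta> q \<delta> \<epsilon> = (\<Sum>i<2. \<delta> (F i) * \<epsilon> (G i) - \<epsilon> (F i) * \<delta> (G i)))"
      if "p \<in> ?V" for p
      using oV FG that by (simp add: \<eta>_def)
    have \<eta>: "is_exterior_derivative X ?V \<omega> \<eta>"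
      unfolding is_exterior_derivative_def
      by (intro conjI ballI, rule \<open>\<eta> \<in> regular_form2 X ?V\<close>) (rule exI, rule exI, rule exI, rule exI, erule E)
    \<comment> \<open>The coefficients of P Q d\<omega> = Q df \<and> ds + P dg \<and> dt, which has
      no denominators left.\<close>
    let ?f = "\<lambda>k. if k = (0::nat) then cut V v else cut V u"
    let ?g = "\<lambda>k. if k = (0::nat) then f else g"
    let ?h = "\<lambda>k. if k = (0::nat) then cut V (sig i) else cut V (tau j)"
    define \<theta>2 :: "('k ppoint, 'k) form2" where
      "\<theta>2 q \<delta> \<epsilon> = (if q \<in> V \<and> \<delta> \<in> tangent X q \<and> \<epsilon> \<in> tangent X q then
        (\<Sum>k<2. ?f k q * (\<delta> (?g k) * \<epsilon> (?h k) - \<epsilon> (?g k) * \<delta> (?h k))) else 0)" for q \<delta> \<epsilon>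
    have kst: "cut V (sig i) \<in> kreg X V" "cut V (tau j) \<in> kreg X V"
      by (rule kreg_cutI[OF V(1,4)], simp add: reg2_id_fst reg2_id_snd)+
    have \<theta>2: "\<theta>2 \<in> regular_form2 X V"
      unfolding regular_form2_def
    proof (intro CollectI conjI allI impI ballI)
      fix p assume "p \<in> V"
      then show "\<exists>W (n::nat) f g h. openin (ktop X) W \<and> p \<in> W \<and> W \<subseteq> V \<and>
          (\<forall>i<n. f i \<in> kreg X W \<and> g i \<in> kreg X W \<and> h i \<in> kreg X W) \<and>
          (\<forall>q\<in>W. \<forall>\<delta>\<in>tangent X q. \<forall>\<epsilon>\<in>tangent X q.
            \<theta>2 q \<delta> \<epsilon> = (\<Sum>i<n. f i q * (\<delta> (g i) * \<epsilon> (h i) - \<epsilon> (g i) * \<delta> (h i))))"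
        using V fg ku kv kst
        by (intro exI[of _ V] exI[of _ 2] exI[of _ ?f] exI[of _ ?g] exI[of _ ?h]) (simp add: \<theta>2_def)
    qed (auto simp: \<theta>2_def)
    have \<theta>2h: "\<theta>2 q \<delta> \<epsilon> = cut V (hS i j) q * \<eta> q \<delta> \<epsilon>"
      if q: "q \<in> ?V" and \<delta>: "\<delta> \<in> tangent X q" and \<epsilon>: "\<epsilon> \<in> tangent X q" for q \<delta> \<epsilon>
    proof -
      obtain s t where qc: "q = chart i j s t" using q V(4) by (blast elim: in_domE)
      note q' = q[unfolded qc] and \<delta>' = \<delta>[unfolded qc] and \<epsilon>' = \<epsilon>[unfolded qc]
      have nz: "near s t (\<lambda>s t. chart i j s t \<in> ?V)" by (rule open_near[OF oV q'])
      have qV: "chart i j s t \<in> V" using q' by blast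
      have c: "\<alpha> (cut V (sig i)) = \<alpha> (sig i)" "\<alpha> (cut V (tau j)) = \<alpha> (tau j)"
        if "\<alpha> \<in> tangent X (chart i j s t)" for \<alpha>
        by (rule tangent_cut[OF that _ V(1) qV], rule regular_near_sig regular_near_tau)+
      have du: "\<alpha> u = poly (pderiv (pp i)) s * \<alpha> (sig i)" and dv: "\<alpha> v = poly (pderiv (qq j)) t * \<alpha> (tau j)"
        if \<alpha>: "\<alpha> \<in> tangent X (chart i j s t)" for \<alpha>
        using tangent_ev[OF \<alpha>, of "[:pp i:]"] tangent_ev[OF \<alpha>, of "tpoly (qq j)"]
        unfolding u_def[abs_def] v_def[abs_def] by (simp_all add: dT_pCons dT_tpoly)
      have ruv: "u \<in> regular_near X (chart i j s t)" "v \<in> regular_near X (chart i j s t)"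
        by (simp_all add: regular_near_iff u v reg2_fst reg2_snd)
      have rF: "F k \<in> regular_near X (chart i j s t)" for k
        by (rule kreg_regular_near[OF FG(1) q'])
      have 1: "u q * (\<delta> (F 0) * \<epsilon> (sig i) - \<epsilon> (F 0) * \<delta> (sig i)) = \<delta> f * \<epsilon> (sig i) - \<epsilon> f * \<delta> (sig i)"
        unfolding qc
        by (rule quotient_wedge[OF \<delta>' \<epsilon>' rF ruv(1) _ du[OF \<delta>'] du[OF \<epsilon>']],
            rule near_mono[OF nz]) (auto simp: F_def u)
      have 2: "v q * (\<delta> (F 1) * \<epsilon> (tau j) - \<epsilon> (F 1) * \<delta> (tau j)) = \<delta> g * \<epsilon> (tau j) - \<epsilon> g * \<delta> (tau j)"
        unfolding qc
        by (rule quotient_wedge[OF \<delta>' \<epsilon>' rF ruv(2) _ dv[OF \<delta>'] dv[OF \<epsilon>']],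
            rule near_mono[OF nz]) (auto simp: F_def v)
      have 3: "\<theta>2 q \<delta> \<epsilon> = v q * (\<delta> f * \<epsilon> (sig i) - \<epsilon> f * \<delta> (sig i))
          + u q * (\<delta> g * \<epsilon> (tau j) - \<epsilon> g * \<delta> (tau j))"
        using q \<delta> \<epsilon> c[OF \<delta>'] c[OF \<epsilon>'] by (simp add: \<theta>2_def numeral_2_eq_2)
      have 4: "\<eta> q \<delta> \<epsilon> = (\<delta> (F 0) * \<epsilon> (sig i) - \<epsilon> (F 0) * \<delta> (sig i))
          + (\<delta> (F 1) * \<epsilon> (tau j) - \<epsilon> (F 1) * \<delta> (tau j))"
        using q \<delta> \<epsilon> cutc[OF q \<delta>] cutc[OF q \<epsilon>] by (simp add: \<eta>_def numeral_2_eq_2 G_def)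
      have 5: "cut V (hS i j) q = u q * v q" using q by (simp add: hS_def u_def v_def)
      show ?thesis unfolding 3 4 5 1[symmetric] 2[symmetric] by (simp add: algebra_simps)
    qed
    have 1: "\<exists>\<theta>\<in>regular_form1 X V. \<forall>q\<in>V - S. \<forall>\<delta>\<in>tangent X q. \<theta> q \<delta> = cut V (hS i j) q * \<omega> q \<delta>"
      by (intro bexI[OF _ \<theta>] ballI \<theta>h)
    have 2: "\<exists>\<theta>\<in>regular_form2 X V. \<forall>q\<in>V - S. \<forall>\<delta>\<in>tangent X q. \<forall>\<epsilon>\<in>tangent X q.
        \<theta> q \<delta> \<epsilon> = cut V (hS i j) q * \<eta> q \<delta> \<epsilon>"
      by (intro bexI[OF _ \<theta>2] ballI \<theta>2h)
    show ?thesis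
      by (intro exI[of _ V] exI[of _ "cut V (hS i j)"] exI[of _ \<eta>] conjI V(2,3) local_equation_S V(1,4) 1 2 \<eta>)
  qed
  ultimately show ?thesis unfolding log_form1_def by blast
qed

end

section \<open>Sections of line bundles in the charts\<close>

context balanced_scroll
begin

abbreviation sec :: "int \<Rightarrow> int \<Rightarrow> 'k::field ppoint set \<Rightarrow> ((nat \<Rightarrow> 'k) \<Rightarrow> (nat \<Rightarrow> 'k) \<Rightarrow> 'k) set" where
  "sec \<beta> m U \<equiv> carrier (osec (scroll_sheaf n n \<beta> m) U)"

text \<open>By homogeneity a section is determined by its values at the normalised coordinates of
  the charts (\<open>sec_scale\<close>, \<open>sec_eqI\<close>).\<close>

definition val :: "((nat \<Rightarrow> 'k) \<Rightarrow> (nat \<Rightarrow> 'k) \<Rightarrow> 'k) \<Rightarrow> bool \<Rightarrow> bool \<Rightarrow> 'k::field \<Rightarrow> 'k \<Rightarrow> 'k" where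
  "val F i j s t = F (smc i j s t) (aff i s)"

lemma sec_iff_local:
  "F \<in> sec \<beta> m U \<longleftrightarrow> (\<forall>v w. \<not> (hclass v \<in> U \<and> w \<in> scroll_proj n n (hclass v)) \<longrightarrow> F v w = 0) \<and>
    (\<forall>p\<in>U. \<exists>V. openin (ktop X) V \<and> p \<in> V \<and> V \<subseteq> U \<and>
      (\<exists>d e d' e'. int d - int d' = \<beta> \<and> int e - int e' = m \<and>
        (\<exists>P\<in>bihpoly (n + n + 1) 1 d e. \<exists>Q\<in>bihpoly (n + n + 1) 1 d' e'.
          \<forall>q\<in>V. \<forall>v\<in>q. \<forall>w\<in>scroll_proj n n q. Q v w \<noteq> 0 \<and> F v w = P v w / Q v w)))"
  unfolding ktop_X by (simp add: scroll_sheaf_def twist_def)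

lemma sec_localE:
  assumes "F \<in> sec \<beta> m U" "p \<in> U"
  obtains V d d' e e' P Q where "openin (ktop X) V" "p \<in> V" "V \<subseteq> U"
    "int d - int d' = \<beta>" "int e - int e' = m"
    "P \<in> bihpoly (n + n + 1) 1 d e" "Q \<in> bihpoly (n + n + 1) 1 d' e'"
    "\<And>q v w. q \<in> V \<Longrightarrow> v \<in> q \<Longrightarrow> w \<in> scroll_proj n n q \<Longrightarrow> Q v w \<noteq> 0 \<and> F v w = P v w / Q v w"
proof -
  note * = assms(1)[unfolded sec_iff_local, THEN conjunct2, rule_format, OF assms(2)]
  show thesis using * by (elim exE conjE bexE) (rule that, assumption+, blast)
qed

lemma sec_zero:
  "F \<in> sec \<beta> m U \<Longrightarrow> \<not> (hclass v \<in> U \<and> w \<in> scroll_proj n n (hclass v)) \<Longrightarrow> F v w = 0"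
  unfolding sec_iff_local by blast

lemma smc_in_chart: "smc i j s t \<in> chart i j s t"
  by (simp add: chart_def hclass_self)

lemma aff_in_proj: "aff i s \<in> scroll_proj n n (chart i j s t)"
  by (simp add: scroll_proj_chart hclass_self)

lemma hclass_scale_chart: "c \<noteq> 0 \<Longrightarrow> hclass (\<lambda>k. c * smc i j s t k) = chart i j s t"
  by (simp add: chart_def hclass_scale)

lemma sec_pairE:
  assumes "openin (ktop X) U" "hclass v \<in> U" "w \<in> scroll_proj n n (hclass v)"
  obtains i j s t c d where "hclass v = chart i j s t" "c \<noteq> 0" "d \<noteq> 0"
    "v = (\<lambda>k. c * smc i j s t k)" "w = (\<lambda>k. d * aff i s k)"
proof -
  obtain i j s t where c: "hclass v = chart i j s t" using openE[OF assms(1,2)] .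
  obtain x where x: "x \<noteq> 0" "v = (\<lambda>k. x * smc i j s t k)"
    using c unfolding chart_def by (rule hclass_eqE)
  obtain d where d: "d \<noteq> 0" "w = (\<lambda>k. d * aff i s k)"
    using assms(3) unfolding c scroll_proj_chart by (rule in_hclassE)
  show thesis by (rule that[OF c x(1) d(1) x(2) d(2)])
qed

lemma sec_reg2:
  assumes "F \<in> sec \<beta> m U" "chart i j s t \<in> U"
  shows "reg2 (val F i j) s t"
proof -
  obtain V d d' e e' P Q where V: "openin (ktop X) V" "chart i j s t \<in> V"
    and PQ: "P \<in> bihpoly (n + n + 1) 1 d e" "Q \<in> bihpoly (n + n + 1) 1 d' e'"
    and eq: "\<And>q v w. q \<in> V \<Longrightarrow> v \<in> q \<Longrightarrow> w \<in> scroll_proj n n q \<Longrightarrow> Q v w \<noteq> 0 \<and> F v w = P v w / Q v w"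
    using sec_localE[OF assms] by metis
  have e: "Q (smc i j s t) (aff i s) \<noteq> 0 \<and> val F i j s t = P (smc i j s t) (aff i s) / Q (smc i j s t) (aff i s)"
    if "chart i j s t \<in> V" for s t
    unfolding val_def by (rule eq[OF that smc_in_chart aff_in_proj])
  have "reg2 (\<lambda>s t. P (smc i j s t) (aff i s) / Q (smc i j s t) (aff i s)) s t"
    using e[OF V(2)]
    by (intro reg2_divide evf_reg2 bihpoly_evf[OF PQ(1)] bihpoly_evf[OF PQ(2)] smc_evf evf_aff) auto
  then show ?thesis by (rule reg2_cong) (rule near_mono[OF open_near[OF V]], simp add: e)
qed

lemma power_int_quotient:
  fixes c :: "'k::field"
  assumes "c \<noteq> 0" "int d - int d' = \<beta>" shows "c ^ d / c ^ d' = c powi \<beta>"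
  using assms power_int_diff[of c "int d" "int d'"] by simp

lemma sec_scale:
  fixes F :: "(nat \<Rightarrow> 'k::field) \<Rightarrow> (nat \<Rightarrow> 'k) \<Rightarrow> 'k"
  assumes F: "F \<in> sec \<beta> m U" and U: "chart i j s t \<in> U" and c: "c \<noteq> 0" and d: "d \<noteq> 0"
  shows "F (\<lambda>k. c * smc i j s t k) (\<lambda>k. d * aff i s k) = c powi \<beta> * d powi m * val F i j s t"
proof -
  obtain V d1 e1 d2 e2 P Q where V: "openin (ktop X) V" "chart i j s t \<in> V"
    and de: "int d1 - int d2 = \<beta>" "int e1 - int e2 = m"
    and PQ: "P \<in> bihpoly (n + n + 1) 1 d1 e1" "Q \<in> bihpoly (n + n + 1) 1 d2 e2"
    and eq: "\<And>q v w. q \<in> V \<Longrightarrow> v \<in> q \<Longrightarrow> w \<in> scroll_proj n n q \<Longrightarrow> Q v w \<noteq> 0 \<and> F v w = P v w / Q v w"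
    using sec_localE[OF F U] by metis
  have v: "(\<lambda>k. c * smc i j s t k) \<in> chart i j s t"
    unfolding hclass_scale_chart[OF c, symmetric] by (rule hclass_self)
  have w: "(\<lambda>k. d * aff i s k) \<in> scroll_proj n n (chart i j s t)"
    unfolding scroll_proj_chart using hclass_scale[OF d] hclass_self by metis
  have "F (\<lambda>k. c * smc i j s t k) (\<lambda>k. d * aff i s k) =
      (c ^ d1 / c ^ d2) * (d ^ e1 / d ^ e2) * (P (smc i j s t) (aff i s) / Q (smc i j s t) (aff i s))"
    using eq[OF V(2) v w] unfolding bihpoly_scale[OF PQ(1)] bihpoly_scale[OF PQ(2)] by simp
  then show ?thesis
    using eq[OF V(2) smc_in_chart aff_in_proj]
    by (simp add: val_def power_int_quotient[OF c de(1)] power_int_quotient[OF d de(2)])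
qed

text \<open>The transition function of the line bundle: the embedding has degree \<open>n\<close> in
  w, so each H contributes s^n and each f contributes s.\<close>

lemma sec_flip_fst:
  assumes F: "F \<in> sec \<beta> m U" and U: "chart i j s t \<in> U" and s: "s * s' = 1"
  shows "val F i j s t = s powi (int n * \<beta> + m) * val F (\<not> i) j s' t"
proof -
  have s0: "s \<noteq> 0" "s ^ n \<noteq> 0" using s by auto
  have "val F i j s t = F (\<lambda>k. s ^ n * smc (\<not> i) j s' t k) (\<lambda>k. s * aff (\<not> i) s' k)"
    unfolding val_def smc_flip_fst[OF s, of i j t] aff_flip[OF s, of i] ..
  also have "\<dots> = (s ^ n) powi \<beta> * s powi m * val F (\<not> i) j s' t"
    using U s0 unfolding chart_flip_fst[OF s] by (intro sec_scale[OF F])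
  also have "(s ^ n) powi \<beta> * s powi m = s powi (int n * \<beta> + m)"
    using s0 by (simp add: power_int_add power_int_mult)
  finally show ?thesis .
qed

lemma sec_flip_snd:
  assumes F: "F \<in> sec \<beta> m U" and U: "chart i j s t \<in> U" and t: "t * t' = 1"
  shows "val F i j s t = t powi \<beta> * val F i (\<not> j) s t'"
proof -
  have t0: "t \<noteq> 0" using t by auto
  have "val F i j s t = F (\<lambda>k. t * smc i (\<not> j) s t' k) (\<lambda>k. 1 * aff i s k)"
    unfolding val_def smc_flip_snd[OF t, of i j s] by simp
  also have "\<dots> = t powi \<beta> * 1 powi m * val F i (\<not> j) s t'"
    using U t0 unfolding chart_flip_snd[OF t] by (intro sec_scale[OF F]) auto
  finally show ?thesis by simp
qed

lemma sec_eqI: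
  assumes U: "openin (ktop X) U" and F: "F \<in> sec \<beta> m U" and G: "G \<in> sec \<beta> m U"
    and eq: "\<And>i j s t. chart i j s t \<in> U \<Longrightarrow> val F i j s t = val G i j s t"
  shows "F = G"
proof (intro ext)
  fix v w
  show "F v w = G v w"
  proof (cases "hclass v \<in> U \<and> w \<in> scroll_proj n n (hclass v)")
    case True
    then obtain i j s t c d where c: "hclass v = chart i j s t" "c \<noteq> 0" "d \<noteq> 0"
      "v = (\<lambda>k. c * smc i j s t k)" "w = (\<lambda>k. d * aff i s k)"
      using sec_pairE[OF U] by metis
    have cU: "chart i j s t \<in> U" using True c(1) by simp
    show ?thesis unfolding c(4,5)
      by (simp add: sec_scale[OF F cU c(2,3)] sec_scale[OF G cU c(2,3)] eq[OF cU])
  qed (simp add: sec_zero[OF F] sec_zero[OF G])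
qed

text \<open>The monomial in the coordinates that are 1 on chart (i, j) trivialises the line bundle
  over this chart, and \<open>r\<close> is the coefficient with respect to it.\<close>

definition gen :: "bool \<Rightarrow> bool \<Rightarrow> int \<Rightarrow> int \<Rightarrow> 'k::field ppoint set \<Rightarrow> ('k ppoint \<Rightarrow> 'k) \<Rightarrow>
    (nat \<Rightarrow> 'k) \<Rightarrow> (nat \<Rightarrow> 'k) \<Rightarrow> 'k" where
  "gen i j \<beta> m V r v w = (if hclass v \<in> V \<and> w \<in> scroll_proj n n (hclass v)
     then r (hclass v) * v (idx i j) powi \<beta> * w (of_bool i) powi m else 0)"

lemma val_gen: "chart i j s t \<in> V \<Longrightarrow> val (gen i j \<beta> m V r) i j s t = r (chart i j s t)"
  using aff_in_proj[of i s j t]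
  by (simp add: val_def gen_def flip: chart_def)

lemma power_int_nat_quotient:
  "(x::'k::field) \<noteq> 0 \<Longrightarrow> x powi \<beta> = x ^ nat \<beta> / x ^ nat (- \<beta>)"
  by (cases "\<beta> \<ge> 0") (auto simp: power_int_def field_simps)

lemma gen_sec:
  fixes r :: "'k::field ppoint \<Rightarrow> 'k"
  assumes V: "openin (ktop X) V" "V \<subseteq> dom i j" and r: "r \<in> kreg X V"
  shows "gen i j \<beta> m V r \<in> sec \<beta> m V"
  unfolding sec_iff_local
proof (intro conjI allI impI ballI)
  fix v w assume "\<not> (hclass v \<in> V \<and> w \<in> scroll_proj n n (hclass v))"
  then show "gen i j \<beta> m V r v w = 0" by (auto simp: gen_def)
next
  fix p assume p: "p \<in> V"
  have "\<forall>p\<in>V. \<exists>W. openin (ktop X) W \<and> p \<in> W \<and> W \<subseteq> V \<and>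
          (\<exists>d. \<exists>P\<in>hpoly (n + n + 1) d. \<exists>Q\<in>hpoly (n + n + 1) d.
            \<forall>q\<in>W. \<forall>v\<in>q. Q v \<noteq> 0 \<and> r q = P v / Q v)"
    using r unfolding ktop_X by (simp add: scroll_def pvariety_def)
  from bspec[OF this p] obtain W d P Q where W: "openin (ktop X) W" "p \<in> W" "W \<subseteq> V"
    and PQ: "P \<in> hpoly (n + n + 1) d" "Q \<in> hpoly (n + n + 1) d"
    and req: "\<forall>q\<in>W. \<forall>v\<in>q. Q v \<noteq> 0 \<and> r q = P v / Q v"
    by (elim exE conjE bexE) (rule that)
  \<comment> \<open>One of \<open>nat \<beta>\<close> and \<open>nat (- \<beta>)\<close> is 0, so
    twists of either sign are written as quotients of forms; the same is done for
    \<open>m\<close>.\<close>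
  let ?P = "\<lambda>v w. (P v * v (idx i j) ^ nat \<beta>) * w (of_bool i) ^ nat m"
  let ?Q = "\<lambda>v w. (Q v * v (idx i j) ^ nat (- \<beta>)) * w (of_bool i) ^ nat (- m)"
  have b: "of_bool i \<le> (1::nat)" by simp
  have P: "?P \<in> bihpoly (n + n + 1) 1 (d + nat \<beta>) (nat m)"
    by (intro bihpoly_product hpoly_mult hpoly_var_power PQ idx_le b)
  have Q: "?Q \<in> bihpoly (n + n + 1) 1 (d + nat (- \<beta>)) (nat (- m))"
    by (intro bihpoly_product hpoly_mult hpoly_var_power PQ idx_le b)
  have eq: "?Q v w \<noteq> 0 \<and> gen i j \<beta> m V r v w = ?P v w / ?Q v w"
    if q: "q \<in> W" "v \<in> q" "w \<in> scroll_proj n n q" for q v w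
  proof -
    obtain s t where qc: "q = chart i j s t" using q(1) W(3) V(2) by (blast elim: in_domE)
    obtain c where c: "c \<noteq> 0" "v = (\<lambda>k. c * smc i j s t k)"
      using q(2) unfolding qc chart_def by (rule in_hclassE)
    obtain d where d: "d \<noteq> 0" "w = (\<lambda>k. d * aff i s k)"
      using q(3) unfolding qc scroll_proj_chart by (rule in_hclassE)
    have v0: "v (idx i j) \<noteq> 0" "w (of_bool i) \<noteq> 0" using c d by simp_all
    have h: "hclass v = q" using hclass_scale_chart[OF c(1)] c(2) qc by simp
    have Qv: "Q v \<noteq> 0" "r q = P v / Q v" using req q by blast+
    have "gen i j \<beta> m V r v w = P v / Q v * v (idx i j) powi \<beta> * w (of_bool i) powi m"
      using q W(3) h Qv(2) by (auto simp: gen_def)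
    then show ?thesis using v0 Qv(1)
      by (simp add: power_int_nat_quotient[OF v0(1)] power_int_nat_quotient[OF v0(2)])
  qed
  have "int (d + nat \<beta>) - int (d + nat (- \<beta>)) = \<beta>" "int (nat m) - int (nat (- m)) = m" by auto
  then show "\<exists>W. openin (ktop X) W \<and> p \<in> W \<and> W \<subseteq> V \<and>
      (\<exists>d e d' e'. int d - int d' = \<beta> \<and> int e - int e' = m \<and>
        (\<exists>P\<in>bihpoly (n + n + 1) 1 d e. \<exists>Q\<in>bihpoly (n + n + 1) 1 d' e'.
          \<forall>q\<in>W. \<forall>v\<in>q. \<forall>w\<in>scroll_proj n n q. Q v w \<noteq> 0 \<and> gen i j \<beta> m V r v w = P v w / Q v w))"
    by (intro exI[of _ W] exI[of _ "d + nat \<beta>"] exI[of _ "nat m"] exI[of _ "d + nat (- \<beta>)"]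
        exI[of _ "nat (- m)"] conjI W bexI[OF bexI[OF _ Q] P] ballI eq)
qed

text \<open>Being a section is a local property; this serves the criterion \<open>secI\<close> and
  the gluing in \<open>psi_surj\<close>.\<close>

lemma sec_localI:
  assumes zero: "\<And>v w. \<not> (hclass v \<in> U \<and> w \<in> scroll_proj n n (hclass v)) \<Longrightarrow> F v w = 0"
    and loc: "\<And>p. p \<in> U \<Longrightarrow> \<exists>W G. openin (ktop X) W \<and> p \<in> W \<and> W \<subseteq> U \<and> G \<in> sec \<beta> m W \<and>
      (\<forall>v w. hclass v \<in> W \<longrightarrow> w \<in> scroll_proj n n (hclass v) \<longrightarrow> F v w = G v w)"
  shows "F \<in> sec \<beta> m U"
  unfolding sec_iff_local
proof (intro conjI allI impI ballI)
  fix p assume p: "p \<in> U"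
  obtain W G where W: "openin (ktop X) W" "p \<in> W" "W \<subseteq> U" "G \<in> sec \<beta> m W"
    and eq: "\<forall>v w. hclass v \<in> W \<longrightarrow> w \<in> scroll_proj n n (hclass v) \<longrightarrow> F v w = G v w"
    using loc[OF p] by (elim exE conjE) (rule that)
  obtain V d d' e e' P Q where V: "openin (ktop X) V" "p \<in> V" "V \<subseteq> W"
    "int d - int d' = \<beta>" "int e - int e' = m"
    and PQ: "P \<in> bihpoly (n + n + 1) 1 d e" "Q \<in> bihpoly (n + n + 1) 1 d' e'"
    and eq2: "\<And>q v w. q \<in> V \<Longrightarrow> v \<in> q \<Longrightarrow> w \<in> scroll_proj n n q \<Longrightarrow> Q v w \<noteq> 0 \<and> G v w = P v w / Q v w"
    using sec_localE[OF W(4,2)] by metis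
  have VU: "V \<subseteq> U" using V W by blast
  have eq3: "Q v w \<noteq> 0 \<and> F v w = P v w / Q v w"
    if q: "q \<in> V" "v \<in> q" "w \<in> scroll_proj n n q" for q v w
  proof -
    obtain i j s t where qc: "q = chart i j s t" using openE[OF V(1) q(1)] .
    obtain c where c: "c \<noteq> 0" "v = (\<lambda>k. c * smc i j s t k)"
      using q(2) unfolding qc chart_def by (rule in_hclassE)
    have h: "hclass v = q" using hclass_scale_chart[OF c(1)] c(2) qc by simp
    then have "F v w = G v w" using eq q V(3) by blast
    then show ?thesis using eq2[OF q] by simp
  qed
  show "\<exists>W. openin (ktop X) W \<and> p \<in> W \<and> W \<subseteq> U \<and>
      (\<exists>d e d' e'. int d - int d' = \<beta> \<and> int e - int e' = m \<and>
        (\<exists>P\<in>bihpoly (n + n + 1) 1 d e. \<exists>Q\<in>bihpoly (n + n + 1) 1 d' e'.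
          \<forall>q\<in>W. \<forall>v\<in>q. \<forall>w\<in>scroll_proj n n q. Q v w \<noteq> 0 \<and> F v w = P v w / Q v w))"
    by (intro exI[of _ V] exI[of _ d] exI[of _ e] exI[of _ d'] exI[of _ e'] conjI V VU
        bexI[OF bexI[OF _ PQ(2)] PQ(1)] ballI eq3)
qed (rule zero)

text \<open>Near a point, homogeneity reduces \<open>F\<close> to the values \<open>val F\<close> on
  one chart, and \<open>gen\<close> realises these by a section.\<close>

lemma secI:
  fixes F :: "(nat \<Rightarrow> 'k::field) \<Rightarrow> (nat \<Rightarrow> 'k) \<Rightarrow> 'k"
  assumes U: "openin (ktop X) U"
    and zero: "\<And>v w. \<not> (hclass v \<in> U \<and> w \<in> scroll_proj n n (hclass v)) \<Longrightarrow> F v w = 0"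
    and hom: "\<And>i j s t c d. chart i j s t \<in> U \<Longrightarrow> c \<noteq> 0 \<Longrightarrow> d \<noteq> 0 \<Longrightarrow>
      F (\<lambda>k. c * smc i j s t k) (\<lambda>k. d * aff i s k) = c powi \<beta> * d powi m * val F i j s t"
    and reg: "\<And>i j s t. chart i j s t \<in> U \<Longrightarrow> reg2 (val F i j) s t"
  shows "F \<in> sec \<beta> m U"
proof (rule sec_localI[OF zero])
  fix p assume p: "p \<in> U"
  obtain i j s t where pc: "p = chart i j s t" using openE[OF U p] .
  have c: "chart i j s t \<in> U" using p pc by simp
  obtain W where W: "openin (ktop X) W" "chart i j s t \<in> W" "W \<subseteq> dom i j"
    "cut W (\<lambda>q. val F i j (sig i q) (tau j q)) \<in> kreg X W"
    and WU: "\<And>s t. chart i j s t \<in> W \<Longrightarrow> chart i j s t \<in> U"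
    using reg2_section[OF reg[OF c] open_near[OF U c]] by blast
  define r where "r = cut W (\<lambda>q. val F i j (sig i q) (tau j q))"
  have r: "r (chart i j s t) = val F i j s t" if "chart i j s t \<in> W" for s t
    using that by (simp add: r_def)
  have G: "gen i j \<beta> m W r \<in> sec \<beta> m W" using gen_sec[OF W(1,3)] W(4) by (simp add: r_def)
  have eq: "F v w = gen i j \<beta> m W r v w" if h: "hclass v \<in> W" "w \<in> scroll_proj n n (hclass v)" for v w
  proof -
    have "hclass v \<in> dom i j" using h(1) W(3) by blast
    then obtain s t where qc: "hclass v = chart i j s t" by (rule in_domE)
    have cW: "chart i j s t \<in> W" using h(1) qc by simp
    obtain c where c: "c \<noteq> 0" "v = (\<lambda>k. c * smc i j s t k)"
      using qc unfolding chart_def by (rule hclass_eqE)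
    obtain d where d: "d \<noteq> 0" "w = (\<lambda>k. d * aff i s k)"
      using h(2) unfolding qc scroll_proj_chart by (rule in_hclassE)
    show ?thesis
      unfolding c(2) d(2) hom[OF WU[OF cW] c(1) d(1)] sec_scale[OF G cW c(1) d(1)] val_gen[OF cW] r[OF cW] ..
  qed
  have "W \<subseteq> U" using W(3) WU by (blast elim: in_domE)
  then show "\<exists>W G. openin (ktop X) W \<and> p \<in> W \<and> W \<subseteq> U \<and> G \<in> sec \<beta> m W \<and>
      (\<forall>v w. hclass v \<in> W \<longrightarrow> w \<in> scroll_proj n n (hclass v) \<longrightarrow> F v w = G v w)"
    using W(1,2) pc G eq by blast
qed

lemma sec_add:
  assumes U: "openin (ktop X) U" and F: "F \<in> sec \<beta> m U" and G: "G \<in> sec \<beta> m U"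
  shows "(\<lambda>v w. F v w + G v w) \<in> sec \<beta> m U"
proof (rule secI[OF U])
  show "reg2 (val (\<lambda>v w. F v w + G v w) i j) s t" if "chart i j s t \<in> U" for i j s t
    using reg2_add[OF sec_reg2[OF F that] sec_reg2[OF G that]]
    unfolding val_def .
qed (simp_all add: sec_zero[OF F] sec_zero[OF G] sec_scale[OF F] sec_scale[OF G] val_def distrib_left)

lemma sec_smult:
  assumes U: "openin (ktop X) U" and F: "F \<in> sec \<beta> m U" and r: "r \<in> kreg X U"
  shows "(\<lambda>v w. r (hclass v) * F v w) \<in> sec \<beta> m U"
proof (rule secI[OF U])
  show "reg2 (val (\<lambda>v w. r (hclass v) * F v w) i j) s t" if "chart i j s t \<in> U" for i j s t
    using reg2_mult[OF kreg_reg2[OF r that] sec_reg2[OF F that]]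
    unfolding val_def chart_def .
qed (simp_all add: sec_zero[OF F] sec_scale[OF F] val_def hclass_scale_chart flip: chart_def)

lemma sec_restrict:
  fixes F :: "(nat \<Rightarrow> 'k::field) \<Rightarrow> (nat \<Rightarrow> 'k) \<Rightarrow> 'k"
  assumes V: "openin (ktop X) V" "V \<subseteq> U" and F: "F \<in> sec \<beta> m U"
  shows "(\<lambda>v w. if hclass v \<in> V then F v w else 0) \<in> sec \<beta> m V"
proof (rule secI[OF V(1)])
  fix i j s t assume c: "chart i j s t \<in> V"
  then have "chart i j s t \<in> U" using V(2) by blast
  from sec_reg2[OF F this] show "reg2 (val (\<lambda>v w. if hclass v \<in> V then F v w else 0) i j) s t"
    by (rule reg2_cong) (rule near_mono[OF open_near[OF V(1) c]], simp add: val_def flip: chart_def)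
next
  fix v w assume "\<not> (hclass v \<in> V \<and> w \<in> scroll_proj n n (hclass v))"
  then show "(if hclass v \<in> V then F v w else 0) = 0" using sec_zero[OF F] by auto
next
  fix i j s t c d assume "chart i j s t \<in> V" "c \<noteq> (0::'k)" "d \<noteq> (0::'k)"
  then show "(if hclass (\<lambda>k. c * smc i j s t k) \<in> V
        then F (\<lambda>k. c * smc i j s t k) (\<lambda>k. d * aff i s k) else 0) =
      c powi \<beta> * d powi m * val (\<lambda>v w. if hclass v \<in> V then F v w else 0) i j s t"
    using V(2) sec_scale[OF F, of i j s t c d]
    by (auto simp: hclass_scale_chart val_def simp flip: chart_def)
qed

lemma val_restrict:
  "chart i j s t \<in> V \<Longrightarrow> val (\<lambda>v w. if hclass v \<in> V then F v w else 0) i j s t = val F i j s t"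
  by (simp add: val_def flip: chart_def)

lemma val_smult: "val (\<lambda>v w. r (hclass v) * F v w) i j s t = r (chart i j s t) * val F i j s t"
  by (simp add: val_def flip: chart_def)

lemma val_add: "val (\<lambda>v w. F v w + G v w) i j s t = val F i j s t + val G i j s t"
  by (simp add: val_def)

end

section \<open>The isomorphism\<close>

text \<open>The exponents a - 2 of the section, - a of 1 / P and 2 of ds add up to 0, and only the
  sign of ds remains. At a zero of P both sides are 0 by the convention for division.\<close>

lemma flip_algebra:
  fixes s :: "'k::field"
  assumes "s \<noteq> 0"
  shows "(s powi (int a - 2) * V) / (s ^ a * p) * (- s\<^sup>2 * d) = - (V / p * d)"
proof -
  have "s powi (int a - 2) = s ^ a / s\<^sup>2"
    using power_int_diff[of s "int a" 2] assms by simp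
  then show ?thesis using assms by (cases "p = 0") (simp_all add: field_simps)
qed

text \<open>The remaining sign: w 0 dw 1 - w 1 dw 0 is ds where w = (1, s) and - ds where w = (s,
  1).\<close>

definition sgb :: "bool \<Rightarrow> 'k::field" where "sgb i = (if i then - 1 else 1)"

lemma sgb_simps [simp]: "sgb (\<not> i) = - sgb i" "sgb i * sgb i = 1" "sgb i * (sgb i * x) = x" "sgb i \<noteq> 0"
  by (auto simp: sgb_def)

context log_scroll
begin

abbreviation secF :: "'k ppoint set \<Rightarrow> ((nat \<Rightarrow> 'k) \<Rightarrow> (nat \<Rightarrow> 'k) \<Rightarrow> 'k) set" where
  "secF \<equiv> sec 0 (int a - 2)"

text \<open>The sheaf O((b - 2) (H - n f)): the second twist cancels the factor s^(n (b - 2)) of the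
  first, so that \<open>val G\<close> is unchanged when the chart of the first factor is
  flipped.\<close>

abbreviation secG :: "'k ppoint set \<Rightarrow> ((nat \<Rightarrow> 'k) \<Rightarrow> (nat \<Rightarrow> 'k) \<Rightarrow> 'k) set" where
  "secG \<equiv> sec (int b - 2) (- (int n * (int b - 2)))"

text \<open>
  On the chart with coordinates \<open>s = w 1 / w 0\<close>, \<open>t = y 1 / y 0\<close>, this is \<open>F\<close> times
  \<open>(w 0 dw 1 - w 1 dw 0) / P\<close> plus \<open>G\<close> times \<open>(y 0 dy 1 - y 1 dy 0) / Q\<close>, where \<open>P = 0\<close> and \<open>Q = 0\<close>
  are the two unions of rulings.  On the other charts the signs \<open>sgb\<close> come in.
\<close>

definition frm :: "((nat \<Rightarrow> 'k) \<Rightarrow> (nat \<Rightarrow> 'k) \<Rightarrow> 'k) \<Rightarrow> ((nat \<Rightarrow> 'k) \<Rightarrow> (nat \<Rightarrow> 'k) \<Rightarrow> 'k) \<Rightarrow>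
    bool \<Rightarrow> bool \<Rightarrow> 'k \<Rightarrow> 'k \<Rightarrow> (('k ppoint \<Rightarrow> 'k) \<Rightarrow> 'k) \<Rightarrow> 'k" where
  "frm F G i j s t \<delta> = sgb i * (val F i j s t / poly (pp i) s * \<delta> (sig i))
    + sgb j * (val G i j s t / poly (qq j) t * \<delta> (tau j))"

lemma frm_flip_fst:
  assumes F: "F \<in> secF U" and G: "G \<in> secG U" and U: "chart i j s t \<in> U"
    and s: "s * s' = 1" and \<delta>: "\<delta> \<in> tangent X (chart i j s t)"
  shows "frm F G i j s t \<delta> = frm F G (\<not> i) j s' t \<delta>"
proof -
  have s0: "s \<noteq> 0" using s by auto
  show ?thesis
    using flip_algebra[OF s0, of a "val F (\<not> i) j s' t" "poly (pp (\<not> i)) s'" "\<delta> (sig (\<not> i))"]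
    unfolding frm_def tangent_flip_fst[OF \<delta> s] flip_pp[OF s] sec_flip_fst[OF F U s] sec_flip_fst[OF G U s]
    by simp
qed

lemma frm_flip_snd:
  assumes F: "F \<in> secF U" and G: "G \<in> secG U" and U: "chart i j s t \<in> U"
    and t: "t * t' = 1" and \<delta>: "\<delta> \<in> tangent X (chart i j s t)"
  shows "frm F G i j s t \<delta> = frm F G i (\<not> j) s t' \<delta>"
proof -
  have t0: "t \<noteq> 0" using t by auto
  show ?thesis
    using flip_algebra[OF t0, of b "val G i (\<not> j) s t'" "poly (qq (\<not> j)) t'" "\<delta> (tau (\<not> j))"]
    unfolding frm_def tangent_flip_snd[OF \<delta> t] flip_qq[OF t] sec_flip_snd[OF F U t] sec_flip_snd[OF G U t]
    by simp
qed

text \<open>The charts are changed one factor at a time, through chart (i', j), which contains the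
  point as well.\<close>

lemma frm_unique:
  assumes F: "F \<in> secF U" and G: "G \<in> secG U" and U: "chart i j s t \<in> U"
    and \<delta>: "\<delta> \<in> tangent X (chart i j s t)" and eq: "chart i j s t = chart i' j' s' t'"
  shows "frm F G i j s t \<delta> = frm F G i' j' s' t' \<delta>"
proof -
  have 1: "chart i j s t = chart i' j s' t \<and> frm F G i j s t \<delta> = frm F G i' j s' t \<delta>"
  proof (cases "i' = i")
    case True
    then show ?thesis using eq chart_fst_eq by blast
  next
    case False
    then have i: "i' = (\<not> i)" by blast
    have s: "s * s' = 1" using eq chart_fst_eq_flip unfolding i by blast
    show ?thesis unfolding i using chart_flip_fst[OF s] frm_flip_fst[OF F G U s \<delta>] by blast
  qed
  have U': "chart i' j s' t \<in> U" and \<delta>': "\<delta> \<in> tangent X (chart i' j s' t)"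
    using U \<delta> 1 by auto
  have "frm F G i' j s' t \<delta> = frm F G i' j' s' t' \<delta>"
  proof (cases "j' = j")
    case True
    then show ?thesis using eq chart_snd_eq by blast
  next
    case False
    then have j: "j' = (\<not> j)" by blast
    have t: "t * t' = 1" using eq chart_snd_eq_flip unfolding j by blast
    show ?thesis unfolding j by (rule frm_flip_snd[OF F G U' t \<delta>'])
  qed
  with 1 show ?thesis by simp
qed

text \<open>The definite description is meaningful for sections of the two sheaves, because the
  value is then the same on every chart (\<open>frm_unique\<close>).\<close>

definition psi :: "'k ppoint set \<Rightarrow> ((nat \<Rightarrow> 'k) \<Rightarrow> (nat \<Rightarrow> 'k) \<Rightarrow> 'k) \<Rightarrow>
    ((nat \<Rightarrow> 'k) \<Rightarrow> (nat \<Rightarrow> 'k) \<Rightarrow> 'k) \<Rightarrow> ('k ppoint, 'k) form1" where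
  "psi U F G p \<delta> = (if p \<in> U - S \<and> \<delta> \<in> tangent X p
     then THE x. \<exists>i j s t. p = chart i j s t \<and> x = frm F G i j s t \<delta> else 0)"

lemma psi_chart:
  assumes F: "F \<in> secF U" and G: "G \<in> secG U" and U: "chart i j s t \<in> U - S"
    and \<delta>: "\<delta> \<in> tangent X (chart i j s t)"
  shows "psi U F G (chart i j s t) \<delta> = frm F G i j s t \<delta>"
proof -
  have "(THE x. \<exists>i' j' s' t'. chart i j s t = chart i' j' s' t' \<and> x = frm F G i' j' s' t' \<delta>)
      = frm F G i j s t \<delta>"
  proof (rule the_equality)
    fix x assume "\<exists>i' j' s' t'. chart i j s t = chart i' j' s' t' \<and> x = frm F G i' j' s' t' \<delta>"
    then obtain i' j' s' t' where "chart i j s t = chart i' j' s' t'" "x = frm F G i' j' s' t' \<delta>"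
      by blast
    moreover have "chart i j s t \<in> U" using U by blast
    ultimately show "x = frm F G i j s t \<delta>" using frm_unique[OF F G _ \<delta>] by metis
  qed blast
  then show ?thesis using U \<delta> by (simp add: psi_def)
qed

lemma psi_outside: "\<not> (p \<in> U - S \<and> \<delta> \<in> tangent X p) \<Longrightarrow> psi U F G p \<delta> = 0"
  unfolding psi_def by (rule if_not_P)

text \<open>Since all charts give the same value, one chart at each point off \<open>S\<close>
  suffices for the comparison.\<close>

lemma psi_eqI:
  assumes U: "openin (ktop X) U"
    and F: "F \<in> secF U" and G: "G \<in> secG U"
    and zero: "\<And>p \<delta>. \<not> (p \<in> U - S \<and> \<delta> \<in> tangent X p) \<Longrightarrow> \<omega> p \<delta> = 0"
    and eq: "\<And>p \<delta>. p \<in> U - S \<Longrightarrow> \<delta> \<in> tangent X p \<Longrightarrow>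
      \<exists>i j s t. p = chart i j s t \<and> frm F G i j s t \<delta> = \<omega> p \<delta>"
  shows "psi U F G = \<omega>"
proof (intro ext)
  fix p \<delta>
  show "psi U F G p \<delta> = \<omega> p \<delta>"
  proof (cases "p \<in> U - S \<and> \<delta> \<in> tangent X p")
    case True
    then obtain i j s t where "p = chart i j s t" "frm F G i j s t \<delta> = \<omega> p \<delta>" using eq by blast
    then show ?thesis using psi_chart[OF F G, of i j s t \<delta>] True by simp
  next
    case False
    show ?thesis unfolding psi_outside[OF False] zero[OF False] ..
  qed
qed

lemma psi_log_form:
  assumes U: "openin (ktop X) U" and F: "F \<in> secF U" and G: "G \<in> secG U"
  shows "psi U F G \<in> log_form1 X S U"
proof (rule log_form1I[OF psi_outside])
  fix p assume p: "p \<in> U"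
  obtain i j s t where pc: "p = chart i j s t" using openE[OF U p] .
  let ?V = "U \<inter> dom i j"
  have V: "openin (ktop X) ?V" "?V \<subseteq> dom i j" using U open_dom by auto
  let ?f = "cut ?V (\<lambda>q. sgb i * val F i j (sig i q) (tau j q))"
  let ?g = "cut ?V (\<lambda>q. sgb j * val G i j (sig i q) (tau j q))"
  have fg: "?f \<in> kreg X ?V" "?g \<in> kreg X ?V"
    by (rule kreg_cutI[OF V], simp, intro reg2_mult[OF reg2_const] sec_reg2[OF F] sec_reg2[OF G], simp)+
  have PS: "psi U F G q \<delta> = ?f q / poly (pp i) (sig i q) * \<delta> (sig i) + ?g q / poly (qq j) (tau j q) * \<delta> (tau j)"
    if q: "q \<in> ?V - S" and \<delta>: "\<delta> \<in> tangent X q" for q \<delta>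
  proof -
    obtain s t where qc: "q = chart i j s t" using q by (blast elim: in_domE)
    show ?thesis using psi_chart[OF F G, of i j s t \<delta>] q \<delta> unfolding qc by (simp add: frm_def mult.assoc)
  qed
  have E: "openin (ktop X) ?V \<and> p \<in> ?V \<and> ?V \<subseteq> U \<and> ?V \<subseteq> dom i j \<and>
      ?f \<in> kreg X ?V \<and> ?g \<in> kreg X ?V \<and> (\<forall>q\<in>?V - S. \<forall>\<delta>\<in>tangent X q.
        psi U F G q \<delta> = ?f q / poly (pp i) (sig i q) * \<delta> (sig i) + ?g q / poly (qq j) (tau j q) * \<delta> (tau j))"
    by (intro conjI ballI PS V fg) (use p pc in auto)
  show "\<exists>V i j f g. openin (ktop X) V \<and> p \<in> V \<and> V \<subseteq> U \<and> V \<subseteq> dom i j \<and>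
      f \<in> kreg X V \<and> g \<in> kreg X V \<and> (\<forall>q\<in>V - S. \<forall>\<delta>\<in>tangent X q.
        psi U F G q \<delta> = f q / poly (pp i) (sig i q) * \<delta> (sig i) + g q / poly (qq j) (tau j q) * \<delta> (tau j))"
    by (rule exI, rule exI, rule exI, rule exI, rule exI, rule E)
qed

text \<open>Off \<open>S\<close> the vectors d/ds and d/dt recover the values of both sections; by
  density these agree across \<open>S\<close> too.\<close>

lemma psi_inj:
  assumes U: "openin (ktop X) U" and F: "F \<in> secF U" "F' \<in> secF U" and G: "G \<in> secG U" "G' \<in> secG U"
    and eq: "psi U F G = psi U F' G'"
  shows "F = F'" "G = G'"
proof -
  have off: "val F i j s t = val F' i j s t \<and> val G i j s t = val G' i j s t"
    if c: "chart i j s t \<in> U" and h: "ev (H i j) s t \<noteq> 0" for i j s t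
  proof -
    have c': "chart i j s t \<in> U - S" using c h by auto
    have "frm F G i j s t \<delta> = frm F' G' i j s t \<delta>" if "\<delta> \<in> tangent X (chart i j s t)" for \<delta>
      using psi_chart[OF F(1) G(1) c' that] psi_chart[OF F(2) G(2) c' that] eq by simp
    from this[OF vec_tangent[OF derivation_dS]] this[OF vec_tangent[OF derivation_dT]]
    show ?thesis using h by (auto simp: frm_def)
  qed
  have 1: "near s t (\<lambda>s t. chart i j s t \<in> U)" if "chart i j s t \<in> U" for i j s t
    by (rule open_near[OF U that])
  show "F = F'"
  proof (rule sec_eqI[OF U F])
    fix i j s t assume c: "chart i j s t \<in> U"
    have "near s t (\<lambda>s t. val F i j s t = val F' i j s t)"
      by (rule reg2_density_eq[OF sec_reg2[OF F(1) c] sec_reg2[OF F(2) c] H_nonzero[of i j]],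
          rule near_mono[OF 1[OF c]]) (use off in blast)
    then show "val F i j s t = val F' i j s t" by (rule near_here)
  qed
  show "G = G'"
  proof (rule sec_eqI[OF U G])
    fix i j s t assume c: "chart i j s t \<in> U"
    have "near s t (\<lambda>s t. val G i j s t = val G' i j s t)"
      by (rule reg2_density_eq[OF sec_reg2[OF G(1) c] sec_reg2[OF G(2) c] H_nonzero[of i j]],
          rule near_mono[OF 1[OF c]]) (use off in blast)
    then show "val G i j s t = val G' i j s t" by (rule near_here)
  qed
qed

section \<open>Compatibility of \<open>psi\<close> with restriction, sums and scalars\<close>

abbreviation rst :: "'k ppoint set \<Rightarrow> ((nat \<Rightarrow> 'k) \<Rightarrow> (nat \<Rightarrow> 'k) \<Rightarrow> 'k) \<Rightarrow> (nat \<Rightarrow> 'k) \<Rightarrow> (nat \<Rightarrow> 'k) \<Rightarrow> 'k" where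
  "rst V F \<equiv> (\<lambda>v w. if hclass v \<in> V then F v w else 0)"

lemma psi_restrict:
  assumes U: "openin (ktop X) U" and V: "openin (ktop X) V" "V \<subseteq> U" and F: "F \<in> secF U" and G: "G \<in> secG U"
  shows "psi V (rst V F) (rst V G) = (\<lambda>p \<delta>. if p \<in> V then psi U F G p \<delta> else 0)"
proof (rule psi_eqI[OF V(1) sec_restrict[OF V F] sec_restrict[OF V G]])
  fix p \<delta> assume p: "p \<in> V - S" and \<delta>: "\<delta> \<in> tangent X p"
  have pV: "p \<in> V" using p by blast
  obtain i j s t where pc: "p = chart i j s t" using openE[OF V(1) pV] .
  have "frm (rst V F) (rst V G) i j s t \<delta> = psi U F G p \<delta>"
    using p \<delta> V(2) psi_chart[OF F G, of i j s t \<delta>] unfolding pc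
    by (auto simp: frm_def val_restrict)
  then show "\<exists>i j s t. p = chart i j s t \<and>
      frm (rst V F) (rst V G) i j s t \<delta> = (if p \<in> V then psi U F G p \<delta> else 0)"
    using p pc by auto
next
  fix p \<delta> assume "\<not> (p \<in> V - S \<and> \<delta> \<in> tangent X p)"
  then have "\<not> (p \<in> U - S \<and> \<delta> \<in> tangent X p) \<or> p \<notin> V" by blast
  then show "(if p \<in> V then psi U F G p \<delta> else 0) = 0" using psi_outside by auto
qed

lemma psi_add:
  assumes U: "openin (ktop X) U" and F: "F \<in> secF U" "F' \<in> secF U" and G: "G \<in> secG U" "G' \<in> secG U"
  shows "psi U (\<lambda>v w. F v w + F' v w) (\<lambda>v w. G v w + G' v w) =
    (\<lambda>p \<delta>. psi U F G p \<delta> + psi U F' G' p \<delta>)"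
proof (rule psi_eqI[OF U sec_add[OF U F] sec_add[OF U G]])
  fix p \<delta> assume p: "p \<in> U - S" and \<delta>: "\<delta> \<in> tangent X p"
  have pU: "p \<in> U" using p by blast
  obtain i j s t where pc: "p = chart i j s t" using openE[OF U pU] .
  have "frm (\<lambda>v w. F v w + F' v w) (\<lambda>v w. G v w + G' v w) i j s t \<delta> = psi U F G p \<delta> + psi U F' G' p \<delta>"
    using p \<delta> psi_chart[OF F(1) G(1), of i j s t \<delta>] psi_chart[OF F(2) G(2), of i j s t \<delta>] unfolding pc
    by (simp add: frm_def val_add add_divide_distrib algebra_simps)
  then show "\<exists>i j s t. p = chart i j s t \<and> frm (\<lambda>v w. F v w + F' v w) (\<lambda>v w. G v w + G' v w) i j s t \<delta> =
      psi U F G p \<delta> + psi U F' G' p \<delta>" using pc by blast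
next
  fix p \<delta> assume n: "\<not> (p \<in> U - S \<and> \<delta> \<in> tangent X p)"
  show "psi U F G p \<delta> + psi U F' G' p \<delta> = 0" unfolding psi_outside[OF n] by simp
qed

lemma psi_smult:
  assumes U: "openin (ktop X) U" and F: "F \<in> secF U" and G: "G \<in> secG U" and r: "r \<in> kreg X U"
  shows "psi U (\<lambda>v w. r (hclass v) * F v w) (\<lambda>v w. r (hclass v) * G v w) = (\<lambda>p \<delta>. r p * psi U F G p \<delta>)"
proof (rule psi_eqI[OF U sec_smult[OF U F r] sec_smult[OF U G r]])
  fix p \<delta> assume p: "p \<in> U - S" and \<delta>: "\<delta> \<in> tangent X p"
  have pU: "p \<in> U" using p by blast
  obtain i j s t where pc: "p = chart i j s t" using openE[OF U pU] .
  have "frm (\<lambda>v w. r (hclass v) * F v w) (\<lambda>v w. r (hclass v) * G v w) i j s t \<delta> = r p * psi U F G p \<delta>"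
    using p \<delta> psi_chart[OF F G, of i j s t \<delta>] unfolding pc frm_def val_smult
    by (simp add: algebra_simps)
  then show "\<exists>i j s t. p = chart i j s t \<and>
      frm (\<lambda>v w. r (hclass v) * F v w) (\<lambda>v w. r (hclass v) * G v w) i j s t \<delta> = r p * psi U F G p \<delta>"
    using pc by blast
next
  fix p \<delta> assume n: "\<not> (p \<in> U - S \<and> \<delta> \<in> tangent X p)"
  show "r p * psi U F G p \<delta> = 0" unfolding psi_outside[OF n] by simp
qed

lemma log_form_outside:
  "\<omega> \<in> log_form1 X S U \<Longrightarrow> \<not> (p \<in> U - S \<and> \<delta> \<in> tangent X p) \<Longrightarrow> \<omega> p \<delta> = 0"
  unfolding log_form1_def regular_form1_def by blast

text \<open>By \<open>log_form_coeffs\<close> the functions P \<omega>(d/ds) and Q \<omega>(d/dt)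
  extend regularly across \<open>S\<close>; \<open>gen\<close> turns these extensions into sections
  of the two sheaves.\<close>

lemma psi_locally_surj:
  assumes U: "openin (ktop X) U" and \<omega>: "\<omega> \<in> log_form1 X S U" and p: "p \<in> U"
  shows "\<exists>W F G. openin (ktop X) W \<and> p \<in> W \<and> W \<subseteq> U \<and> F \<in> secF W \<and> G \<in> secG W \<and>
    psi W F G = (\<lambda>p \<delta>. if p \<in> W then \<omega> p \<delta> else 0)"
proof -
  obtain i j s t where pc: "p = chart i j s t" using openE[OF U p] .
  have c: "chart i j s t \<in> U" using p pc by simp
  have \<omega>reg: "\<omega> \<in> regular_form1 X (U - S)" using \<omega> by (simp add: log_form1_def)
  obtain \<psi>1 \<psi>2 where \<psi>: "reg2 \<psi>1 s t" "reg2 \<psi>2 s t" "near s t (\<lambda>s t.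
    poly (pp i) s \<noteq> 0 \<longrightarrow> poly (qq j) t \<noteq> 0 \<longrightarrow>
      \<psi>1 s t = poly (pp i) s * coeff1 dS i j \<omega> s t \<and> \<psi>2 s t = poly (qq j) t * coeff1 dT i j \<omega> s t)"
    using log_form_coeffs[OF \<omega> c] by blast
  obtain W where W: "openin (ktop X) W" "chart i j s t \<in> W" "W \<subseteq> dom i j"
    and WP: "\<And>s t. chart i j s t \<in> W \<Longrightarrow> (reg2 \<psi>1 s t \<and> reg2 \<psi>2 s t) \<and> chart i j s t \<in> U \<and>
      (poly (pp i) s \<noteq> 0 \<longrightarrow> poly (qq j) t \<noteq> 0 \<longrightarrow>
      \<psi>1 s t = poly (pp i) s * coeff1 dS i j \<omega> s t \<and> \<psi>2 s t = poly (qq j) t * coeff1 dT i j \<omega> s t)"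
    by (rule reg2_section[OF \<psi>(1) near_conj[OF near_conj[OF reg2_near[OF \<psi>(1)] reg2_near[OF \<psi>(2)]]
            near_conj[OF open_near[OF U c] \<psi>(3)]]]) (rule that)
  have WU: "W \<subseteq> U" using W(3) WP by (blast elim: in_domE)
  \<comment> \<open>\<open>frm\<close> multiplies by the sign once more, and the square of the sign
    is 1.\<close>
  let ?r1 = "cut W (\<lambda>q. sgb i * \<psi>1 (sig i q) (tau j q))"
  let ?r2 = "cut W (\<lambda>q. sgb j * \<psi>2 (sig i q) (tau j q))"
  have r: "?r1 \<in> kreg X W" "?r2 \<in> kreg X W"
    by (rule kreg_cutI[OF W(1,3)], simp, intro reg2_mult[OF reg2_const], use WP in blast)+
  define F where "F = gen i j 0 (int a - 2) W ?r1"
  define G where "G = gen i j (int b - 2) (- (int n * (int b - 2))) W ?r2"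
  have F: "F \<in> secF W" and G: "G \<in> secG W"
    unfolding F_def G_def by (intro gen_sec W r)+
  have "psi W F G = (\<lambda>p \<delta>. if p \<in> W then \<omega> p \<delta> else 0)"
  proof (rule psi_eqI[OF W(1) F G])
    fix q \<delta> assume q: "q \<in> W - S" and \<delta>: "\<delta> \<in> tangent X q"
    obtain s t where qc: "q = chart i j s t" using q W(3) by (blast elim: in_domE)
    have cW: "chart i j s t \<in> W" and cU: "chart i j s t \<in> U - S" and \<delta>': "\<delta> \<in> tangent X (chart i j s t)"
      using q qc WU \<delta> by auto
    have nz: "poly (pp i) s \<noteq> 0" "poly (qq j) t \<noteq> 0" using cU by auto
    have "\<psi>1 s t = poly (pp i) s * coeff1 dS i j \<omega> s t" "\<psi>2 s t = poly (qq j) t * coeff1 dT i j \<omega> s t"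
      using WP[OF cW] nz by blast+
    moreover have "val F i j s t = sgb i * \<psi>1 s t" "val G i j s t = sgb j * \<psi>2 s t"
      unfolding F_def G_def val_gen[OF cW] using cW by simp_all
    ultimately have "frm F G i j s t \<delta> = \<omega> q \<delta>"
      using nz form1_coeffs[OF \<omega>reg cU \<delta>'] unfolding qc by (simp add: frm_def mult.assoc)
    then show "\<exists>i j s t. q = chart i j s t \<and> frm F G i j s t \<delta> = (if q \<in> W then \<omega> q \<delta> else 0)"
      using q qc by auto
  next
    fix q \<delta> assume "\<not> (q \<in> W - S \<and> \<delta> \<in> tangent X q)"
    then have "\<not> (q \<in> U - S \<and> \<delta> \<in> tangent X q) \<or> q \<notin> W" by blast
    then show "(if q \<in> W then \<omega> q \<delta> else 0) = 0" using log_form_outside[OF \<omega>] by auto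
  qed
  then show ?thesis using W(1,2) WU F G pc by blast
qed

text \<open>Local preimages agree on overlaps because \<open>psi\<close> is injective over every
  open set. They are therefore values of one global pair, picked out pointwise by definite
  descriptions.\<close>

lemma psi_surj:
  assumes U: "openin (ktop X) U" and \<omega>: "\<omega> \<in> log_form1 X S U"
  shows "\<exists>F\<in>secF U. \<exists>G\<in>secG U. psi U F G = \<omega>"
proof -
  define good where "good W F G \<longleftrightarrow> openin (ktop X) W \<and> W \<subseteq> U \<and> F \<in> secF W \<and> G \<in> secG W \<and>
    psi W F G = (\<lambda>p \<delta>. if p \<in> W then \<omega> p \<delta> else 0)" for W F G
  have ex: "\<exists>W F G. good W F G \<and> p \<in> W" if "p \<in> U" for p
    using psi_locally_surj[OF U \<omega> that] unfolding good_def by blast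
  have uniq: "F v w = F' v w \<and> G v w = G' v w"
    if 1: "good W F G" "hclass v \<in> W" and 2: "good W' F' G'" "hclass v \<in> W'" for W F G W' F' G' v w
  proof -
    let ?V = "W \<inter> W'"
    have V: "openin (ktop X) ?V" "?V \<subseteq> W" "?V \<subseteq> W'" using 1 2 by (auto simp: good_def)
    note g1 = 1(1)[unfolded good_def] and g2 = 2(1)[unfolded good_def]
    have "psi ?V (rst ?V F) (rst ?V G) = (\<lambda>p \<delta>. if p \<in> ?V then psi W F G p \<delta> else 0)"
      using g1 V by (intro psi_restrict) auto
    moreover have "psi ?V (rst ?V F') (rst ?V G') = (\<lambda>p \<delta>. if p \<in> ?V then psi W' F' G' p \<delta> else 0)"
      using g2 V by (intro psi_restrict) auto
    moreover have "(\<lambda>p \<delta>. if p \<in> ?V then psi W F G p \<delta> else 0) =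
        (\<lambda>p \<delta>. if p \<in> ?V then psi W' F' G' p \<delta> else 0)"
      using g1 g2 by (intro ext) auto
    ultimately have eq: "psi ?V (rst ?V F) (rst ?V G) = psi ?V (rst ?V F') (rst ?V G')" by simp
    have s: "rst ?V F \<in> secF ?V" "rst ?V F' \<in> secF ?V" "rst ?V G \<in> secG ?V" "rst ?V G' \<in> secG ?V"
      using g1 g2 by (intro sec_restrict[OF V(1,2)] sec_restrict[OF V(1,3)]; simp)+
    have "rst ?V F = rst ?V F'" "rst ?V G = rst ?V G'"
      using psi_inj[OF V(1) s eq] by blast+
    from fun_cong[OF fun_cong[OF this(1), of v], of w] fun_cong[OF fun_cong[OF this(2), of v], of w]
    show ?thesis using 1(2) 2(2) by simp
  qed
  define P where "P v w \<longleftrightarrow> hclass v \<in> U \<and> w \<in> scroll_proj n n (hclass v)" for v w :: "nat \<Rightarrow> 'k"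
  define F where "F v w = (if P v w then THE x. \<exists>W F G. good W F G \<and> hclass v \<in> W \<and> x = F v w else 0)" for v w
  define G where "G v w = (if P v w then THE x. \<exists>W F G. good W F G \<and> hclass v \<in> W \<and> x = G v w else 0)" for v w
  have FG: "F v w = F' v w" "G v w = G' v w"
    if g: "good W F' G'" "hclass v \<in> W" and w: "w \<in> scroll_proj n n (hclass v)" for W F' G' v w
  proof -
    have P: "P v w" using g w unfolding good_def P_def by blast
    have "(THE x. \<exists>W F G. good W F G \<and> hclass v \<in> W \<and> x = F v w) = F' v w"
    proof (rule the_equality)
      show "\<exists>W F G. good W F G \<and> hclass v \<in> W \<and> F' v w = F v w" using g by blast
    qed (elim exE conjE, use uniq[OF _ _ g] in simp)
    then show "F v w = F' v w" using P by (simp add: F_def)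
    have "(THE x. \<exists>W F G. good W F G \<and> hclass v \<in> W \<and> x = G v w) = G' v w"
    proof (rule the_equality)
      show "\<exists>W F G. good W F G \<and> hclass v \<in> W \<and> G' v w = G v w" using g by blast
    qed (elim exE conjE, use uniq[OF _ _ g] in simp)
    then show "G v w = G' v w" using P by (simp add: G_def)
  qed
  have Fs: "F \<in> secF U"
  proof (rule sec_localI)
    fix p assume "p \<in> U"
    then obtain W F' G' where g: "good W F' G'" "p \<in> W" using ex by blast
    then show "\<exists>W G. openin (ktop X) W \<and> p \<in> W \<and> W \<subseteq> U \<and> G \<in> secF W \<and>
        (\<forall>v w. hclass v \<in> W \<longrightarrow> w \<in> scroll_proj n n (hclass v) \<longrightarrow> F v w = G v w)"
      using FG(1)[OF g(1)] unfolding good_def by (intro exI[of _ W] exI[of _ F']) simp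
  qed (auto simp: F_def P_def)
  have Gs: "G \<in> secG U"
  proof (rule sec_localI)
    fix p assume "p \<in> U"
    then obtain W F' G' where g: "good W F' G'" "p \<in> W" using ex by blast
    then show "\<exists>W F. openin (ktop X) W \<and> p \<in> W \<and> W \<subseteq> U \<and> F \<in> secG W \<and>
        (\<forall>v w. hclass v \<in> W \<longrightarrow> w \<in> scroll_proj n n (hclass v) \<longrightarrow> G v w = F v w)"
      using FG(2)[OF g(1)] unfolding good_def by (intro exI[of _ W] exI[of _ G']) simp
  qed (auto simp: G_def P_def)
  have "psi U F G = \<omega>"
  proof (rule psi_eqI[OF U Fs Gs log_form_outside[OF \<omega>]])
    fix p \<delta> assume p: "p \<in> U - S" and \<delta>: "\<delta> \<in> tangent X p"
    then obtain W F' G' where g: "good W F' G'" "p \<in> W" using ex by blast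
    have o: "openin (ktop X) W" and s: "F' \<in> secF W" "G' \<in> secG W"
      and e: "psi W F' G' = (\<lambda>p \<delta>. if p \<in> W then \<omega> p \<delta> else 0)" using g(1) by (simp_all add: good_def)
    obtain i j s t where pc: "p = chart i j s t" using openE[OF o g(2)] .
    have h: "hclass (smc i j s t) \<in> W" using g(2) pc by (simp add: chart_def)
    have w: "aff i s \<in> scroll_proj n n (hclass (smc i j s t))"
      using aff_in_proj[of i s j t] by (simp add: chart_def)
    have "frm F G i j s t \<delta> = frm F' G' i j s t \<delta>"
      unfolding frm_def val_def FG(1)[OF g(1) h w] FG(2)[OF g(1) h w] ..
    also have "\<dots> = psi W F' G' p \<delta>"
      using psi_chart[OF s, of i j s t \<delta>] p g(2) \<delta> unfolding pc by auto
    also have "\<dots> = \<omega> p \<delta>" using g(2) by (simp add: e)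
    finally show "\<exists>i j s t. p = chart i j s t \<and> frm F G i j s t \<delta> = \<omega> p \<delta>" using pc by blast
  qed
  then show ?thesis using Fs Gs by blast
qed

lemma scroll_sheaf_simps:
  "F \<oplus>\<^bsub>osec (scroll_sheaf n n \<beta> m) U\<^esub> G = (\<lambda>v w. F v w + G v w)"
  "r \<odot>\<^bsub>osec (scroll_sheaf n n \<beta> m) U\<^esub> F = (\<lambda>v w. r (hclass v) * F v w)"
  "ores (scroll_sheaf n n \<beta> m) U V F = (\<lambda>v w. if hclass v \<in> V then F v w else 0)"
  by (simp_all add: scroll_sheaf_def twist_def)

lemma log_sheaf_isomorphic:
  assumes D: "\<Union>D = S"
  shows "omodule_isomorphic X (log_sheaf X D)
    (omodule_sum (scroll_sheaf n n 0 (int a - 2)) (scroll_sheaf n n (int b - 2) (- (int n * (int b - 2)))))"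
proof -
  let ?M = "omodule_sum (scroll_sheaf n n 0 (int a - 2)) (scroll_sheaf n n (int b - 2) (- (int n * (int b - 2))))"
  define ps where "ps U = (\<lambda>(F, G). psi U F G)" for U
  \<comment> \<open>The isomorphism is required to start at the logarithmic sheaf, so it is the
    inverse of \<open>psi\<close>; linearity and naturality are transported by writing each form as
    \<open>psi U F G\<close>.\<close>
  define \<phi> where "\<phi> U = inv_into (secF U \<times> secG U) (ps U)" for U
  have bij: "bij_betw (ps U) (secF U \<times> secG U) (log_form1 X S U)" if U: "openin (ktop X) U" for U
    unfolding bij_betw_def
  proof (intro conjI equalityI subsetI)
    show "inj_on (ps U) (secF U \<times> secG U)"
      by (auto simp: inj_on_def ps_def dest: psi_inj[OF U])
    show "\<omega> \<in> log_form1 X S U" if "\<omega> \<in> ps U ` (secF U \<times> secG U)" for \<omega>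
      using that psi_log_form[OF U] by (auto simp: ps_def)
    show "\<omega> \<in> ps U ` (secF U \<times> secG U)" if "\<omega> \<in> log_form1 X S U" for \<omega>
      using psi_surj[OF U that] by (force simp: ps_def)
  qed
  have inv: "\<phi> U (psi U F G) = (F, G)"
    if "openin (ktop X) U" "F \<in> secF U" "G \<in> secG U" for U F G
    using bij_betw_inv_into_left[OF bij[OF that(1)], of "(F, G)"] that by (simp add: \<phi>_def ps_def)
  have E: "\<exists>F\<in>secF U. \<exists>G\<in>secG U. \<omega> = psi U F G"
    if "openin (ktop X) U" "\<omega> \<in> carrier (osec (log_sheaf X D) U)" for U \<omega>
    using psi_surj[OF that(1), of \<omega>] that(2) unfolding log_sheaf_def D by fastforce
  show ?thesis
    unfolding omodule_isomorphic_def
  proof (intro exI[of _ \<phi>] conjI allI impI ballI)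
    fix U :: "'k ppoint set" assume U: "openin (ktop X) U"
    show "bij_betw (\<phi> U) (carrier (osec (log_sheaf X D) U)) (carrier (osec ?M U))"
      using bij_betw_inv_into[OF bij[OF U]] by (simp add: \<phi>_def log_sheaf_def omodule_sum_def D)
  next
    fix U :: "'k ppoint set" and \<omega> \<omega>'
    assume U: "openin (ktop X) U" and \<omega>: "\<omega> \<in> carrier (osec (log_sheaf X D) U)"
      "\<omega>' \<in> carrier (osec (log_sheaf X D) U)"
    obtain F G where FG: "F \<in> secF U" "G \<in> secG U" "\<omega> = psi U F G"
      using E[OF U \<omega>(1)] by blast
    obtain F' G' where FG': "F' \<in> secF U" "G' \<in> secG U" "\<omega>' = psi U F' G'"
      using E[OF U \<omega>(2)] by blast
    have "\<omega> \<oplus>\<^bsub>osec (log_sheaf X D) U\<^esub> \<omega>' = psi U (\<lambda>v w. F v w + F' v w) (\<lambda>v w. G v w + G' v w)"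
      unfolding psi_add[OF U FG(1) FG'(1) FG(2) FG'(2)] FG FG' by (simp add: log_sheaf_def)
    then show "\<phi> U (\<omega> \<oplus>\<^bsub>osec (log_sheaf X D) U\<^esub> \<omega>') = \<phi> U \<omega> \<oplus>\<^bsub>osec ?M U\<^esub> \<phi> U \<omega>'"
      unfolding FG(3) FG'(3) inv[OF U FG(1,2)] inv[OF U FG'(1,2)]
      by (simp add: inv[OF U sec_add[OF U FG(1) FG'(1)] sec_add[OF U FG(2) FG'(2)]]
          omodule_sum_def scroll_sheaf_simps)
  next
    fix U :: "'k ppoint set" and r \<omega>
    assume U: "openin (ktop X) U" and r: "r \<in> carrier (kring X U)"
      and \<omega>: "\<omega> \<in> carrier (osec (log_sheaf X D) U)"
    have r: "r \<in> kreg X U" using r by (simp add: kring_def)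
    obtain F G where FG: "F \<in> secF U" "G \<in> secG U" "\<omega> = psi U F G"
      using E[OF U \<omega>] by blast
    have "r \<odot>\<^bsub>osec (log_sheaf X D) U\<^esub> \<omega> = psi U (\<lambda>v w. r (hclass v) * F v w) (\<lambda>v w. r (hclass v) * G v w)"
      unfolding psi_smult[OF U FG(1,2) r] FG by (simp add: log_sheaf_def)
    then show "\<phi> U (r \<odot>\<^bsub>osec (log_sheaf X D) U\<^esub> \<omega>) = r \<odot>\<^bsub>osec ?M U\<^esub> \<phi> U \<omega>"
      unfolding FG(3) inv[OF U FG(1,2)]
      by (simp add: inv[OF U sec_smult[OF U FG(1) r] sec_smult[OF U FG(2) r]]
          omodule_sum_def scroll_sheaf_simps)
  next
    fix U V :: "'k ppoint set" and \<omega>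
    assume UV: "openin (ktop X) U \<and> openin (ktop X) V \<and> V \<subseteq> U"
      and \<omega>: "\<omega> \<in> carrier (osec (log_sheaf X D) U)"
    have U: "openin (ktop X) U" and V: "openin (ktop X) V" "V \<subseteq> U" using UV by auto
    obtain F G where FG: "F \<in> secF U" "G \<in> secG U" "\<omega> = psi U F G"
      using E[OF U \<omega>] by blast
    have "ores (log_sheaf X D) U V \<omega> = psi V (rst V F) (rst V G)"
      unfolding psi_restrict[OF U V FG(1,2)] FG by (simp add: log_sheaf_def)
    then show "\<phi> V (ores (log_sheaf X D) U V \<omega>) = ores ?M U V (\<phi> U \<omega>)"
      unfolding FG(3) inv[OF U FG(1,2)]
      by (simp add: inv[OF V(1) sec_restrict[OF V FG(1)] sec_restrict[OF V FG(2)]]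
          omodule_sum_def scroll_sheaf_simps)
  qed
qed

end

section \<open>Global sections and linear systems\<close>

definition reg1 :: "('k::field \<Rightarrow> 'k) \<Rightarrow> 'k \<Rightarrow> bool" where
  "reg1 \<phi> x \<longleftrightarrow> (\<exists>A B. poly B x \<noteq> 0 \<and> (\<forall>y. poly B y \<noteq> 0 \<longrightarrow> \<phi> y = poly A y / poly B y))"

lemma reg2_reg1_fst: "reg2 \<phi> s t \<Longrightarrow> reg1 (\<lambda>s. \<phi> s t) s"
  unfolding reg2_def rep_def ev_def reg1_def by blast

lemma reg2_reg1_snd: "reg2 \<phi> s t \<Longrightarrow> reg1 (\<lambda>t. \<phi> s t) t"
  unfolding reg2_def rep_def reg1_def by (metis ev_fixed_fst)

text \<open>A denominator of least degree has no root: it would be a common root with the numerator.\<close>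

lemma everywhere_reg1_polynomial:
  fixes \<phi> :: "'k::{alg_closed_field, field_char_0} \<Rightarrow> 'k"
  assumes reg: "\<And>x. reg1 \<phi> x"
  obtains p where "\<And>x. \<phi> x = poly p x"
proof -
  \<comment> \<open>The relation is demanded only off the zeros of some \<open>C\<close>, so that a
    common factor x - r can be cancelled at the price of enlarging \<open>C\<close>.\<close>
  define good where "good B \<longleftrightarrow> B \<noteq> 0 \<and>
    (\<exists>A C. C \<noteq> 0 \<and> (\<forall>x. poly C x \<noteq> 0 \<longrightarrow> \<phi> x * poly B x = poly A x))" for B
  have "\<exists>B. good B"
  proof -
    obtain A B where "poly B 0 \<noteq> 0" "\<forall>y. poly B y \<noteq> 0 \<longrightarrow> \<phi> y = poly A y / poly B y"
      using reg[of 0] unfolding reg1_def by blast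
    then have "good B" unfolding good_def by (intro conjI exI[of _ A] exI[of _ B]) auto
    then show ?thesis by blast
  qed
  then obtain B where B: "good B" and least: "\<And>B'. good B' \<Longrightarrow> degree B \<le> degree B'"
    using ex_has_least_nat[of good _ degree] by blast
  obtain A C where B0: "B \<noteq> 0" and C: "C \<noteq> 0" and eq: "\<And>x. poly C x \<noteq> 0 \<Longrightarrow> \<phi> x * poly B x = poly A x"
    using B unfolding good_def by blast
  have cross: "A * B1 = A1 * B" if "B1 \<noteq> 0" "\<forall>y. poly B1 y \<noteq> 0 \<longrightarrow> \<phi> y = poly A1 y / poly B1 y" for A1 B1
  proof -
    have "A * B1 - A1 * B = 0"
    proof (rule poly_vanishing_off_eq_0[of "C * B1"])
      fix x assume "poly (C * B1) x \<noteq> 0"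
      then have nz: "poly C x \<noteq> 0" "poly B1 x \<noteq> 0" by auto
      then have "\<phi> x = poly A1 x / poly B1 x" using that by blast
      then have "poly A1 x = \<phi> x * poly B1 x" using nz(2) by simp
      then show "poly (A * B1 - A1 * B) x = 0" using eq[OF nz(1), symmetric] by simp
    qed (use C that in simp)
    then show ?thesis by simp
  qed
  have "degree B = 0"
  proof (rule ccontr)
    assume "degree B \<noteq> 0"
    then obtain r where r: "poly B r = 0" using alg_closed_imp_poly_has_root[of B] by auto
    obtain A1 B1 where 1: "poly B1 r \<noteq> 0" "\<forall>y. poly B1 y \<noteq> 0 \<longrightarrow> \<phi> y = poly A1 y / poly B1 y"
      using reg[of r] unfolding reg1_def by blast
    have "B1 \<noteq> 0" using 1(1) by auto
    from cross[OF this 1(2)] have "poly (A * B1) r = poly (A1 * B) r" by simp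
    then have "poly A r = 0" using r 1(1) by simp
    then obtain A' where A': "A = [:- r, 1:] * A'" by (auto simp: poly_eq_0_iff_dvd)
    obtain B' where B': "B = [:- r, 1:] * B'" using r by (auto simp: poly_eq_0_iff_dvd)
    have "B' \<noteq> 0" using B0 B' by auto
    have "good B'" unfolding good_def
    proof (rule conjI, fact, rule exI[of _ A'], rule exI[of _ "C * [:- r, 1:]"], intro conjI allI impI)
      fix x assume "poly (C * [:- r, 1:]) x \<noteq> 0"
      then have "poly C x \<noteq> 0" "x - r \<noteq> 0" by auto
      moreover have "\<phi> x * ((x - r) * poly B' x) = (x - r) * poly A' x"
        using eq[OF \<open>poly C x \<noteq> 0\<close>] unfolding A' B' by (simp add: algebra_simps)
      ultimately show "\<phi> x * poly B' x = poly A' x" by simp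
    qed (use C in \<open>simp del: mult_pCons_right\<close>)
    then have "degree B \<le> degree B'" by (rule least)
    moreover have "degree B = Suc (degree B')"
      unfolding B' using \<open>B' \<noteq> 0\<close> by (simp add: degree_mult_eq del: mult_pCons_left)
    ultimately show False by simp
  qed
  then obtain \<beta> where \<beta>: "B = [:\<beta>:]" by (metis degree_eq_zeroE)
  then have \<beta>0: "\<beta> \<noteq> 0" using B0 by auto
  \<comment> \<open>So far the relation is known off the zeros of \<open>C\<close>. Comparison with
    a fraction that is valid at \<open>x\<close> itself yields it at every point.\<close>
  have "\<phi> x = poly (Polynomial.smult (inverse \<beta>) A) x" for x
  proof -
    obtain A1 B1 where 1: "poly B1 x \<noteq> 0" "\<forall>y. poly B1 y \<noteq> 0 \<longrightarrow> \<phi> y = poly A1 y / poly B1 y"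
      using reg[of x] unfolding reg1_def by blast
    have "B1 \<noteq> 0" using 1(1) by auto
    then have "A * B1 = A1 * B" by (rule cross[OF _ 1(2)])
    from arg_cong[OF this, of "\<lambda>p. poly p x"] have "poly A x * poly B1 x = poly A1 x * \<beta>"
      unfolding \<beta> by simp
    moreover have "poly A1 x = \<phi> x * poly B1 x" using 1 by simp
    ultimately have "poly A x * poly B1 x = (\<beta> * \<phi> x) * poly B1 x"
      by (simp only: ac_simps)
    then have "poly A x = \<beta> * \<phi> x" using mult_right_cancel[OF 1(1)] by blast
    then show ?thesis using \<beta>0 by simp
  qed
  then show thesis by (rule that)
qed

text \<open>Multiplication by s^(degree q) turns q(1 / s) into the reflected polynomial, whose
  degree is at most that of q; the bound follows by comparing degrees. It expresses that sections of
  O(m) on the line are forms of degree m.\<close>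

lemma transition_degree_le:
  fixes p q :: "'k::field_char_0 poly"
  assumes eq: "\<And>s. s \<noteq> 0 \<Longrightarrow> poly p s = s ^ m * poly q (inverse s)"
  shows "degree p \<le> m"
proof (cases "p = 0")
  case False
  have "monom 1 (degree q) * p - monom 1 m * reflect_poly q = 0"
  proof (rule poly_vanishing_off_eq_0[of "[:0, 1:]"])
    fix s :: 'k assume "poly [:0, 1:] s \<noteq> 0"
    then have "s \<noteq> 0" by simp
    then show "poly (monom 1 (degree q) * p - monom 1 m * reflect_poly q) s = 0"
      by (simp add: eq poly_monom poly_reflect_poly_nz)
  qed simp
  then have e: "monom 1 (degree q) * p = monom 1 m * reflect_poly q" by simp
  moreover have "monom (1::'k) (degree q) * p \<noteq> 0" using False by simp
  ultimately have "reflect_poly q \<noteq> 0" by auto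
  then have "degree q + degree p = m + degree (reflect_poly q)"
    using arg_cong[OF e, of degree] False by (simp add: degree_mult_eq degree_monom_eq)
  then show ?thesis using degree_reflect_poly_le[of q] by linarith
qed simp

text \<open>A nonzero linear form on the line, restricted to the two affine lines given by \<open>aff\<close>.\<close>

definition linear_form :: "(bool \<Rightarrow> 'k::field poly) \<Rightarrow> bool" where
  "linear_form l \<longleftrightarrow> (\<exists>\<gamma> \<gamma>'. \<not> (\<gamma> = 0 \<and> \<gamma>' = 0) \<and> l False = [:\<gamma>, \<gamma>':] \<and> l True = [:\<gamma>', \<gamma>:])"

lemma linear_form_flip:
  assumes "linear_form l" "s * s' = 1" shows "poly (l i) s = s * poly (l (\<not> i)) s'"
proof -
  obtain \<gamma> \<gamma>' where l: "l False = [:\<gamma>, \<gamma>':]" "l True = [:\<gamma>', \<gamma>:]"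
    using assms(1) by (auto simp: linear_form_def)
  have "s * (x + s' * y) = s * x + y" for x y
    using assms(2) by (simp add: distrib_left flip: mult.assoc)
  then show ?thesis using l by (cases i) (simp_all add: mult.commute)
qed

text \<open>Linear forms on the line with a common zero are proportional, so their zeros agree on
  both charts. This shows that distinct rulings of one family are disjoint.\<close>

lemma linear_form_common_root:
  assumes l: "linear_form l" "linear_form l'" and root: "poly (l i) s = 0" "poly (l' i) s = 0"
  shows "poly (l j) t = 0 \<longleftrightarrow> poly (l' j) t = 0"
proof -
  obtain \<gamma> \<gamma>' where g: "\<not> (\<gamma> = 0 \<and> \<gamma>' = 0)" "l False = [:\<gamma>, \<gamma>':]" "l True = [:\<gamma>', \<gamma>:]"
    using l(1) by (auto simp: linear_form_def)
  obtain \<epsilon> \<epsilon>' where e: "\<not> (\<epsilon> = 0 \<and> \<epsilon>' = 0)" "l' False = [:\<epsilon>, \<epsilon>':]" "l' True = [:\<epsilon>', \<epsilon>:]"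
    using l(2) by (auto simp: linear_form_def)
  have r: "(\<gamma> = - (s * \<gamma>') \<and> \<epsilon> = - (s * \<epsilon>')) \<or> (\<gamma>' = - (s * \<gamma>) \<and> \<epsilon>' = - (s * \<epsilon>))"
    using root g e by (cases i) (auto simp: eq_neg_iff_add_eq_0)
  then have "\<exists>c. c \<noteq> 0 \<and> \<epsilon> = c * \<gamma> \<and> \<epsilon>' = c * \<gamma>'"
  proof
    assume "\<gamma> = - (s * \<gamma>') \<and> \<epsilon> = - (s * \<epsilon>')"
    then show ?thesis using g(1) e(1) by (intro exI[of _ "\<epsilon>' / \<gamma>'"]) auto
  next
    assume "\<gamma>' = - (s * \<gamma>) \<and> \<epsilon>' = - (s * \<epsilon>)"
    then show ?thesis using g(1) e(1) by (intro exI[of _ "\<epsilon> / \<gamma>"]) auto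
  qed
  then obtain c where c: "c \<noteq> 0" "\<epsilon> = c * \<gamma>" "\<epsilon>' = c * \<gamma>'" by blast
  have "poly (l' j) t = c * poly (l j) t"
    using g e c by (cases j) (simp_all add: algebra_simps)
  then show ?thesis using c(1) by simp
qed

text \<open>Global sections of O(1, 0) on the product of two lines: for fixed s the function is
  polynomial in t of degree 0, and then polynomial in s of degree at most 1. The abstract
  \<open>g\<close> allows the use with the two factors exchanged.\<close>

lemma linear_section:
  fixes g :: "bool \<Rightarrow> bool \<Rightarrow> 'k::{alg_closed_field, field_char_0} \<Rightarrow> 'k \<Rightarrow> 'k"
  assumes r1: "\<And>i j s t. reg1 (\<lambda>s. g i j s t) s" and r2: "\<And>i j s t. reg1 (\<lambda>t. g i j s t) t"
    and t1: "\<And>i j s s' t. s * s' = 1 \<Longrightarrow> g i j s t = s * g (\<not> i) j s' t"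
    and t2: "\<And>i j s t t'. t * t' = 1 \<Longrightarrow> g i j s t = g i (\<not> j) s t'"
  shows "\<exists>l. (\<forall>i j s t. g i j s t = poly (l i) s) \<and>
    (linear_form l \<or> (\<forall>i s. poly (l i) s = 0))"
proof -
  have "\<exists>p. \<forall>t. g i j s t = poly p t" for i j s
    by (rule everywhere_reg1_polynomial[OF r2]) blast
  then obtain P where P: "\<And>i j s t. g i j s t = poly (P i j s) t" by metis
  have "degree (P i j s) \<le> 0" for i j s
  proof (rule transition_degree_le)
    fix t :: 'k assume "t \<noteq> 0"
    then show "poly (P i j s) t = t ^ 0 * poly (P i (\<not> j) s) (inverse t)"
      using t2[of t "inverse t" i j s] by (simp add: P)
  qed
  \<comment> \<open>The base value 1 is fixed by t -> 1 / t, so the two values of \<open>j\<close>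
    can be compared there.\<close>
  then have const: "g i j s t = g i j s 1" for i j s t
    unfolding P by (metis degree_eq_zeroE le_zero_eq poly_pCons poly_0 mult_zero_right)
  have "\<exists>p. \<forall>s. g i False s 1 = poly p s" for i
    by (rule everywhere_reg1_polynomial[OF r1]) blast
  then obtain l where l: "\<And>i s. g i False s 1 = poly (l i) s" by metis
  have g: "g i j s t = poly (l i) s" for i j s t
    using const[of i j s t] t2[of 1 1 i j s] l[of i s] by (cases j) simp_all
  have tr: "poly (l i) s = s * poly (l (\<not> i)) (inverse s)" if "s \<noteq> 0" for i s
    using t1[of s "inverse s" i False 1] that by (simp add: g)
  have deg: "\<exists>x y. l i = [:x, y:]" for i
  proof -
    have "degree (l i) \<le> 1" by (rule transition_degree_le[of _ _ "l (\<not> i)"]) (simp only: power_one_right, rule tr)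
    then have "l i = [:coeff (l i) 0, coeff (l i) 1:]"
      by (intro poly_eqI) (auto simp: coeff_pCons coeff_eq_0 split: nat.splits)
    then show ?thesis by (intro exI)
  qed
  obtain x y where xy: "l False = [:x, y:]" using deg by blast
  obtain x' y' where xy': "l True = [:x', y':]" using deg by blast
  have "[:x, y:] - [:y', x':] = 0"
  proof (rule poly_vanishing_off_eq_0[of "[:0, 1:]"])
    fix s :: 'k assume "poly [:0, 1:] s \<noteq> 0"
    then have s: "s \<noteq> 0" by simp
    have "s * (x + s * y) = s * (y' + s * x')"
      using tr[OF s, of False] s by (simp add: xy xy' field_simps)
    then have "x + s * y = y' + s * x'" using s by simp
    then show "poly ([:x, y:] - [:y', x':]) s = 0" by (simp add: algebra_simps)
  qed simp
  then have "x' = y" "y' = x" by simp_all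
  then have "linear_form l \<or> (\<forall>i s. poly (l i) s = 0)"
    unfolding linear_form_def using xy xy' by (cases "x = 0 \<and> y = 0") (auto simp: all_bool_eq)
  with g show ?thesis by blast
qed

text \<open>At a root of one factor the others are nonzero, so the derivative of the product is the
  slope of that factor times a nonzero number; a nonzero linear form with a root has nonzero
  slope.\<close>

lemma poly_product_simple_roots:
  fixes l :: "nat \<Rightarrow> bool \<Rightarrow> 'k::field_char_0 poly"
  assumes "finite K" and l: "\<And>k. k \<in> K \<Longrightarrow> linear_form (l k)"
    and distinct: "\<And>k k' x. k \<in> K \<Longrightarrow> k' \<in> K \<Longrightarrow> poly (l k i) x = 0 \<Longrightarrow> poly (l k' i) x = 0 \<Longrightarrow> k = k'"
  shows "simple_roots (\<Prod>k\<in>K. l k i)"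
  unfolding simple_roots_def
proof (intro allI impI)
  fix x assume "poly (\<Prod>k\<in>K. l k i) x = 0"
  then obtain k where k: "k \<in> K" "poly (l k i) x = 0" using assms(1) by (auto simp: poly_prod)
  let ?u = "\<Prod>k'\<in>K - {k}. l k' i"
  have u: "poly ?u x \<noteq> 0" using distinct k assms(1) by (auto simp: poly_prod)
  have "poly (pderiv (l k i)) x \<noteq> 0"
  proof -
    obtain \<gamma> \<gamma>' where g: "\<not> (\<gamma> = 0 \<and> \<gamma>' = 0)" "l k i = [:\<gamma>, \<gamma>':]"
      using l[OF k(1)] by (cases i) (auto simp: linear_form_def)
    then show ?thesis using k(2) by (auto simp: pderiv_pCons)
  qed
  moreover have "(\<Prod>k\<in>K. l k i) = l k i * ?u" by (rule prod.remove[OF assms(1) k(1)])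
  ultimately show "poly (pderiv (\<Prod>k\<in>K. l k i)) x \<noteq> 0" using u k(2) by (simp add: pderiv_mult)
qed

section \<open>Divisors in the two linear systems are rulings\<close>

context balanced_scroll
begin

lemma kreg_one:
  assumes "openin (ktop X) W" shows "cut W (\<lambda>q. 1) \<in> kreg X W"
proof (rule kregI[OF assms cut_out])
  fix p assume p: "p \<in> W"
  obtain i j s t where pc: "p = chart i j s t" using openE[OF assms p] .
  have "reg2 (\<lambda>s t. cut W (\<lambda>q. 1) (chart i j s t)) s t"
    by (rule reg2_cong[OF reg2_const[of 1]]) (use near_cut[OF assms, of i j s t "\<lambda>q. 1"] p pc in simp)
  then show "\<exists>i j s t. p = chart i j s t \<and> reg2 (\<lambda>s t. cut W (\<lambda>q. 1) (chart i j s t)) s t"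
    using pc by blast
qed

text \<open>
  A local equation of \<open>Y\<close> is nonzero off \<open>Y\<close> since it divides \<open>1\<close> there, and a local trivialisation
  is nonzero since it divides a nowhere vanishing section.
\<close>

lemma linear_system_zero_set:
  assumes "in_linear_system X (scroll_sheaf n n \<beta> m) (Y :: 'k::field ppoint set)"
  shows "\<exists>F\<in>sec \<beta> m (topspace (ktop X)). \<forall>i j s t. val F i j s t = 0 \<longleftrightarrow> chart i j s t \<in> Y"
proof -
  let ?T = "topspace (ktop X) :: 'k ppoint set" and ?L = "scroll_sheaf n n \<beta> m"
  have Y: "closedin (ktop X) Y" using assms by (simp add: in_linear_system_def)
  obtain F where F: "F \<in> sec \<beta> m ?T" and loc: "\<forall>p\<in>?T. \<exists>V h e.
      p \<in> V \<and> local_equation X Y V h \<and> e \<in> sec \<beta> m V \<and>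
      (\<forall>W. openin (ktop X) W \<and> W \<subseteq> V \<longrightarrow>
        (\<forall>t\<in>sec \<beta> m W. \<exists>!r. r \<in> kreg X W \<and> t = r \<odot>\<^bsub>osec ?L W\<^esub> ores ?L V W e)) \<and>
      ores ?L ?T V F = h \<odot>\<^bsub>osec ?L V\<^esub> e"
    using assms unfolding in_linear_system_def by (elim exE conjE bexE) (rule that)
  have "val F i j s t = 0 \<longleftrightarrow> chart i j s t \<in> Y" for i j s t
  proof -
    let ?p = "chart i j s t"
    have "?p \<in> ?T" unfolding topspace_X by (rule chart_in_points)
    from bspec[OF loc this] obtain V h e where V: "?p \<in> V" and h: "local_equation X Y V h"
      and triv: "\<forall>W. openin (ktop X) W \<and> W \<subseteq> V \<longrightarrow>
        (\<forall>t\<in>sec \<beta> m W. \<exists>!r. r \<in> kreg X W \<and> t = r \<odot>\<^bsub>osec ?L W\<^esub> ores ?L V W e)"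
      and Fh: "ores ?L ?T V F = h \<odot>\<^bsub>osec ?L V\<^esub> e"
      by (elim exE conjE) (rule that)
    have oV: "openin (ktop X) V" using h by (simp add: local_equation_def)
    have sm: "ores (scroll_sheaf n n \<beta> m) U V F = (\<lambda>v w. if hclass v \<in> V then F v w else 0)"
      "r \<odot>\<^bsub>osec (scroll_sheaf n n \<beta> m) U\<^esub> F = (\<lambda>v w. r (hclass v) * F v w)" for U V F r
      by (simp_all add: scroll_sheaf_def twist_def)
    have "val (ores ?L ?T V F) i j s t = val (h \<odot>\<^bsub>osec ?L V\<^esub> e) i j s t" unfolding Fh ..
    then have Fv: "val F i j s t = h ?p * val e i j s t"
      unfolding sm val_smult val_restrict[OF V] .
    have e0: "val e i j s t \<noteq> 0"
    proof -
      let ?W = "V \<inter> dom i j"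
      have W: "openin (ktop X) ?W" "?W \<subseteq> dom i j" "?W \<subseteq> V" "?p \<in> ?W"
        using oV open_dom V by auto
      have t: "gen i j \<beta> m ?W (cut ?W (\<lambda>q. 1)) \<in> sec \<beta> m ?W"
        by (rule gen_sec[OF W(1,2) kreg_one[OF W(1)]])
      have "\<exists>!r. r \<in> kreg X ?W \<and>
          gen i j \<beta> m ?W (cut ?W (\<lambda>q. 1)) = r \<odot>\<^bsub>osec ?L ?W\<^esub> ores ?L V ?W e"
        using triv[rule_format, OF conjI[OF W(1,3)] t] .
      then obtain r where "gen i j \<beta> m ?W (cut ?W (\<lambda>q. 1)) = r \<odot>\<^bsub>osec ?L ?W\<^esub> ores ?L V ?W e"
        by blast
      then have "val (gen i j \<beta> m ?W (cut ?W (\<lambda>q. 1))) i j s t =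
          val (r \<odot>\<^bsub>osec ?L ?W\<^esub> ores ?L V ?W e) i j s t" by (rule arg_cong)
      also have "\<dots> = r ?p * val (ores ?L V ?W e) i j s t" unfolding sm(2) by (rule val_smult)
      also have "val (ores ?L V ?W e) i j s t = val e i j s t"
        unfolding sm(1) by (rule val_restrict[OF W(4)])
      finally have "1 = r ?p * val e i j s t" unfolding val_gen[OF W(4)] using W(4) by simp
      then show ?thesis by auto
    qed
    have "h ?p = 0 \<longleftrightarrow> ?p \<in> Y"
    proof
      assume "?p \<in> Y"
      then show "h ?p = 0" using h V by (simp add: local_equation_def)
    next
      assume h0: "h ?p = 0"
      show "?p \<in> Y"
      proof (rule ccontr)
        assume pY: "?p \<notin> Y"
        have W: "openin (ktop X) (V - Y)" "V - Y \<subseteq> V" "?p \<in> V - Y"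
          using openin_diff[OF oV Y] V pY by auto
        obtain W' r where "?p \<in> W'" "W' \<subseteq> V - Y" "\<And>q. q \<in> W' \<Longrightarrow> cut (V - Y) (\<lambda>q. 1) q = r q * h q"
          by (rule local_equation_divides[OF h W(1,2) kreg_one[OF W(1)] _ W(3)]) auto
        then have "1 = r ?p * h ?p" using W(3) by (metis cut_in)
        then show False using h0 by simp
      qed
    qed
    with e0 Fv show ?thesis by simp
  qed
  with F show ?thesis by blast
qed

lemma smooth_divisor_subset: "smooth_irreducible_divisor X Y \<Longrightarrow> Y \<subseteq> scroll_points n n"
  using closedin_subset[of "ktop X" Y] by (simp add: smooth_irreducible_divisor_def topspace_X)

lemma smooth_divisor_proper:
  assumes "smooth_irreducible_divisor X Y"
  shows "\<exists>i j s t. chart i j s t \<notin> Y"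
proof (rule ccontr)
  assume "\<not> ?thesis"
  then have "topspace (ktop X) \<subseteq> Y" unfolding topspace_X by (auto elim: scroll_points_chart)
  then show False
    using assms smooth_divisor_subset[OF assms] by (simp add: smooth_irreducible_divisor_def topspace_X)
qed

text \<open>The zero set of the defining section is \<open>Y\<close>, and
  \<open>linear_section\<close> makes the section a linear form in w. The zero form is excluded
  because a prime divisor is a proper subset of the scroll.\<close>

lemma linear_system_fst:
  fixes Y :: "'k::{alg_closed_field, field_char_0} ppoint set"
  assumes "in_linear_system X (scroll_sheaf n n 0 1) Y" "smooth_irreducible_divisor X Y"
  shows "\<exists>l. linear_form l \<and> (\<forall>i j s t. chart i j s t \<in> Y \<longleftrightarrow> poly (l i) s = 0)"
proof -
  obtain F where F: "F \<in> sec 0 1 (topspace (ktop X))"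
    and zero: "\<And>i j s t. val F i j s t = 0 \<longleftrightarrow> chart i j s t \<in> Y"
    using linear_system_zero_set[OF assms(1)] by blast
  have T: "chart i j s t \<in> topspace (ktop X)" for i j and s t :: 'k
    unfolding topspace_X by (rule chart_in_points)
  have "\<exists>l. (\<forall>i j s t. val F i j s t = poly (l i) s) \<and> (linear_form l \<or> (\<forall>i s. poly (l i) s = 0))"
  proof (rule linear_section)
    show "reg1 (\<lambda>s. val F i j s t) s" "reg1 (\<lambda>t. val F i j s t) t" for i j s t
      using reg2_reg1_fst reg2_reg1_snd sec_reg2[OF F T] by blast+
    show "val F i j s t = s * val F (\<not> i) j s' t" if "s * s' = 1" for i j s s' t
      using sec_flip_fst[OF F T that, of i j t] by simp
    show "val F i j s t = val F i (\<not> j) s t'" if "t * t' = 1" for i j s t t'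
      using sec_flip_snd[OF F T that, of i j s] by simp
  qed
  then obtain l where l: "\<And>i j s t. val F i j s t = poly (l i) s"
    "linear_form l \<or> (\<forall>i s. poly (l i) s = 0)" by blast
  have "\<not> (\<forall>i s. poly (l i) s = 0)"
    using smooth_divisor_proper[OF assms(2)] zero l(1) by metis
  then show ?thesis using l zero by (intro exI[of _ l]) auto
qed

lemma linear_system_snd:
  fixes Y :: "'k::{alg_closed_field, field_char_0} ppoint set"
  assumes "in_linear_system X (scroll_sheaf n n 1 (- int n)) Y" "smooth_irreducible_divisor X Y"
  shows "\<exists>l. linear_form l \<and> (\<forall>i j s t. chart i j s t \<in> Y \<longleftrightarrow> poly (l j) t = 0)"
proof -
  obtain F where F: "F \<in> sec 1 (- int n) (topspace (ktop X))"
    and zero: "\<And>i j s t. val F i j s t = 0 \<longleftrightarrow> chart i j s t \<in> Y"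
    using linear_system_zero_set[OF assms(1)] by blast
  have T: "chart i j s t \<in> topspace (ktop X)" for i j and s t :: 'k
    unfolding topspace_X by (rule chart_in_points)
  \<comment> \<open>The bound variables are reordered so that \<open>linear_section\<close> applies
    with the two factors exchanged; the twist - n has removed the factor s^n.\<close>
  have "\<exists>l. (\<forall>j i t s. val F i j s t = poly (l j) t) \<and> (linear_form l \<or> (\<forall>i s. poly (l i) s = 0))"
  proof (rule linear_section)
    show "reg1 (\<lambda>t. val F i j s t) t" "reg1 (\<lambda>s. val F i j s t) s" for i j s t
      using reg2_reg1_fst reg2_reg1_snd sec_reg2[OF F T] by blast+
    show "val F i j s t = t * val F i (\<not> j) s t'" if "t * t' = 1" for i j s t t'
      using sec_flip_snd[OF F T that, of i j s] by simp
    show "val F i j s t = val F (\<not> i) j s' t" if "s * s' = 1" for i j s s' t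
      using sec_flip_fst[OF F T that, of i j t] by simp
  qed
  then obtain l where l: "\<And>i j s t. val F i j s t = poly (l j) t"
    "linear_form l \<or> (\<forall>i s. poly (l i) s = 0)" by blast
  have "\<not> (\<forall>i s. poly (l i) s = 0)"
    using smooth_divisor_proper[OF assms(2)] zero l(1) by metis
  then show ?thesis using l zero by (intro exI[of _ l]) auto
qed

lemma divisor_extensional:
  assumes "smooth_irreducible_divisor X Y" "smooth_irreducible_divisor X Z"
    and "\<And>i j s t. chart i j s t \<in> Y \<longleftrightarrow> chart i j s t \<in> Z"
  shows "Y = Z"
proof -
  have "Y \<subseteq> scroll_points n n" "Z \<subseteq> scroll_points n n"
    using smooth_divisor_subset assms(1,2) by blast+
  then show ?thesis
    using assms(3) by (intro equalityI subsetI) (metis scroll_points_chart subsetD)+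
qed

end

theorem theorem4p5:
  fixes L C :: "nat \<Rightarrow> 'k::{alg_closed_field, field_char_0} ppoint set"
    and a0 a1 a b :: nat and c e :: int
  assumes "0 < a0" and "a0 \<le> a1"
    and "c = int a0 + int a1" and "e = int a1 - int a0"
    and "e = 0"
    and "arrangement (scroll a0 a1) (L ` {1..a} \<union> C ` {1..b})"
    and "inj_on L {1..a}" and "inj_on C {1..b}" and "L ` {1..a} \<inter> C ` {1..b} = {}"
    and "\<And>i. i \<in> {1..a} \<Longrightarrow> line_in (a0 + a1 + 1) (L i)"
    and "\<And>j. j \<in> {1..b} \<Longrightarrow> rational_curve (a0 + a1 + 1) (C j)"
    and "\<And>i. i \<in> {1..a} \<Longrightarrow> in_linear_system (scroll a0 a1) (scroll_sheaf a0 a1 0 1) (L i)"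
    and "\<And>j. j \<in> {1..b} \<Longrightarrow>
           in_linear_system (scroll a0 a1) (scroll_sheaf a0 a1 1 (- int a1)) (C j)"
  shows "omodule_isomorphic (scroll a0 a1)
           (log_sheaf (scroll a0 a1) (L ` {1..a} \<union> C ` {1..b}))
           (omodule_sum
             (scroll_sheaf a0 a1 0 (int a - 2))
             (scroll_sheaf a0 a1 (int b - 2) (c - int b * int a1)))"
proof -
  have a01: "a0 = a1" using assms(4,5) by simp
  interpret balanced_scroll a1 by unfold_locales (use assms(1,2) in simp)
  have smL: "smooth_irreducible_divisor X (L k)" if "k \<in> {1..a}" for k
    using assms(6) that unfolding a01 arrangement_def by blast
  have smC: "smooth_irreducible_divisor X (C k)" if "k \<in> {1..b}" for k
    using assms(6) that unfolding a01 arrangement_def by blast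
  have "\<forall>k\<in>{1..a}. \<exists>l. linear_form l \<and> (\<forall>i j s t. chart i j s t \<in> L k \<longleftrightarrow> poly (l i) s = 0)"
    using linear_system_fst assms(12) smL unfolding a01 by blast
  then obtain l where l: "\<And>k. k \<in> {1..a} \<Longrightarrow> linear_form (l k)"
    "\<And>k i j s t. k \<in> {1..a} \<Longrightarrow> chart i j s t \<in> L k \<longleftrightarrow> poly (l k i) s = 0" by metis
  have "\<forall>k\<in>{1..b}. \<exists>l. linear_form l \<and> (\<forall>i j s t. chart i j s t \<in> C k \<longleftrightarrow> poly (l j) t = 0)"
    using linear_system_snd assms(13) smC unfolding a01 by blast
  then obtain m where m: "\<And>k. k \<in> {1..b} \<Longrightarrow> linear_form (m k)"
    "\<And>k i j s t. k \<in> {1..b} \<Longrightarrow> chart i j s t \<in> C k \<longleftrightarrow> poly (m k j) t = 0" by metis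
  \<comment> \<open>Lines with a common zero have the same points and hence, by injectivity, the
    same index; this gives the simple roots of the product.\<close>
  have dl: "k = k'" if k: "k \<in> {1..a}" "k' \<in> {1..a}" "poly (l k i) x = 0" "poly (l k' i) x = 0" for k k' i x
  proof -
    have "L k = L k'"
      using linear_form_common_root[OF l(1)[OF k(1)] l(1)[OF k(2)] k(3,4)] l(2) k(1,2)
      by (intro divisor_extensional smL) simp_all
    then show ?thesis using assms(7) k(1,2) by (auto dest: inj_onD)
  qed
  have dm: "k = k'" if k: "k \<in> {1..b}" "k' \<in> {1..b}" "poly (m k i) x = 0" "poly (m k' i) x = 0" for k k' i x
  proof -
    have "C k = C k'"
      using linear_form_common_root[OF m(1)[OF k(1)] m(1)[OF k(2)] k(3,4)] m(2) k(1,2)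
      by (intro divisor_extensional smC) simp_all
    then show ?thesis using assms(8) k(1,2) by (auto dest: inj_onD)
  qed
  define pp where "pp i = (\<Prod>k\<in>{1..a}. l k i)" for i
  define qq where "qq i = (\<Prod>k\<in>{1..b}. m k i)" for i
  \<comment> \<open>Each linear form contributes one factor s to the transition law, so the products
    have degrees \<open>a\<close> and \<open>b\<close>.\<close>
  interpret log_scroll a1 pp qq a b
  proof
    show "simple_roots (pp i)" for i
      unfolding pp_def using l(1) dl by (intro poly_product_simple_roots) auto
    show "simple_roots (qq i)" for i
      unfolding qq_def using m(1) dm by (intro poly_product_simple_roots) auto
    show "poly (pp i) s = s ^ a * poly (pp (\<not> i)) s'" if "s * s' = 1" for i s s'
    proof -
      have "poly (pp i) s = (\<Prod>k\<in>{1..a}. s * poly (l k (\<not> i)) s')"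
        unfolding pp_def poly_prod by (intro prod.cong refl linear_form_flip l(1) that)
      then show ?thesis by (simp add: pp_def poly_prod prod.distrib)
    qed
    show "poly (qq i) s = s ^ b * poly (qq (\<not> i)) s'" if "s * s' = 1" for i s s'
    proof -
      have "poly (qq i) s = (\<Prod>k\<in>{1..b}. s * poly (m k (\<not> i)) s')"
        unfolding qq_def poly_prod by (intro prod.cong refl linear_form_flip m(1) that)
      then show ?thesis by (simp add: qq_def poly_prod prod.distrib)
    qed
  qed
  have pts: "p \<in> scroll_points a1 a1" if "p \<in> L k \<and> k \<in> {1..a} \<or> p \<in> C k \<and> k \<in> {1..b}" for p k
    using that smooth_divisor_subset[OF smL] smooth_divisor_subset[OF smC] by blast
  have mem: "chart i j s t \<in> \<Union>(L ` {1..a} \<union> C ` {1..b}) \<longleftrightarrow> chart i j s t \<in> S" for i j s t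
    using l(2) m(2) by (auto simp: pp_def qq_def poly_prod)
  have "\<Union>(L ` {1..a} \<union> C ` {1..b}) = S"
  proof (intro equalityI subsetI)
    fix p assume p: "p \<in> \<Union>(L ` {1..a} \<union> C ` {1..b})"
    then have "p \<in> scroll_points a1 a1" using pts by blast
    then obtain i j s t where "p = chart i j s t" by (rule scroll_points_chart)
    then show "p \<in> S" using p mem[of i j s t] by (simp only:)
  next
    fix p assume p: "p \<in> S"
    then obtain i j s t where "p = chart i j s t" unfolding S_def by blast
    then show "p \<in> \<Union>(L ` {1..a} \<union> C ` {1..b})" using p mem[of i j s t] by (simp only:)
  qed
  \<comment> \<open>For a0 = a1 the constant \<open>c\<close> is 2 a1, so the twist is that of the
    multiple b - 2 of H - a1 f.\<close>
  moreover have "c - int b * int a1 = - (int a1 * (int b - 2))"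
    unfolding assms(3) a01 by (simp add: algebra_simps)
  ultimately show ?thesis unfolding a01 using log_sheaf_isomorphic by simp
qed

end
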